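(* Let $\mathcal T\in\mathbb T$ and $\mathcal T_\star\in\widehat{\mathbb T}$ with $\mathcal T\le\mathcal T_\star$. There exists an operator $\mathcal J_{\mathcal T}^{\mathcal T_\star}:\mathrm{CR}^1_0(\mathcal T)\to\mathrm{CR}^1_0(\mathcal T_\star)$ such that $$\|h_{\mathcal T}^{-1}(v_{\mathcal T}-\mathcal J_{\mathcal T}^{\mathcal T_\star}v_{\mathcal T})\|_\Omega^2+\|\nabla_{NC}(v_{\mathcal T}-\mathcal J_{\mathcal T}^{\mathcal T_\star}v_{\mathcal T})\|_\Omega^2\lesssim\sum_{S\in\mathcal S(\mathcal T)\setminus\mathcal S(\mathcal T_\star)}h_S\,\|[\![\nabla_{NC}v_{\mathcal T}\cdot\boldsymbol t]\!]\|_S^2$$ for all $v_{\mathcal T}\in\mathrm{CR}^1_0(\mathcal T)$, where $\boldsymbol t$ is a tangential unit vector of $S$.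
   Context: $\Omega\subset\mathbb R^2$ is a bounded polygonal domain and $\mathcal T_\bot$ a conforming triangulation of $\Omega$ into closed triangles, each triangle having a designated refinement edge (the edge opposite its newest vertex), such that the matching assumption holds: if $T,T'\in\mathcal T_\bot$ and $T\cap T'$ is the refinement edge of $T$, then it is the refinement edge of $T'$. Newest vertex bisection splits a triangle by joining its newest vertex to the midpoint of its refinement edge; this midpoint is the newest vertex of both children. $\mathbb T$ is the set of all conforming triangulations obtained from $\mathcal T_\bot$ by finitely many newest vertex bisections; $\mathcal T\le\mathcal T_\star$ means that $\mathcal T_\star$ is a refinement of $\mathcal T$. $\mathcal T^\top$ is a formal largest element ($\mathcal T\le\mathcal T^\top$ for all $\mathcal T$) and $\widehat{\mathbb T}=\mathbb T\cup\{\mathcal T^\top\}$. $\mathcal S(\mathcal T)$ is the set of sides (edges, including boundary edges) of $\mathcal T$, and $\mathcal S(\mathcal T)\setminus\mathcal S(\mathcal T^\top):=\mathcal S(\mathcal T)$. $h_{\mathcal T}|_T:=|T|^{1/2}$ for $T\in\mathcal T$, $h_S:=|S|$. $\|\cdot\|_\omega$ is the $L^2(\omega)$ norm. For interior $S=T_1\cap T_2$, $[\![v]\!]|_S:=(v|_{T_1}-v|_{T_2})|_S$ (the sign is irrelevant), and $[\![v]\!]|_S:=v|_S$ for $S\subset\partial\Omega$; so $[\![\nabla_{NC}v_{\mathcal T}\cdot\boldsymbol t]\!]|_S$ is the jump of the tangential derivative across interior sides and its trace on boundary sides. For $\mathcal T\in\mathbb T$, $\mathrm{CR}^1_0(\mathcal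 T)$ is the space of $v\in L^2(\Omega)$ with $v|_T$ affine for each $T\in\mathcal T$ and $\int_S[\![v]\!]\,ds=0$ for all $S\in\mathcal S(\mathcal T)$; $\mathrm{CR}^1_0(\mathcal T^\top):=H^1_0(\Omega)$. $\nabla_{NC}$ is the piecewise gradient (with respect to a common refinement of the triangulations involved; it equals $\nabla$ on $H^1_0(\Omega)$). $A\lesssim B$ means $A\le cB$ with a constant $c>0$ depending only on $\mathcal T_\bot$ (in particular independent of $\mathcal T,\mathcal T_\star,v_{\mathcal T}$). *)

theory Defs
  imports "HOL-Analysis.Analysis"
begin

section \<open>Triangulations and newest vertex bisection\<close>

type_synonym point = "real^2"

text \<open>
  A triangle is stored as its newest vertex together with the two endpoints of the opposite edge,
  its refinement edge.  The endpoints form a set, so every triangle with a designated refinement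
  edge has exactly one representation.
\<close>

datatype marked_triangle = Marked (newest: point) (base: "point set")

definition nondegenerate :: "marked_triangle \<Rightarrow> bool" where
  "nondegenerate T \<longleftrightarrow> card (base T) = 2 \<and> \<not> collinear (insert (newest T) (base T))"

definition vertices :: "marked_triangle \<Rightarrow> point set" where
  "vertices T = insert (newest T) (base T)"

definition tri :: "marked_triangle \<Rightarrow> point set" where
  "tri T = convex hull (vertices T)"

definition refinement_edge :: "marked_triangle \<Rightarrow> point set" where
  "refinement_edge T = convex hull (base T)"

definition tri_sides :: "marked_triangle \<Rightarrow> point set set" where
  "tri_sides T = {closed_segment a b | a b. a \<in> vertices T \<and> b \<in> vertices T \<and> a \<noteq> b}"

text \<open>
  The regularity condition \<open>interior (closure \<Omega>) = \<Omega>\<close> rules out slits, for which a side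
  could be interior to the union of the triangles and at the same time contained in the boundary.
\<close>

definition polygonal_domain :: "point set \<Rightarrow> bool" where
  "polygonal_domain \<Omega> \<longleftrightarrow>
     open \<Omega> \<and> connected \<Omega> \<and> bounded \<Omega> \<and> \<Omega> \<noteq> {} \<and> interior (closure \<Omega>) = \<Omega> \<and>
     (\<exists>F :: (point \<times> point) set. finite F \<and> frontier \<Omega> = (\<Union>(a, b)\<in>F. closed_segment a b))"

definition conforming_triangulation :: "point set \<Rightarrow> marked_triangle set \<Rightarrow> bool" where
  "conforming_triangulation \<Omega> \<T> \<longleftrightarrow>
     finite \<T> \<and> (\<forall>T\<in>\<T>. nondegenerate T) \<and> (\<Union>T\<in>\<T>. tri T) = closure \<Omega> \<and>
     (\<forall>T\<in>\<T>. \<forall>T'\<in>\<T>. T \<noteq> T' \<longrightarrow>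
        tri T \<inter> tri T' = {} \<or>
        (\<exists>z \<in> vertices T \<inter> vertices T'. tri T \<inter> tri T' = {z}) \<or>
        tri T \<inter> tri T' \<in> tri_sides T \<inter> tri_sides T')"

definition matching :: "marked_triangle set \<Rightarrow> bool" where
  "matching \<T> \<longleftrightarrow>
     (\<forall>T\<in>\<T>. \<forall>T'\<in>\<T>. tri T \<inter> tri T' = refinement_edge T \<longrightarrow>
        tri T \<inter> tri T' = refinement_edge T')"

definition children :: "marked_triangle \<Rightarrow> marked_triangle set" where
  "children T = {Marked (midpoint a b) {newest T, a} | a b. a \<noteq> b \<and> base T = {a, b}}"

definition bisection :: "marked_triangle set \<Rightarrow> marked_triangle set \<Rightarrow> bool" where
  "bisection \<T> \<T>' \<longleftrightarrow> (\<exists>T\<in>\<T>. \<T>' = (\<T> - {T}) \<union> children T)"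

text \<open>
  Intermediate partitions in a sequence of bisections may have hanging nodes; only the final result
  has to be conforming.
\<close>

definition admissible :: "point set \<Rightarrow> marked_triangle set \<Rightarrow> marked_triangle set set" where
  "admissible \<Omega> \<T>\<^sub>0 = {\<T>. bisection\<^sup>*\<^sup>* \<T>\<^sub>0 \<T> \<and> conforming_triangulation \<Omega> \<T>}"

datatype triangulation = Mesh "marked_triangle set" | Top

definition admissible_hat :: "point set \<Rightarrow> marked_triangle set \<Rightarrow> triangulation set" where
  "admissible_hat \<Omega> \<T>\<^sub>0 = insert Top (Mesh ` admissible \<Omega> \<T>\<^sub>0)"

fun refined_by :: "triangulation \<Rightarrow> triangulation \<Rightarrow> bool" where
  "refined_by \<T> Top \<longleftrightarrow> True"
| "refined_by Top (Mesh \<M>) \<longleftrightarrow> False"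
| "refined_by (Mesh \<T>) (Mesh \<M>) \<longleftrightarrow> bisection\<^sup>*\<^sup>* \<T> \<M>"

text \<open>
  Taking \<open>sides Top\<close> to be empty encodes the convention that removing the sides of the largest
  element from the sides of a triangulation removes nothing.
\<close>

fun sides :: "triangulation \<Rightarrow> point set set" where
  "sides (Mesh \<T>) = (\<Union>T\<in>\<T>. tri_sides T)"
| "sides Top = {}"

definition mesh_size :: "marked_triangle set \<Rightarrow> point \<Rightarrow> real" where
  "mesh_size \<T> x = sqrt (measure lebesgue (tri (SOME T. T \<in> \<T> \<and> x \<in> tri T)))"


section \<open>Integration along sides\<close>

text \<open>
  A side is integrated over via its arclength parametrization.  The choice of the first endpoint
  only affects the sign of the tangent.
\<close>

definition side_ends :: "point set \<Rightarrow> point \<times> point" where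
  "side_ends S = (SOME (a, b). a \<noteq> b \<and> S = closed_segment a b)"

definition side_length :: "point set \<Rightarrow> real" where
  "side_length S = dist (fst (side_ends S)) (snd (side_ends S))"

definition tangent :: "point set \<Rightarrow> point" where
  "tangent S = (snd (side_ends S) - fst (side_ends S)) /\<^sub>R side_length S"

definition side_integral :: "point set \<Rightarrow> (point \<Rightarrow> real) \<Rightarrow> real" where
  "side_integral S f =
     (\<integral>s. f (fst (side_ends S) + s *\<^sub>R tangent S) \<partial>lebesgue_on {0..side_length S})"

definition L2_norm_side :: "point set \<Rightarrow> (point \<Rightarrow> real) \<Rightarrow> real" where
  "L2_norm_side S f = sqrt (side_integral S (\<lambda>x. (f x)\<^sup>2))"


section \<open>Function spaces\<close>

text \<open>
  Elements of L2 are represented by functions on the plane; only their values almost everywhere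
  in the domain matter.
\<close>

definition L2 :: "point set \<Rightarrow> (point \<Rightarrow> 'a::euclidean_space) set" where
  "L2 U = {f \<in> borel_measurable (lebesgue_on U). integrable (lebesgue_on U) (\<lambda>x. (norm (f x))\<^sup>2)}"

definition L2_norm :: "point set \<Rightarrow> (point \<Rightarrow> 'a::euclidean_space) \<Rightarrow> real" where
  "L2_norm U f = sqrt (\<integral>x. (norm (f x))\<^sup>2 \<partial>lebesgue_on U)"

fun C_k :: "nat \<Rightarrow> (point \<Rightarrow> real) \<Rightarrow> bool" where
  "C_k 0 f \<longleftrightarrow> continuous_on UNIV f"
| "C_k (Suc k) f \<longleftrightarrow> (\<exists>g. (\<forall>x. GDERIV f x :> g x) \<and> (\<forall>i. C_k k (\<lambda>x. g x $ i)))"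

definition test_functions :: "point set \<Rightarrow> (point \<Rightarrow> real) set" where
  "test_functions U =
     {\<phi>. (\<forall>k. C_k k \<phi>) \<and> compact (closure {x. \<phi> x \<noteq> 0}) \<and> closure {x. \<phi> x \<noteq> 0} \<subseteq> U}"

definition grad :: "(point \<Rightarrow> real) \<Rightarrow> point \<Rightarrow> point" where
  "grad f x = (THE D. GDERIV f x :> D)"

definition weak_grad :: "point set \<Rightarrow> (point \<Rightarrow> real) \<Rightarrow> (point \<Rightarrow> point) \<Rightarrow> bool" where
  "weak_grad U u G \<longleftrightarrow> u \<in> L2 U \<and> G \<in> L2 U \<and>
     (\<forall>\<phi>\<in>test_functions U.
        (\<integral>x. u x *\<^sub>R grad \<phi> x \<partial>lebesgue_on U) = - (\<integral>x. \<phi> x *\<^sub>R G x \<partial>lebesgue_on U))"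

text \<open>The closure of the test functions in the \<open>H\<^sup>1\<close> norm.\<close>

definition H10 :: "point set \<Rightarrow> (point \<Rightarrow> real) set" where
  "H10 U = {u. \<exists>G. weak_grad U u G \<and>
     (\<exists>\<phi>. (\<forall>n::nat. \<phi> n \<in> test_functions U) \<and>
        (\<lambda>n. L2_norm U (\<lambda>x. \<phi> n x - u x)) \<longlonglongrightarrow> 0 \<and>
        (\<lambda>n. L2_norm U (\<lambda>x. grad (\<phi> n) x - G x)) \<longlonglongrightarrow> 0)}"

text \<open>
  The piecewise gradient, defined for functions that are \<open>H\<^sup>1\<close> on every triangle and unique
  up to null sets.
\<close>

definition nc_grad :: "marked_triangle set \<Rightarrow> (point \<Rightarrow> real) \<Rightarrow> point \<Rightarrow> point" where
  "nc_grad \<T> u = (SOME G. \<forall>T\<in>\<T>. weak_grad (interior (tri T)) u G)"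

text \<open>
  The mesh for the piecewise gradient of \<open>v - w\<close>, where \<open>v\<close> belongs to the mesh \<open>\<T>\<close> and
  \<open>w\<close> to a refinement of it: functions belonging to \<open>Top\<close> are globally \<open>H\<^sup>1\<close>,
  so that \<open>\<T>\<close> itself suffices there.
\<close>

fun common_mesh :: "marked_triangle set \<Rightarrow> triangulation \<Rightarrow> marked_triangle set" where
  "common_mesh \<T> (Mesh \<M>) = \<M>"
| "common_mesh \<T> Top = \<T>"

text \<open>
  The restriction of \<open>u\<close> to a closed triangle, as the continuous representative, which is unique
  on the triangle and in particular has values on its sides.
\<close>

definition restr :: "(point \<Rightarrow> real) \<Rightarrow> marked_triangle \<Rightarrow> point \<Rightarrow> real" where
  "restr u T = (SOME g. continuous_on (tri T) g \<and> (AE x in lebesgue_on (tri T). u x = g x))"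

text \<open>On interior sides the sign of the jump depends on the choice of the ordered pair.\<close>

definition jump ::
  "point set \<Rightarrow> marked_triangle set \<Rightarrow> (point \<Rightarrow> real) \<Rightarrow> point set \<Rightarrow> point \<Rightarrow> real" where
  "jump \<Omega> \<T> u S x =
     (if S \<subseteq> frontier \<Omega> then restr u (THE T. T \<in> \<T> \<and> S \<in> tri_sides T) x
      else let (T\<^sub>1, T\<^sub>2) = (SOME (T\<^sub>1, T\<^sub>2). T\<^sub>1 \<in> \<T> \<and> T\<^sub>2 \<in> \<T> \<and> T\<^sub>1 \<noteq> T\<^sub>2 \<and> S = tri T\<^sub>1 \<inter> tri T\<^sub>2)
           in restr u T\<^sub>1 x - restr u T\<^sub>2 x)"

definition affine_on_triangle :: "(point \<Rightarrow> real) \<Rightarrow> marked_triangle \<Rightarrow> bool" where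
  "affine_on_triangle v T \<longleftrightarrow> (\<exists>a b. AE x in lebesgue_on (tri T). v x = a \<bullet> x + b)"

fun CR10 :: "point set \<Rightarrow> triangulation \<Rightarrow> (point \<Rightarrow> real) set" where
  "CR10 \<Omega> (Mesh \<T>) =
     {v \<in> L2 \<Omega>. (\<forall>T\<in>\<T>. affine_on_triangle v T) \<and>
        (\<forall>S\<in>sides (Mesh \<T>). side_integral S (jump \<Omega> \<T> v S) = 0)}"
| "CR10 \<Omega> Top = H10 \<Omega>"

definition tangential_jump ::
  "point set \<Rightarrow> marked_triangle set \<Rightarrow> (point \<Rightarrow> real) \<Rightarrow> point set \<Rightarrow> point \<Rightarrow> real" where
  "tangential_jump \<Omega> \<T> v S = jump \<Omega> \<T> (\<lambda>x. nc_grad \<T> v x \<bullet> tangent S) S"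

text \<open>
  Compatibility with equality almost everywhere makes a map on representatives an operator between
  the spaces of equivalence classes.
\<close>

definition respects_AE ::
  "point set \<Rightarrow> (point \<Rightarrow> real) set \<Rightarrow> ((point \<Rightarrow> real) \<Rightarrow> (point \<Rightarrow> real)) \<Rightarrow> bool" where
  "respects_AE \<Omega> V J \<longleftrightarrow>
     (\<forall>v\<in>V. \<forall>v'\<in>V. (AE x in lebesgue_on \<Omega>. v x = v' x) \<longrightarrow>
        (AE x in lebesgue_on \<Omega>. J v x = J v' x))"

end

theory Submission
  imports Defs
begin

text \<open>
  Let \<open>R\<close> be the set of sides of \<open>\<T>\<close> that are not sides of the finer triangulation.  At a vertex
  \<open>z\<close>, two triangles of \<open>\<T>\<close> are linked when they share a side of \<open>R\<close> that contains \<open>z\<close>.  Each class of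
  linked triangles gets one nodal value: zero if one of its triangles has a boundary side of \<open>R\<close> at \<open>z\<close>,
  and otherwise the value at \<open>z\<close> of the restriction of \<open>v\<close> to some triangle of the class.  The affine
  interpolants of these values on the triangles agree across the sides of \<open>R\<close> and vanish on the
  boundary sides in \<open>R\<close>.

  The jump of a Crouzeix-Raviart function across a side is affine along the side and has mean value
  zero, so at an endpoint it equals, up to its sign, half the length of the side times the jump of the
  tangential derivative.  Passing along a chain of linked triangles, one bounds the distance of the
  nodal values to \<open>v\<close> by these jumps over the sides of \<open>R\<close> at \<open>z\<close> (\<open>nodal_error\<close>,
  \<open>interpolant_error\<close>).  The number of triangles at a vertex is bounded because newest vertex bisection
  preserves a shape parameter exactly (\<open>shape_bound_child\<close>, \<open>card_triangles_at_vertex\<close>).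

  If the target is the space of the refinement, the operator takes the mean values of \<open>v\<close> on the
  unrefined sides and those of the interpolant on all other sides.  These data are single valued on
  each side of the refinement (\<open>cr_operator_CR10\<close>).  On a fine triangle the difference to \<open>v\<close> is an
  affine function whose values at the midpoints of the sides are either zero or values of the nodal
  error.  Its gradient is controlled by the size of the coarse triangle, because a fine triangle with a
  coarse side is as large as the coarse triangle up to a constant (\<open>cr_error\<close>).

  If the target is the largest element, every side belongs to \<open>R\<close> and the interpolant itself is used.
  A class of triangles at \<open>z\<close> that does not reach the boundary consists of all triangles at \<open>z\<close>, since
  it is relatively open and closed in a punctured disc (\<open>star_without_boundary\<close>).  Hence the interpolant
  is continuous and vanishes on the boundary.  A Lipschitz continuous, piecewise affine function that
  vanishes outside the domain is the limit of mollified truncations (\<open>H10I\<close>).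

  The piecewise gradient is determined by its integrals against test functions, so its value on each
  triangle has to be identified by the fundamental lemma of the calculus of variations
  (\<open>weak_grad_unique\<close>, \<open>nc_grad_AE\<close>).
\<close>

section \<open>Barycentric coordinates\<close>

definition cross2 :: "point \<Rightarrow> point \<Rightarrow> real" where
  "cross2 u v = u$1 * v$2 - u$2 * v$1"

text \<open>An affine function is stored as its gradient and its value at the origin, so that equal affine
  functions have equal representations.\<close>

definition aff :: "point \<times> real \<Rightarrow> point \<Rightarrow> real" where
  "aff p x = fst p \<bullet> x + snd p"

text \<open>The barycentric coordinate of the vertex \<open>z\<close>.  Describing it by its values at the vertices avoids an
  enumeration of the vertices.\<close>

definition bary :: "marked_triangle \<Rightarrow> point \<Rightarrow> point \<times> real" where
  "bary T z = (SOME p. aff p z = 1 \<and> (\<forall>w\<in>vertices T - {z}. aff p w = 0))"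

abbreviation bc :: "marked_triangle \<Rightarrow> point \<Rightarrow> point \<Rightarrow> real" where
  "bc T z \<equiv> aff (bary T z)"

definition opp_side :: "marked_triangle \<Rightarrow> point \<Rightarrow> point set" where
  "opp_side T z = convex hull (vertices T - {z})"

abbreviation area :: "marked_triangle \<Rightarrow> real" where
  "area T \<equiv> measure lebesgue (tri T)"

lemma aff_convex:
  assumes "u + v = 1" shows "aff p (u *\<^sub>R x + v *\<^sub>R y) = u * aff p x + v * aff p y"
proof -
  have "u * aff p x + v * aff p y = fst p \<bullet> (u *\<^sub>R x + v *\<^sub>R y) + (u + v) * snd p"
    by (simp add: aff_def inner_add_right distrib_left distrib_right)
  then show ?thesis using assms by (simp add: aff_def)
qed

lemma aff_add: "aff p (x + y) = aff p x + fst p \<bullet> y"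
  by (simp add: aff_def inner_add_right)

lemma aff_diff: "aff p x - aff p y = fst p \<bullet> (x - y)"
  by (simp add: aff_def inner_diff_right)

lemma aff_midpoint: "aff p (midpoint x y) = (aff p x + aff p y) / 2"
  unfolding midpoint_def by (simp add: aff_def inner_add_right field_simps)

lemma continuous_aff: "continuous_on A (aff p)"
  unfolding aff_def by (intro continuous_intros)

lemma aff_sum_coefs: "aff (\<Sum>i\<in>I. c i *\<^sub>R p i) x = (\<Sum>i\<in>I. c i * aff (p i) x)"
  by (simp add: aff_def fst_sum snd_sum inner_sum_left sum.distrib algebra_simps)

lemma aff_minus_coefs: "aff (p - q) x = aff p x - aff q x"
  by (simp add: aff_def inner_diff_left)

lemma collinear_cross2:
  assumes "cross2 (q - p) (r - p) = 0" shows "collinear {p, q, r}"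
proof (cases "q = p")
  case True then show ?thesis by simp
next
  case False
  define u v where "u = q - p" and "v = r - p"
  have u: "u $ 1 \<noteq> 0 \<or> u $ 2 \<noteq> 0" using False by (auto simp: u_def vec_eq_iff forall_2)
  have c: "u$1 * v$2 = u$2 * v$1" using assms by (simp add: cross2_def u_def v_def)
  have "\<exists>k. v = k *\<^sub>R u"
  proof (cases "u $ 1 = 0")
    case True
    then have "v = (v$2 / u$2) *\<^sub>R u" using u c by (auto simp: vec_eq_iff forall_2)
    then show ?thesis by blast
  next
    case False
    then have "v = (v$1 / u$1) *\<^sub>R u" using c by (auto simp: vec_eq_iff forall_2 field_simps)
    then show ?thesis by blast
  qed
  then obtain k where "v = k *\<^sub>R u" by blast
  then have "collinear {0, u, v}" by (auto simp: collinear_lemma)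
  then have "collinear {q, p, r}"
    by (subst collinear_3) (auto simp: u_def v_def insert_commute)
  then show ?thesis by (simp add: insert_commute)
qed

lemma nondegenerateE:
  assumes "nondegenerate T" "z \<in> vertices T"
  obtains q r where "vertices T = {z, q, r}" "z \<noteq> q" "z \<noteq> r" "q \<noteq> r" "cross2 (q - z) (r - z) \<noteq> 0"
proof -
  obtain a b where ab: "base T = {a, b}" "a \<noteq> b"
    using assms(1) by (auto simp: nondegenerate_def card_2_iff)
  let ?n = "newest T"
  have nc: "\<not> collinear {?n, a, b}" using assms(1) ab by (simp add: nondegenerate_def)
  then have d: "?n \<noteq> a" "?n \<noteq> b" by (auto simp: insert_commute)
  have V: "vertices T = {?n, a, b}" by (simp add: vertices_def ab)
  consider "z = ?n" | "z = a" | "z = b" using assms(2) V by auto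
  then obtain q r where "{?n, a, b} = {z, q, r}" "z \<noteq> q" "z \<noteq> r" "q \<noteq> r"
    using d ab(2) by cases (metis, (metis insert_commute)+)
  moreover from this nc have "cross2 (q - z) (r - z) \<noteq> 0" using collinear_cross2[of q z r] by metis
  ultimately show ?thesis using that V by metis
qed

lemma finite_vertices[simp]: "nondegenerate T \<Longrightarrow> finite (vertices T)"
  unfolding nondegenerate_def vertices_def by (metis card.infinite finite_insert zero_neq_numeral)

lemma card_vertices: assumes "nondegenerate T" shows "card (vertices T) = 3"
proof -
  have "newest T \<in> vertices T" by (simp add: vertices_def)
  from nondegenerateE[OF assms this] show ?thesis by force
qed

text \<open>A barycentric coordinate is a quotient of signed areas; its gradient is the side \<open>q - r\<close> rotated by a
  right angle and divided by twice the area.\<close>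

lemma signed_area_quotient_affine:
  "(D::real) \<noteq> 0 \<Longrightarrow> D = cross2 (q - z) (r - z) \<Longrightarrow>
   aff ((vector [(q - r)$2 / D, (r - q)$1 / D]), cross2 q r / D) x = cross2 (q - x) (r - x) / D"
  unfolding aff_def cross2_def by (simp add: inner_vec_def sum_2 field_simps)

lemma affine_function_of_side:
  assumes "cross2 (q - z) (r - z) \<noteq> 0"
  obtains p where "aff p z = 1" "aff p q = 0" "aff p r = 0"
    "norm (fst p) * \<bar>cross2 (q - z) (r - z)\<bar> = dist q r"
proof -
  define D where "D = cross2 (q - z) (r - z)"
  define p where "p = (vector [(q - r)$2 / D, (r - q)$1 / D] :: point, cross2 q r / D)"
  have D: "D \<noteq> 0" using assms by (simp add: D_def)
  have *: "aff p x = cross2 (q - x) (r - x) / D" for x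
    unfolding p_def using signed_area_quotient_affine[OF D D_def] by simp
  have "norm (fst p) = sqrt (((q - r)$2 / D)\<^sup>2 + ((r - q)$1 / D)\<^sup>2)"
    by (simp add: p_def norm_vec_def L2_set_def sum_2)
  also have "\<dots> = sqrt ((((q - r)$1)\<^sup>2 + ((q - r)$2)\<^sup>2) / D\<^sup>2)"
    by (simp add: power_divide add_divide_distrib power2_commute[of "r$1"])
  also have "\<dots> = dist q r / \<bar>D\<bar>"
    by (simp add: real_sqrt_divide dist_norm norm_vec_def L2_set_def sum_2)
  finally have "norm (fst p) * \<bar>D\<bar> = dist q r" using D by simp
  then show ?thesis using that[of p] D * by (auto simp: D_def cross2_def)
qed

lemma bary_vertex:
  assumes "nondegenerate T" "z \<in> vertices T" "w \<in> vertices T"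
  shows "bc T z w = (if w = z then 1 else 0)"
proof -
  obtain q r where V: "vertices T = {z, q, r}" "z \<noteq> q" "z \<noteq> r" "q \<noteq> r" "cross2 (q - z) (r - z) \<noteq> 0"
    using nondegenerateE[OF assms(1,2)] by blast
  obtain p where "aff p z = 1" "aff p q = 0" "aff p r = 0" using affine_function_of_side[OF V(5)] by metis
  then have "aff p z = 1 \<and> (\<forall>w\<in>vertices T - {z}. aff p w = 0)" using V by auto
  from someI[of "\<lambda>p. aff p z = 1 \<and> (\<forall>w\<in>vertices T - {z}. aff p w = 0)", OF this] assms(3) show ?thesis
    unfolding bary_def by auto
qed

text \<open>The gradient of the difference is orthogonal to two linearly independent edges.\<close>

lemma affine_eq_on_triangle:
  assumes "nondegenerate T" "\<And>w. w \<in> vertices T \<Longrightarrow> aff p w = aff q w" shows "p = q"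
proof -
  obtain z q' r where V: "vertices T = {z, q', r}" "cross2 (q' - z) (r - z) \<noteq> 0"
    using nondegenerateE[OF assms(1)] by (metis insertI1 vertices_def)
  define d where "d = fst p - fst q"
  have "d \<bullet> (q' - z) = 0" "d \<bullet> (r - z) = 0"
    using assms(2)[of q'] assms(2)[of z] assms(2)[of r] V(1)
    by (auto simp: d_def aff_def inner_diff_left inner_diff_right)
  then have e: "d$1 * (q' - z)$1 + d$2 * (q' - z)$2 = 0" "d$1 * (r - z)$1 + d$2 * (r - z)$2 = 0"
    by (auto simp: inner_vec_def sum_2)
  have "d$1 * cross2 (q' - z) (r - z) = 0" "d$2 * cross2 (q' - z) (r - z) = 0"
    using e unfolding cross2_def by algebra+
  then have "d = 0" using V(2) by (simp add: vec_eq_iff forall_2)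
  then have "fst p = fst q" by (simp add: d_def)
  moreover have "aff p z = aff q z" using assms(2) V by auto
  ultimately show ?thesis by (auto simp: aff_def prod_eq_iff)
qed

lemma affine_interpolation_coefs:
  assumes "nondegenerate T" shows "p = (\<Sum>z\<in>vertices T. aff p z *\<^sub>R bary T z)"
proof (rule affine_eq_on_triangle[OF assms])
  fix w assume w: "w \<in> vertices T"
  have "(\<Sum>z\<in>vertices T. aff p z * bc T z w) = (\<Sum>z\<in>vertices T. if z = w then aff p w else 0)"
    by (rule sum.cong) (auto simp: bary_vertex[OF assms _ w])
  then show "aff p w = aff (\<Sum>z\<in>vertices T. aff p z *\<^sub>R bary T z) w"
    using w assms by (simp add: aff_sum_coefs)
qed

lemma affine_interpolation:
  assumes "nondegenerate T" shows "aff p x = (\<Sum>z\<in>vertices T. aff p z * bc T z x)"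
  by (subst affine_interpolation_coefs[OF assms, of p]) (simp add: aff_sum_coefs)

lemma bary_sum: assumes "nondegenerate T" shows "(\<Sum>z\<in>vertices T. bc T z x) = 1"
  using affine_interpolation[OF assms, of "(0,1)" x] by (simp add: aff_def)

lemma bary_point:
  assumes "nondegenerate T" shows "(\<Sum>z\<in>vertices T. bc T z x *\<^sub>R z) = x"
proof -
  have "u \<bullet> (\<Sum>z\<in>vertices T. bc T z x *\<^sub>R z) = u \<bullet> x" for u
    using affine_interpolation[OF assms, of "(u,0)" x]
    by (simp add: aff_def inner_sum_right mult.commute)
  then show ?thesis using vector_eq_ldot by blast
qed

lemma tri_iff: assumes "nondegenerate T" shows "x \<in> tri T \<longleftrightarrow> (\<forall>z\<in>vertices T. 0 \<le> bc T z x)"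
proof
  assume "x \<in> tri T"
  then obtain u where u: "\<forall>z\<in>vertices T. 0 \<le> u z" "sum u (vertices T) = 1" "(\<Sum>z\<in>vertices T. u z *\<^sub>R z) = x"
    unfolding tri_def convex_hull_finite[OF finite_vertices[OF assms]] by auto
  show "\<forall>z\<in>vertices T. 0 \<le> bc T z x"
  proof
    fix z assume z: "z \<in> vertices T"
    have "bc T z x = fst (bary T z) \<bullet> x + (\<Sum>w\<in>vertices T. u w) * snd (bary T z)" by (simp add: aff_def u)
    also have "\<dots> = (\<Sum>w\<in>vertices T. u w * bc T z w)"
      unfolding u(3)[symmetric] by (simp add: inner_sum_right aff_def sum.distrib algebra_simps sum_distrib_right)
    also have "\<dots> \<ge> 0" using u z by (intro sum_nonneg mult_nonneg_nonneg) (auto simp: bary_vertex[OF assms])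
    finally show "0 \<le> bc T z x" .
  qed
next
  assume "\<forall>z\<in>vertices T. 0 \<le> bc T z x"
  then show "x \<in> tri T"
    unfolding tri_def convex_hull_finite[OF finite_vertices[OF assms]] 
    using bary_sum[OF assms, of x] bary_point[OF assms, of x]
    by (intro CollectI exI[of _ "\<lambda>z. bc T z x"] conjI) auto
qed

lemma vertex_in_tri: "z \<in> vertices T \<Longrightarrow> z \<in> tri T"
  unfolding tri_def by (simp add: hull_inc)

lemma convex_tri: "convex (tri T)" by (simp add: tri_def)

lemma compact_tri: "nondegenerate T \<Longrightarrow> compact (tri T)"
  unfolding tri_def by (intro compact_convex_hull finite_imp_compact) simp

lemma closed_tri: "nondegenerate T \<Longrightarrow> closed (tri T)"
  by (simp add: compact_imp_closed compact_tri)

lemma interior_tri_iff: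
  assumes "nondegenerate T" shows "x \<in> interior (tri T) \<longleftrightarrow> (\<forall>z\<in>vertices T. 0 < bc T z x)"
proof
  assume x: "x \<in> interior (tri T)"
  show "\<forall>z\<in>vertices T. 0 < bc T z x"
  proof (rule ballI, rule ccontr)
    fix z assume z: "z \<in> vertices T" and "\<not> 0 < bc T z x"
    then have 0: "bc T z x \<le> 0" by simp
    let ?a = "fst (bary T z)"
    obtain e where e: "e > 0" "cball x e \<subseteq> tri T" using x by (auto simp: mem_interior_cball)
    obtain q r where "vertices T = {z, q, r}" "q \<noteq> z"
      using nondegenerateE[OF assms z] by metis
    then have "bc T z z \<noteq> bc T z q" using bary_vertex[OF assms z] by auto
    then have a: "?a \<noteq> 0" by (auto simp: aff_def)
    let ?y = "x - (e / norm ?a) *\<^sub>R ?a"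
    have "?y \<in> cball x e" using e a by (simp add: dist_norm)
    then have "0 \<le> bc T z ?y" using e tri_iff[OF assms] z by blast
    moreover have "bc T z ?y = bc T z x - e * norm ?a"
      using a by (simp add: aff_def inner_diff_right dot_square_norm power2_eq_square)
    moreover have "e * norm ?a > 0" using e a by simp
    ultimately show False using 0 by linarith
  qed
next
  assume *: "\<forall>z\<in>vertices T. 0 < bc T z x"
  have "{x. \<forall>z\<in>vertices T. 0 < bc T z x} = (\<Inter>z\<in>vertices T. {x. 0 < bc T z x})" by auto
  moreover have "open \<dots>" using finite_vertices[OF assms]
    by (intro open_INT) (auto intro!: open_Collect_less continuous_aff)
  ultimately have "open {x. \<forall>z\<in>vertices T. 0 < bc T z x}" by simp
  moreover have "{x. \<forall>z\<in>vertices T. 0 < bc T z x} \<subseteq> tri T" using tri_iff[OF assms] by (auto intro: less_imp_le)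
  ultimately show "x \<in> interior (tri T)" using * by (intro interiorI[where T = "{x. \<forall>z\<in>vertices T. 0 < bc T z x}"]) auto
qed

text \<open>A closed convex set is the closure of its interior unless the latter is empty; the barycentre is an
  interior point.\<close>

lemma closure_interior_tri: assumes "nondegenerate T" shows "closure (interior (tri T)) = tri T"
proof -
  have "(\<Sum>w\<in>vertices T. w) /\<^sub>R 3 \<in> interior (tri T)"
    unfolding interior_tri_iff[OF assms]
  proof
    fix v assume v: "v \<in> vertices T"
    obtain q s where V: "vertices T = {v, q, s}" "v \<noteq> q" "v \<noteq> s" "q \<noteq> s" using nondegenerateE[OF assms v] by metis
    have "3 * bc T v ((\<Sum>w\<in>vertices T. w) /\<^sub>R 3) = bc T v v + bc T v q + bc T v s"
      using V by (simp add: aff_def inner_add_right)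
    then show "0 < bc T v ((\<Sum>w\<in>vertices T. w) /\<^sub>R 3)" 
      using V by (simp add: bary_vertex[OF assms])
  qed
  then have "closure (interior (tri T)) = closure (tri T)" 
    by (intro convex_closure_interior[OF convex_tri]) blast
  then show ?thesis using closed_tri[OF assms] by simp
qed

lemma negligible_tri_boundary: "negligible (tri T - interior (tri T))"
  using negligible_convex_frontier[OF convex_tri, of T]
  by (rule negligible_subset) (use closure_subset in \<open>auto simp: frontier_def\<close>)

lemma tri_sides_opp_side:
  assumes "nondegenerate T" shows "S \<in> tri_sides T \<longleftrightarrow> (\<exists>z\<in>vertices T. S = opp_side T z)"
proof
  assume "S \<in> tri_sides T"
  then obtain a b where ab: "a \<in> vertices T" "b \<in> vertices T" "a \<noteq> b" "S = closed_segment a b"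
    by (auto simp: tri_sides_def)
  obtain q r where V: "vertices T = {a, q, r}" "a \<noteq> q" "a \<noteq> r" "q \<noteq> r" using nondegenerateE[OF assms ab(1)] by metis
  then consider "b = q" | "b = r" using ab by auto
  then show "\<exists>z\<in>vertices T. S = opp_side T z"
  proof cases
    case 1
    then have "vertices T - {r} = {a, b}" using V by auto
    then show ?thesis using V ab by (auto simp: opp_side_def segment_convex_hull)
  next
    case 2
    then have "vertices T - {q} = {a, b}" using V by auto
    then show ?thesis using V ab by (auto simp: opp_side_def segment_convex_hull)
  qed
next
  assume "\<exists>z\<in>vertices T. S = opp_side T z"
  then obtain z where z: "z \<in> vertices T" "S = opp_side T z" by auto
  obtain q r where V: "vertices T = {z, q, r}" "z \<noteq> q" "z \<noteq> r" "q \<noteq> r" using nondegenerateE[OF assms z(1)] by metis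
  then have "vertices T - {z} = {q, r}" by auto
  then have "S = closed_segment q r" by (simp add: z opp_side_def segment_convex_hull)
  then show "S \<in> tri_sides T" using V by (auto simp: tri_sides_def)
qed

lemma sideE:
  assumes "nondegenerate T" "S \<in> tri_sides T"
  obtains z a b where "vertices T = {z, a, b}" "z \<noteq> a" "z \<noteq> b" "a \<noteq> b" 
    "S = opp_side T z" "S = closed_segment a b" "cross2 (a - z) (b - z) \<noteq> 0"
proof -
  obtain z where z: "z \<in> vertices T" "S = opp_side T z" using tri_sides_opp_side[OF assms(1)] assms(2) by blast
  obtain q r where V: "vertices T = {z, q, r}" "z \<noteq> q" "z \<noteq> r" "q \<noteq> r" "cross2 (q - z) (r - z) \<noteq> 0"
    using nondegenerateE[OF assms(1) z(1)] by metis
  then have "vertices T - {z} = {q, r}" by auto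
  then have "S = closed_segment q r" by (simp add: z opp_side_def segment_convex_hull)
  then show ?thesis using that V z by blast
qed

lemma opp_side_iff:
  assumes "nondegenerate T" "z \<in> vertices T"
  shows "x \<in> opp_side T z \<longleftrightarrow> x \<in> tri T \<and> bc T z x = 0"
proof -
  have f: "finite (vertices T - {z})" using assms by simp
  show ?thesis
  proof
    assume x: "x \<in> opp_side T z"
    then have t: "x \<in> tri T" unfolding opp_side_def tri_def using hull_mono[of "vertices T - {z}" "vertices T" convex] by auto
    obtain u where u: "sum u (vertices T - {z}) = 1" "(\<Sum>w\<in>vertices T - {z}. u w *\<^sub>R w) = x"
      using x unfolding opp_side_def convex_hull_finite[OF f] by auto
    have "bc T z x = fst (bary T z) \<bullet> x + (\<Sum>w\<in>vertices T - {z}. u w) * snd (bary T z)" by (simp add: aff_def u)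
    also have "\<dots> = (\<Sum>w\<in>vertices T - {z}. u w * bc T z w)"
      unfolding u(2)[symmetric] by (simp add: inner_sum_right aff_def sum.distrib algebra_simps sum_distrib_left)
    also have "\<dots> = 0" using assms by (intro sum.neutral) (auto simp: bary_vertex)
    finally show "x \<in> tri T \<and> bc T z x = 0" using t by simp
  next
    assume x: "x \<in> tri T \<and> bc T z x = 0"
    have s: "(\<Sum>w\<in>vertices T - {z}. bc T w x) = 1" using bary_sum[OF assms(1), of x] assms x
      by (simp add: sum.remove[of "vertices T" z])
    moreover have "(\<Sum>w\<in>vertices T - {z}. bc T w x *\<^sub>R w) = x" 
      using bary_point[OF assms(1), of x] assms x by (simp add: sum.remove[of "vertices T" z])
    moreover have "\<forall>w\<in>vertices T - {z}. 0 \<le> bc T w x" using x tri_iff[OF assms(1)] by auto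
    ultimately show "x \<in> opp_side T z" unfolding opp_side_def convex_hull_finite[OF f]
      by (intro CollectI exI[of _ "\<lambda>z. bc T z x"] conjI) auto
  qed
qed

lemma side_subset_tri: assumes "S \<in> tri_sides T" shows "S \<subseteq> tri T"
proof -
  obtain a b where ab: "a \<in> vertices T" "b \<in> vertices T" "S = closed_segment a b"
    using assms by (auto simp: tri_sides_def)
  then have "{a, b} \<subseteq> vertices T" by simp
  then show ?thesis unfolding ab(3) tri_def segment_convex_hull by (rule hull_mono)
qed

lemma boundary_point_on_side:
  assumes "nondegenerate T" "x \<in> tri T" "x \<notin> interior (tri T)"
  obtains z where "z \<in> vertices T" "x \<in> opp_side T z"
proof -
  obtain z where z: "z \<in> vertices T" "\<not> 0 < bc T z x" using assms interior_tri_iff by blast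
  then have "bc T z x = 0" using assms tri_iff by force
  then show ?thesis using that z assms by (simp add: opp_side_iff)
qed

lemma nested_sides_same_tri:
  assumes "nondegenerate T" "S \<in> tri_sides T" "S' \<in> tri_sides T" "S \<subseteq> S'" shows "S = S'"
proof -
  obtain z z' where z: "z \<in> vertices T" "S = opp_side T z" "z' \<in> vertices T" "S' = opp_side T z'"
    using assms tri_sides_opp_side by metis
  have "z = z'"
  proof (rule ccontr)
    assume "z \<noteq> z'"
    then have "z' \<in> opp_side T z" using z unfolding opp_side_def by (auto intro: hull_inc)
    then have "z' \<in> opp_side T z'" using z assms by auto
    then show False using opp_side_iff[OF assms(1) z(3)] bary_vertex[OF assms(1) z(3) z(3)] by auto
  qed
  then show ?thesis using z by simp
qed

lemma vertex_on_side:
  assumes "nondegenerate T" "w \<in> vertices T" "w \<in> closed_segment a b" "a \<in> vertices T" "b \<in> vertices T"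
  shows "w = a \<or> w = b"
proof (rule ccontr)
  assume *: "\<not> (w = a \<or> w = b)"
  obtain u where "0 \<le> u" "u \<le> 1" "w = (1 - u) *\<^sub>R a + u *\<^sub>R b" using assms(3) by (auto simp: closed_segment_def)
  then have "bc T w w = (1 - u) * bc T w a + u * bc T w b" using aff_convex[of "1-u" u] by auto
  then show False using * assms by (auto simp: bary_vertex)
qed

lemma area_eq:
  assumes "vertices T = {z, q, r}" shows "area T = \<bar>cross2 (q - z) (r - z)\<bar> / 2"
proof -
  have "compact (convex hull {z, q, r})" by (intro compact_convex_hull finite_imp_compact) simp
  then have "convex hull {z, q, r} \<in> sets lborel" using borel_compact sets_lborel by blast
  then have "area T = measure lborel (convex hull {z, q, r})" 
    unfolding tri_def assms by (rule measure_completion)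
  then show ?thesis unfolding content_triangle cross2_def by (simp add: mult.commute)
qed

lemma area_pos: assumes "nondegenerate T" shows "0 < area T"
proof -
  have "newest T \<in> vertices T" by (simp add: vertices_def)
  from nondegenerateE[OF assms this] obtain q r where
    "vertices T = {newest T, q, r}" "cross2 (q - newest T) (r - newest T) \<noteq> 0" by metis
  then show ?thesis by (simp add: area_eq)
qed

text \<open>The length of the gradient of a barycentric coordinate is the reciprocal of a height.\<close>

lemma bary_gradient:
  assumes "nondegenerate T" "vertices T = {z, q, r}" "z \<noteq> q" "z \<noteq> r"
  shows "norm (fst (bary T z)) * (2 * area T) = dist q r"
proof -
  have D: "cross2 (q - z) (r - z) \<noteq> 0" using area_pos[OF assms(1)] area_eq[OF assms(2)] by auto
  obtain p where p: "aff p z = 1" "aff p q = 0" "aff p r = 0"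
    "norm (fst p) * \<bar>cross2 (q - z) (r - z)\<bar> = dist q r" using affine_function_of_side[OF D] by metis
  have "p = bary T z" using assms p by (intro affine_eq_on_triangle[OF assms(1)]) (auto simp: bary_vertex)
  then show ?thesis using p by (simp add: area_eq[OF assms(2)])
qed

section \<open>Adjacency in conforming triangulations\<close>

locale mesh =
  fixes \<Omega> :: "point set" and \<T> :: "marked_triangle set"
  assumes polygonal: "polygonal_domain \<Omega>" and conforming: "conforming_triangulation \<Omega> \<T>"
begin

lemma finite_mesh: "finite \<T>" using conforming by (simp add: conforming_triangulation_def)
lemma nondeg: "T \<in> \<T> \<Longrightarrow> nondegenerate T" using conforming by (simp add: conforming_triangulation_def)
lemma union_tri: "(\<Union>T\<in>\<T>. tri T) = closure \<Omega>" using conforming by (simp add: conforming_triangulation_def)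
lemma open_domain: "open \<Omega>" using polygonal by (simp add: polygonal_domain_def)
lemma interior_closure_domain: "interior (closure \<Omega>) = \<Omega>" using polygonal by (simp add: polygonal_domain_def)

lemma tri_subset_closure: "T \<in> \<T> \<Longrightarrow> tri T \<subseteq> closure \<Omega>" using union_tri by auto

lemma frontier_eq: "frontier \<Omega> = closure \<Omega> - \<Omega>"
  by (simp add: frontier_def interior_open open_domain)

lemma interior_subset_domain: "A \<subseteq> closure \<Omega> \<Longrightarrow> interior A \<subseteq> \<Omega>"
  using interior_mono interior_closure_domain by metis

lemma intersection_cases:
  assumes "T \<in> \<T>" "T' \<in> \<T>" "T \<noteq> T'" "x \<in> tri T" "x \<in> tri T'"
  obtains "x \<in> vertices T" "x \<in> vertices T'" "tri T \<inter> tri T' = {x}"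
    | "tri T \<inter> tri T' \<in> tri_sides T" "tri T \<inter> tri T' \<in> tri_sides T'"
proof -
  have "tri T \<inter> tri T' = {} \<or> (\<exists>z \<in> vertices T \<inter> vertices T'. tri T \<inter> tri T' = {z}) \<or>
        tri T \<inter> tri T' \<in> tri_sides T \<inter> tri_sides T'"
    using assms(1-3) conforming unfolding conforming_triangulation_def by blast
  then consider z where "z \<in> vertices T" "z \<in> vertices T'" "tri T \<inter> tri T' = {z}"
    | "tri T \<inter> tri T' \<in> tri_sides T" "tri T \<inter> tri T' \<in> tri_sides T'" using assms(4,5) by blast
  then show ?thesis
  proof cases
    case 1
    then have "z = x" using assms(4,5) by auto
    then show ?thesis using that(1) 1 by simp
  next
    case 2 then show ?thesis using that(2) by simp
  qed
qed

text \<open>Two triangles that share a segment share a side, and a side of a triangle is not a proper part of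
  another side of the same triangle.\<close>

lemma side_of_neighbour:
  assumes "S \<in> tri_sides T" "T \<in> \<T>" "T' \<in> \<T>" "S \<subseteq> tri T'" shows "S \<in> tri_sides T'"
proof (cases "T = T'")
  case True then show ?thesis using assms by simp
next
  case False
  obtain a b where ab: "a \<noteq> b" "S = closed_segment a b" using assms(1) by (auto simp: tri_sides_def)
  have sub: "S \<subseteq> tri T \<inter> tri T'" using side_subset_tri assms by auto
  then have aT: "a \<in> tri T" "a \<in> tri T'" "b \<in> tri T \<inter> tri T'" using ab by auto
  from intersection_cases[OF assms(2,3) False aT(1,2)] show ?thesis
  proof cases
    case 1 then show ?thesis using ab aT by auto
  next
    case 2
    then have "S = tri T \<inter> tri T'" using nested_sides_same_tri[OF nondeg[OF assms(2)] assms(1) _ sub] by simp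
    then show ?thesis using 2 by simp
  qed
qed

lemma nested_sides:
  assumes "S \<in> sides (Mesh \<T>)" "S' \<in> sides (Mesh \<T>)" "S \<subseteq> S'" shows "S = S'"
proof -
  obtain T T' where T: "T \<in> \<T>" "S \<in> tri_sides T" "T' \<in> \<T>" "S' \<in> tri_sides T'" using assms by auto
  then have "S \<subseteq> tri T'" using side_subset_tri assms(3) by blast
  then have "S \<in> tri_sides T'" using side_of_neighbour T by blast
  then show ?thesis using nested_sides_same_tri[OF nondeg] T assms by blast
qed

lemma interior_point_unique:
  assumes "T \<in> \<T>" "T' \<in> \<T>" "x \<in> interior (tri T)" "x \<in> tri T'" shows "T = T'"
proof (rule ccontr)
  assume ne: "T \<noteq> T'"
  note nd = nondeg[OF assms(1)]
  have pos: "0 < bc T z x" if "z \<in> vertices T" for z using interior_tri_iff[OF nd] assms(3) that by blast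
  have xT: "x \<in> tri T" using assms(3) interior_subset by blast
  from intersection_cases[OF assms(1,2) ne xT assms(4)] show False
  proof cases
    case 1
    obtain q r where "vertices T = {x, q, r}" "x \<noteq> q" using nondegenerateE[OF nd 1(1)] by metis
    then show False using pos[of q] bary_vertex[OF nd, of q x] by auto
  next
    case 2
    then obtain z where z: "z \<in> vertices T" "tri T \<inter> tri T' = opp_side T z" using tri_sides_opp_side[OF nd] by auto
    then have "x \<in> opp_side T z" using xT assms(4) by auto
    then show False using pos[OF z(1)] opp_side_iff[OF nd z(1)] by auto
  qed
qed

lemma negligible_tri_Int:
  assumes "T \<in> \<T>" "T' \<in> \<T>" "T \<noteq> T'" shows "negligible (tri T \<inter> tri T')"
  by (rule negligible_subset[OF negligible_tri_boundary[of T]]) (use interior_point_unique assms in blast)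

text \<open>Conformity excludes hanging nodes.\<close>

lemma vertex_of_neighbour:
  assumes "T \<in> \<T>" "T' \<in> \<T>" "z \<in> vertices T" "z \<in> tri T'" shows "z \<in> vertices T'"
proof (cases "T = T'")
  case True then show ?thesis using assms by simp
next
  case False
  have zT: "z \<in> tri T" using assms vertex_in_tri by simp
  from intersection_cases[OF assms(1,2) False zT assms(4)] show ?thesis
  proof cases
    case 1 then show ?thesis by simp
  next
    case 2
    obtain a b where ab: "tri T \<inter> tri T' = closed_segment a b" "a \<in> vertices T" "b \<in> vertices T" 
      using 2 by (auto simp: tri_sides_def)
    obtain c d where cd: "tri T \<inter> tri T' = closed_segment c d" "c \<in> vertices T'" "d \<in> vertices T'" 
      using 2 by (auto simp: tri_sides_def)
    have "z = a \<or> z = b" using vertex_on_side[OF nondeg[OF assms(1)] assms(3) _ ab(2,3)] ab(1) zT assms(4) by auto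
    moreover have "{a, b} = {c, d}" using ab cd closed_segment_eq by metis
    ultimately show ?thesis using cd by auto
  qed
qed

text \<open>If both third vertices were on the same side of the common edge, some points of \<open>T'\<close> close to the
  midpoint of the edge would be interior to \<open>T\<close>.  A third vertex on the line through the edge would make
  \<open>T'\<close> degenerate.\<close>

lemma opposite_vertex_across:
  assumes T: "T \<in> \<T>" "T' \<in> \<T>" "T \<noteq> T'" and V: "vertices T = {z, a, b}" "vertices T' = {z', a, b}"
    and d: "z \<noteq> a" "z \<noteq> b" "a \<noteq> b" "z' \<noteq> a" "z' \<noteq> b"
  shows "bc T z z' < 0"
proof (rule ccontr)
  assume "\<not> bc T z z' < 0"
  then have nn: "0 \<le> bc T z z'" by simp
  note nd = nondeg[OF T(1)] and nd' = nondeg[OF T(2)]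
  have "bc T z z' \<noteq> 0"
  proof
    assume 0: "bc T z z' = 0"
    have "bary T z = 0"
      by (rule affine_eq_on_triangle[OF nd']) 
        (use 0 d V bary_vertex[OF nd, of z] in \<open>auto simp: aff_def\<close>)
    then show False using bary_vertex[OF nd, of z z] V by (auto simp: aff_def)
  qed
  with nn have p: "0 < bc T z z'" by simp
  define m where "m = midpoint a b"
  define f where "f w t = bc T w m + t * (bc T w z' - bc T w m)" for w and t :: real
  have fe: "bc T w ((1 - t) *\<^sub>R m + t *\<^sub>R z') = f w t" for w t
    unfolding f_def by (subst aff_convex) (simp_all add: algebra_simps)
  have ab: "bc T a m = 1/2" "bc T b m = 1/2" "bc T z m = 0"
    using d V by (auto simp: m_def aff_midpoint bary_vertex[OF nd])
  \<comment> \<open>A small step from the midpoint towards \<open>z'\<close> changes the positive coordinates by less than 1/2.\<close>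
  define c d where "c = bc T a z' - 1/2" and "d = bc T b z' - 1/2"
  define t where "t = 1 / (2 * (1 + \<bar>c\<bar> + \<bar>d\<bar>))"
  have "\<bar>t * c\<bar> < 1/2" "\<bar>t * d\<bar> < 1/2" by (auto simp: t_def abs_mult field_simps)
  moreover have "f a t = 1/2 + t * c" "f b t = 1/2 + t * d" by (auto simp: f_def ab c_def d_def)
  ultimately have "0 < f a t" "0 < f b t" by linarith+
  moreover have "0 < t" "t < 1" by (auto simp: t_def field_simps)
  ultimately have t: "0 < f a t" "0 < f b t" "0 < t" "t < 1" by auto
  let ?x = "(1 - t) *\<^sub>R m + t *\<^sub>R z'"
  have "0 < f z t" using ab p t by (simp add: f_def)
  then have "?x \<in> interior (tri T)" using t unfolding interior_tri_iff[OF nd] V by (simp add: fe)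
  moreover have "?x \<in> tri T'"
  proof -
    have "a \<in> tri T'" "b \<in> tri T'" "z' \<in> tri T'" using V vertex_in_tri by auto
    moreover from this have "m \<in> tri T'" unfolding m_def
      using closed_segment_subset[OF _ _ convex_tri] midpoints_in_convex_hull
      by (metis convex_contains_segment convex_tri midpoint_in_closed_segment subsetD)
    ultimately show ?thesis using t convexD[OF convex_tri, of m T' z' "1-t" t] by auto
  qed
  ultimately show False using interior_point_unique T by blast
qed

lemma neighbour_vertices:
  assumes "T \<in> \<T>" "T' \<in> \<T>" "T \<noteq> T'" "S \<in> tri_sides T" "S \<in> tri_sides T'"
  obtains a b z z' where "S = closed_segment a b" "vertices T = {z, a, b}" "vertices T' = {z', a, b}"
    "z \<noteq> a" "z \<noteq> b" "a \<noteq> b" "z' \<noteq> a" "z' \<noteq> b" "S = opp_side T z" "S = opp_side T' z'"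
proof -
  obtain z a b where 1: "vertices T = {z, a, b}" "z \<noteq> a" "z \<noteq> b" "a \<noteq> b" "S = opp_side T z" "S = closed_segment a b"
    using sideE[OF nondeg[OF assms(1)] assms(4)] by metis
  obtain z' c d where 2: "vertices T' = {z', c, d}" "z' \<noteq> c" "z' \<noteq> d" "c \<noteq> d" "S = opp_side T' z'" "S = closed_segment c d"
    using sideE[OF nondeg[OF assms(2)] assms(5)] by metis
  have e: "{a, b} = {c, d}" using 1 2 closed_segment_eq by metis
  then have "vertices T' = {z', a, b}" "z' \<noteq> a" "z' \<noteq> b" using 2 by (auto simp: doubleton_eq_iff)
  then show ?thesis using that 1 2 by blast
qed

lemma neighbours_Int:
  assumes "T \<in> \<T>" "T' \<in> \<T>" "T \<noteq> T'" "S \<in> tri_sides T" "S \<in> tri_sides T'"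
  shows "tri T \<inter> tri T' = S"
proof -
  obtain a b where ab: "a \<noteq> b" "S = closed_segment a b" using assms(4) by (auto simp: tri_sides_def)
  have sub: "S \<subseteq> tri T \<inter> tri T'" using side_subset_tri assms by auto
  then have aT: "a \<in> tri T" "a \<in> tri T'" "b \<in> tri T \<inter> tri T'" using ab by auto
  from intersection_cases[OF assms(1-3) aT(1,2)] show ?thesis
  proof cases
    case 1 then show ?thesis using ab aT by auto
  next
    case 2
    then show ?thesis using nested_sides_same_tri[OF nondeg[OF assms(1)] assms(4) _ sub] by simp
  qed
qed

text \<open>Of three triangles with a common side, two would lie on the same side of it.\<close>

lemma two_triangles_at_side:
  assumes "T1 \<in> \<T>" "T2 \<in> \<T>" "T3 \<in> \<T>" "T1 \<noteq> T2" "T1 \<noteq> T3"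
    and "S \<in> tri_sides T1" "S \<in> tri_sides T2" "S \<in> tri_sides T3"
  shows "T2 = T3"
proof (rule ccontr)
  assume 23: "T2 \<noteq> T3"
  obtain a b z1 z2 where 1: "S = closed_segment a b" "vertices T1 = {z1, a, b}" "vertices T2 = {z2, a, b}"
    "z1 \<noteq> a" "z1 \<noteq> b" "a \<noteq> b" "z2 \<noteq> a" "z2 \<noteq> b" 
    using neighbour_vertices[OF assms(1,2,4,6,7)] by metis
  obtain z3 c d where 3: "vertices T3 = {z3, c, d}" "z3 \<noteq> c" "z3 \<noteq> d" "S = closed_segment c d"
    using sideE[OF nondeg[OF assms(3)] assms(8)] by metis
  have e: "{a, b} = {c, d}" using 1 3 closed_segment_eq by metis
  then have 3: "vertices T3 = {z3, a, b}" "z3 \<noteq> a" "z3 \<noteq> b" using 3 by (auto simp: doubleton_eq_iff)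
  have n: "bc T1 z1 z2 < 0" "bc T1 z1 z3 < 0" "bc T2 z2 z3 < 0"
    using opposite_vertex_across[OF assms(1,2,4) 1(2,3)] opposite_vertex_across[OF assms(1,3,5) 1(2) 3(1)]
      opposite_vertex_across[OF assms(2,3) 23 1(3) 3(1)] 1 3 by auto
  have "bc T1 z1 z3 = (\<Sum>w\<in>vertices T2. bc T1 z1 w * bc T2 w z3)"
    by (rule affine_interpolation[OF nondeg[OF assms(2)]])
  also have "\<dots> = bc T1 z1 z2 * bc T2 z2 z3"
    using 1 by (simp add: bary_vertex[OF nondeg[OF assms(1)]])
  also have "\<dots> > 0" using n by (simp add: mult_neg_neg)
  finally show False using n by simp
qed

text \<open>The barycentric coordinates that belong to the common side are negative multiples of each
  other, so each point near a relative interior point of the side belongs to one of the two triangles.\<close>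

lemma interior_of_two_triangles:
  assumes T: "T \<in> \<T>" "T' \<in> \<T>" "T \<noteq> T'" and V: "vertices T = {z, a, b}" "vertices T' = {z', a, b}"
    and d: "z \<noteq> a" "z \<noteq> b" "a \<noteq> b" "z' \<noteq> a" "z' \<noteq> b"
    and x: "x \<in> closed_segment a b" "0 < bc T a x" "0 < bc T b x"
  shows "x \<in> interior (tri T \<union> tri T')"
proof -
  note nd = nondeg[OF T(1)] and nd' = nondeg[OF T(2)]
  obtain u where u: "x = (1 - u) *\<^sub>R a + u *\<^sub>R b" using x by (auto simp: closed_segment_def)
  have bx: "bc T w x = (1 - u) * bc T w a + u * bc T w b" "bc T' w x = (1 - u) * bc T' w a + u * bc T' w b" for w
    unfolding u using aff_convex[of "1-u" u] by auto
  have "bc T a x = 1 - u" "bc T b x = u" "bc T' a x = 1 - u" "bc T' b x = u"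
    using d V by (auto simp: bx bary_vertex[OF nd] bary_vertex[OF nd'])
  then have pos: "0 < bc T' a x" "0 < bc T' b x" using x by auto
  define U where "U = {y. 0 < bc T a y} \<inter> {y. 0 < bc T b y} \<inter> {y. 0 < bc T' a y} \<inter> {y. 0 < bc T' b y}"
  have "open U" unfolding U_def by (intro open_Int open_Collect_less continuous_aff continuous_on_const)
  moreover have "x \<in> U" using x pos by (simp add: U_def)
  moreover have "U \<subseteq> tri T \<union> tri T'"
  proof
    fix y assume y: "y \<in> U"
    have "bc T z y = (\<Sum>w\<in>vertices T'. bc T z w * bc T' w y)"
      by (rule affine_interpolation[OF nd'])
    also have "\<dots> = bc T z z' * bc T' z' y"
      using d V by (simp add: bary_vertex[OF nd])
    finally have "bc T z y = bc T z z' * bc T' z' y" .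
    then have "0 \<le> bc T z y \<or> 0 \<le> bc T' z' y" 
      using opposite_vertex_across[OF T V d] by (metis mult_nonpos_nonpos less_imp_le linear)
    then show "y \<in> tri T \<union> tri T'" using y V unfolding U_def Un_iff tri_iff[OF nd] tri_iff[OF nd'] by auto
  qed
  ultimately show ?thesis by (meson interiorI)
qed

lemma interior_side_not_in_frontier:
  assumes "T \<in> \<T>" "T' \<in> \<T>" "T \<noteq> T'" "S \<in> tri_sides T" "S \<in> tri_sides T'" "x \<in> S"
    and "x \<notin> vertices T"
  shows "x \<in> \<Omega>"
proof -
  obtain a b z z' where 1: "S = closed_segment a b" and V: "vertices T = {z, a, b}" "vertices T' = {z', a, b}"
    and d: "z \<noteq> a" "z \<noteq> b" "a \<noteq> b" "z' \<noteq> a" "z' \<noteq> b" and "S = opp_side T z"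
    using neighbour_vertices[OF assms(1-5)] by metis
  note nd = nondeg[OF assms(1)]
  obtain u where u: "0 \<le> u" "u \<le> 1" "x = (1 - u) *\<^sub>R a + u *\<^sub>R b" using assms(6) 1 by (auto simp: closed_segment_def)
  have "u \<noteq> 0" "u \<noteq> 1" using assms(7) u V by auto
  then have "0 < u" "u < 1" using u by auto
  moreover have "bc T a x = 1 - u" "bc T b x = u" 
    unfolding u(3) using d V by (auto simp: aff_convex bary_vertex[OF nd])
  ultimately have "x \<in> interior (tri T \<union> tri T')" 
    using interior_of_two_triangles[OF assms(1-3) V d] assms(6) 1 by auto
  moreover have "tri T \<union> tri T' \<subseteq> closure \<Omega>" using tri_subset_closure assms(1,2) by blast
  ultimately show ?thesis using interior_subset_domain by blast
qed

lemma shared_side_not_boundary: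
  assumes "T \<in> \<T>" "T' \<in> \<T>" "T \<noteq> T'" "S \<in> tri_sides T" "S \<in> tri_sides T'" shows "\<not> S \<subseteq> frontier \<Omega>"
proof -
  obtain a b where ab: "a \<in> vertices T" "b \<in> vertices T" "a \<noteq> b" "S = closed_segment a b" using assms by (auto simp: tri_sides_def)
  have "midpoint a b \<notin> vertices T"
  proof
    assume "midpoint a b \<in> vertices T"
    then have "midpoint a b = a \<or> midpoint a b = b"
      using vertex_on_side[OF nondeg[OF assms(1)] _ midpoint_in_closed_segment ab(1,2)] by simp
    then show False using ab(3) midpoint_eq_endpoint by metis
  qed
  then have "midpoint a b \<in> \<Omega>" using interior_side_not_in_frontier[OF assms] ab by simp
  then show ?thesis using frontier_eq ab by auto
qed

text \<open>A relative interior point of a side that belongs to \<open>T\<close> only has a neighbourhood in which the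
  closure of the domain coincides with \<open>T\<close>.\<close>

lemma unshared_side_boundary:
  assumes "T \<in> \<T>" "S \<in> tri_sides T" "\<And>T'. T' \<in> \<T> \<Longrightarrow> S \<in> tri_sides T' \<Longrightarrow> T' = T"
  shows "S \<subseteq> frontier \<Omega>"
proof -
  note nd = nondeg[OF assms(1)]
  obtain z a b where V: "vertices T = {z, a, b}" "z \<noteq> a" "z \<noteq> b" "a \<noteq> b" "S = opp_side T z" "S = closed_segment a b"
    using sideE[OF nd assms(2)] by metis
  have "open_segment a b \<subseteq> frontier \<Omega>"
  proof
    fix x assume x: "x \<in> open_segment a b"
    then have xS: "x \<in> S" and xab: "x \<noteq> a" "x \<noteq> b" using V by (auto simp: open_segment_def)
    then have xT: "x \<in> tri T" using assms(2) side_subset_tri by blast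
    have x0: "bc T z x = 0" using opp_side_iff[OF nd] V xS by auto
    then have xz: "x \<noteq> z" using bary_vertex[OF nd, of z z] V by auto
    have only: "T' = T" if T': "T' \<in> \<T>" "x \<in> tri T'" for T'
    proof (rule ccontr)
      assume ne: "T' \<noteq> T"
      from intersection_cases[OF assms(1) T'(1) ne[symmetric] xT T'(2)] show False
      proof cases
        case 1 then show False using V xab xz by auto
      next
        case 2
        then obtain w where w: "w \<in> vertices T" "tri T \<inter> tri T' = opp_side T w" using tri_sides_opp_side[OF nd] by auto
        then have "bc T w x = 0" using opp_side_iff[OF nd w(1)] xT T' by auto
        moreover obtain u where u: "x = (1 - u) *\<^sub>R a + u *\<^sub>R b" using x by (auto simp: open_segment_def closed_segment_def)
        ultimately have "0 = (1 - u) * bc T w a + u * bc T w b" using aff_convex[of "1-u" u] by auto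
        moreover have "u \<noteq> 0" "u \<noteq> 1" using u xab by auto
        ultimately have "w = z" using w(1) V bary_vertex[OF nd w(1)] by auto
        then have "S \<in> tri_sides T'" using 2 w V by simp
        then show False using assms(3) T' ne by blast
      qed
    qed
    have "x \<notin> \<Omega>"
    proof
      assume xO: "x \<in> \<Omega>"
      define F where "F = (\<Union>T'\<in>\<T> - {T}. tri T')"
      have "closed F" unfolding F_def using finite_mesh nondeg by (intro closed_UN) (auto intro: closed_tri)
      moreover have "x \<notin> F" using only by (auto simp: F_def)
      ultimately have o: "open (\<Omega> - F)" "x \<in> \<Omega> - F" using open_domain xO by auto
      have "\<Omega> - F \<subseteq> tri T" using union_tri closure_subset[of \<Omega>] unfolding F_def by blast
      then have "x \<in> interior (tri T)" using o by (meson interiorI)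
      then show False using interior_tri_iff[OF nd] x0 V by auto
    qed
    then show "x \<in> frontier \<Omega>" using frontier_eq tri_subset_closure assms(1) xT by blast
  qed
  then have "closure (open_segment a b) \<subseteq> frontier \<Omega>" by (rule closure_minimal) (rule frontier_closed)
  moreover have "closure (open_segment a b) = closed_segment a b" using V(4) closure_open_segment by metis
  ultimately show ?thesis using V by simp
qed

lemma boundary_side_unique:
  assumes "T \<in> \<T>" "S \<in> tri_sides T" "S \<subseteq> frontier \<Omega>" shows "(THE T. T \<in> \<T> \<and> S \<in> tri_sides T) = T"
proof (rule the_equality)
  show "T \<in> \<T> \<and> S \<in> tri_sides T" using assms by simp
  fix T' assume "T' \<in> \<T> \<and> S \<in> tri_sides T'"
  then show "T' = T" using assms shared_side_not_boundary[of T T' S] by auto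
qed

lemma interior_sideE:
  assumes "T \<in> \<T>" "S \<in> tri_sides T" "\<not> S \<subseteq> frontier \<Omega>"
  obtains T' where "T' \<in> \<T>" "S \<in> tri_sides T'" "T' \<noteq> T"
proof -
  have "\<exists>T'\<in>\<T>. S \<in> tri_sides T' \<and> T' \<noteq> T"
  proof (rule ccontr)
    assume "\<not> (\<exists>T'\<in>\<T>. S \<in> tri_sides T' \<and> T' \<noteq> T)"
    then have "T' = T" if "T' \<in> \<T>" "S \<in> tri_sides T'" for T' using that by blast
    from unshared_side_boundary[OF assms(1,2) this] assms(3) show False by blast
  qed
  then show ?thesis using that by blast
qed

section \<open>Triangles around a vertex\<close>

text \<open>Only sides in \<open>R\<close> link triangles.  The classes of linked triangles at \<open>z\<close> are the parts into which
  the remaining sides cut the triangles around \<open>z\<close>.\<close>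

definition adjacent :: "point set set \<Rightarrow> point \<Rightarrow> (marked_triangle \<times> marked_triangle) set" where
  "adjacent R z = {(T, T'). T \<in> \<T> \<and> T' \<in> \<T> \<and> z \<in> vertices T \<and> z \<in> vertices T' \<and>
     (\<exists>S\<in>R. z \<in> S \<and> S \<in> tri_sides T \<and> S \<in> tri_sides T')}"

lemma sym_adjacent: "sym (adjacent R z)"
  unfolding adjacent_def sym_def by auto

lemma adjacent_rtrancl_mesh:
  "(T, T') \<in> (adjacent R z)\<^sup>* \<Longrightarrow> T \<in> \<T> \<Longrightarrow> z \<in> vertices T \<Longrightarrow> T' \<in> \<T> \<and> z \<in> vertices T'"
proof (induction rule: rtrancl_induct)
  case base then show ?case by simp
next
  case (step T1 T2)
  from step.hyps(2) show ?case by (simp add: adjacent_def)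
qed

lemma vertex_neighbourhood:
  obtains r where "r > 0" "\<And>T x. T \<in> \<T> \<Longrightarrow> z \<in> vertices T \<Longrightarrow> x \<in> ball z r \<Longrightarrow> 0 < bc T z x"
proof -
  define U where "U = (\<Inter>T\<in>{T\<in>\<T>. z \<in> vertices T}. {x. 0 < bc T z x})"
  have "open U" unfolding U_def
    using finite_mesh by (intro open_INT) (auto intro!: open_Collect_less continuous_aff)
  moreover have "z \<in> U" unfolding U_def by (auto simp: bary_vertex[OF nondeg])
  ultimately obtain r where "r > 0" "ball z r \<subseteq> U" using open_contains_ball by blast
  then show ?thesis using that[of r] unfolding U_def by blast
qed

text \<open>If no triangle that is reached from \<open>T\<close> by crossing sides at \<open>z\<close> has a boundary side at \<open>z\<close>,
  then the triangles reached form a relatively open and closed subset of a punctured disc around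
  \<open>z\<close>, hence fill it.\<close>

lemma star_without_boundary:
  assumes T: "T \<in> \<T>" "z \<in> vertices T"
    and R: "\<And>S. S \<in> sides (Mesh \<T>) \<Longrightarrow> S \<in> R"
    and nb: "\<And>T' S. (T, T') \<in> (adjacent R z)\<^sup>* \<Longrightarrow> S \<in> tri_sides T' \<Longrightarrow> z \<in> S \<Longrightarrow> \<not> S \<subseteq> frontier \<Omega>"
  shows "z \<in> \<Omega>" and "\<And>T'. T' \<in> \<T> \<Longrightarrow> z \<in> tri T' \<Longrightarrow> (T, T') \<in> (adjacent R z)\<^sup>*"
proof -
  define C where "C = {T'. (T, T') \<in> (adjacent R z)\<^sup>*}"
  have C: "T' \<in> \<T>" "z \<in> vertices T'" if "T' \<in> C" for T'
    using adjacent_rtrancl_mesh that T unfolding C_def by auto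
  obtain r where r: "r > 0" "\<And>T x. T \<in> \<T> \<Longrightarrow> z \<in> vertices T \<Longrightarrow> x \<in> ball z r \<Longrightarrow> 0 < bc T z x"
    using vertex_neighbourhood[of z] by metis
  define B where "B = ball z r - {z}"
  have conB: "connected B" unfolding B_def by (rule connected_punctured_ball) simp
  define W where "W = (\<Union>T'\<in>C. tri T')"
  have "finite C" using finite_subset[OF _ finite_mesh] C(1) by (metis subsetI)
  then have clW: "closed W" unfolding W_def using C nondeg by (intro closed_UN) (auto intro: closed_tri)
  \<comment> \<open>A point of the union is interior to a triangle of the class or, because boundary sides are
    excluded, to the union of two adjacent ones.\<close>
  have in_int: "x \<in> interior W" if x: "x \<in> W \<inter> B" for x
  proof -
    obtain T1 where T1: "T1 \<in> C" "x \<in> tri T1" using x by (auto simp: W_def)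
    note nd = nondeg[OF C(1)[OF T1(1)]]
    have pz: "0 < bc T1 z x" using r(2)[OF C[OF T1(1)]] x by (auto simp: B_def)
    show ?thesis
    proof (cases "x \<in> interior (tri T1)")
      case True
      moreover have "interior (tri T1) \<subseteq> interior W" using T1 by (intro interior_mono) (auto simp: W_def)
      ultimately show ?thesis by blast
    next
      case False
      obtain q where q: "q \<in> vertices T1" "x \<in> opp_side T1 q" using boundary_point_on_side[OF nd T1(2) False] by metis
      have q0: "bc T1 q x = 0" using opp_side_iff[OF nd q(1)] q(2) by auto
      then have qz: "q \<noteq> z" using pz by auto
      have S: "opp_side T1 q \<in> tri_sides T1" using tri_sides_opp_side[OF nd] q by auto
      have zS: "z \<in> opp_side T1 q" using C(2)[OF T1(1)] qz unfolding opp_side_def by (auto intro: hull_inc)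
      have "\<not> opp_side T1 q \<subseteq> frontier \<Omega>" using nb T1(1) S zS unfolding C_def by blast
      then obtain T2 where T2: "T2 \<in> \<T>" "opp_side T1 q \<in> tri_sides T2" "T2 \<noteq> T1"
        using interior_sideE[OF C(1)[OF T1(1)] S] by metis
      have "z \<in> vertices T2"
        using vertex_of_neighbour[OF C(1)[OF T1(1)] T2(1) C(2)[OF T1(1)]] side_subset_tri[OF T2(2)] zS by auto
      then have "(T1, T2) \<in> adjacent R z" using T2 C[OF T1(1)] S zS R unfolding adjacent_def by auto
      then have T2C: "T2 \<in> C" using T1(1) unfolding C_def by (auto intro: rtrancl_into_rtrancl)
      obtain a b p p' where 1: "opp_side T1 q = closed_segment a b" and V: "vertices T1 = {p, a, b}" "vertices T2 = {p', a, b}"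
        and d: "p \<noteq> a" "p \<noteq> b" "a \<noteq> b" "p' \<noteq> a" "p' \<noteq> b" and "opp_side T1 q = opp_side T1 p"
        using neighbour_vertices[OF C(1)[OF T1(1)] T2(1) T2(3)[symmetric] S T2(2)] by metis
      have pp: "bc T1 p x = 0" using opp_side_iff[OF nd, of p] V(1) q(2) \<open>opp_side T1 q = opp_side T1 p\<close> by auto
      have xab: "x \<in> closed_segment a b" using q(2) 1 by simp
      obtain c where c: "{a, b} = {z, c}" "c \<noteq> z" using C(2)[OF T1(1)] V pz pp d by auto
      have "bc T1 c x \<noteq> 0"
      proof
        assume "bc T1 c x = 0"
        moreover have "(\<Sum>w\<in>vertices T1. bc T1 w x *\<^sub>R w) = x" "(\<Sum>w\<in>vertices T1. bc T1 w x) = 1" 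
          using bary_point[OF nd] bary_sum[OF nd] by auto
        moreover have "vertices T1 = {p, z, c}" "p \<noteq> z" "p \<noteq> c" using V c d by (auto simp: doubleton_eq_iff)
        ultimately have "x = z" using pp c(2) by auto
        then show False using x by (simp add: B_def)
      qed
      moreover have "0 \<le> bc T1 c x" using tri_iff[OF nd] T1(2) V c(1) by (metis insertCI)
      ultimately have "0 < bc T1 c x" by simp
      then have "0 < bc T1 a x" "0 < bc T1 b x" using pz c by (auto simp: doubleton_eq_iff)
      then have "x \<in> interior (tri T1 \<union> tri T2)"
        using interior_of_two_triangles[OF C(1)[OF T1(1)] T2(1) T2(3)[symmetric] V d xab] by simp
      moreover have "interior (tri T1 \<union> tri T2) \<subseteq> interior W" using T1 T2C by (intro interior_mono) (auto simp: W_def)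
      ultimately show ?thesis by blast
    qed
  qed
  have TC: "T \<in> C" by (simp add: C_def)
  have "B \<subseteq> W"
  proof (rule ccontr)
    assume "\<not> B \<subseteq> W"
    then have 1: "(- W) \<inter> B \<noteq> {}" by auto
    have 2: "interior W \<inter> B \<noteq> {}"
    proof -
      obtain q s where V: "vertices T = {z, q, s}" "z \<noteq> q" using nondegenerateE[OF nondeg[OF T(1)] T(2)] by metis
      define t where "t = min 1 (r / (2 * dist z q))"
      have t: "0 < t" "t \<le> 1" using V r by (auto simp: t_def)
      have "t * dist z q \<le> r / (2 * dist z q) * dist z q" unfolding t_def using V by (intro mult_right_mono) auto
      then have tr: "t * dist z q < r" using r V by simp
      let ?x = "(1 - t) *\<^sub>R z + t *\<^sub>R q"
      have e: "?x = z + t *\<^sub>R (q - z)" by (simp add: algebra_simps)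
      have "dist z ?x = t * dist z q" unfolding e using t by (simp add: dist_norm norm_minus_commute)
      then have "?x \<in> B" unfolding B_def using tr V t e by auto
      moreover have "?x \<in> tri T" using t V by (intro convexD[OF convex_tri]) (auto intro: vertex_in_tri)
      ultimately have "?x \<in> W \<inter> B" using TC by (auto simp: W_def)
      then show ?thesis using in_int by blast
    qed
    have "interior W \<inter> (- W) \<inter> B = {}" using interior_subset by blast
    moreover have "B \<subseteq> interior W \<union> (- W)" using in_int by blast
    moreover have "open (- W)" using clW by auto
    ultimately show False using connectedD[OF conB open_interior[of W]] 1 2 by blast
  qed
  moreover have "z \<in> W" using TC T vertex_in_tri unfolding W_def by blast
  ultimately have ball: "ball z r \<subseteq> W" unfolding B_def by blast
  then have "ball z r \<subseteq> closure \<Omega>" unfolding W_def using C tri_subset_closure by blast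
  then show "z \<in> \<Omega>" using interior_closure_domain r(1) by (metis centre_in_ball interiorI open_ball)
  fix T' assume T': "T' \<in> \<T>" "z \<in> tri T'"
  then have "z \<in> closure (interior (tri T'))" using closure_interior_tri[OF nondeg[OF T'(1)]] by simp
  then obtain y where y: "y \<in> interior (tri T')" "y \<in> ball z r" using r(1) closure_approachable by (metis dist_commute mem_ball)
  then obtain T'' where "T'' \<in> C" "y \<in> tri T''" using ball unfolding W_def by blast
  then have "T' \<in> C" using interior_point_unique[OF T'(1) C(1) y(1)] by blast
  then show "(T, T') \<in> (adjacent R z)\<^sup>*" by (simp add: C_def)
qed

end

section \<open>Shape regularity of newest vertex bisection\<close>

text \<open>The median from the newest vertex and half of the refinement edge determine the triangle; their
  determinant is its area up to sign.\<close>

definition shape_bound :: "real \<Rightarrow> marked_triangle \<Rightarrow> bool" where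
  "shape_bound K T \<longleftrightarrow> (\<forall>a b. base T = {a, b} \<longrightarrow>
     (norm (newest T - midpoint a b))\<^sup>2 + (norm ((b - a) /\<^sub>R 2))\<^sup>2
       \<le> K * \<bar>cross2 (newest T - midpoint a b) ((b - a) /\<^sub>R 2)\<bar>)"

definition shape_regular :: "real \<Rightarrow> marked_triangle \<Rightarrow> bool" where
  "shape_regular C T \<longleftrightarrow> (\<forall>w\<in>vertices T. \<forall>w'\<in>vertices T. (dist w w')\<^sup>2 \<le> C * area T)"

lemma norm2_sq: "(norm (x::point))\<^sup>2 = (x$1)\<^sup>2 + (x$2)\<^sup>2"
  unfolding power2_norm_eq_inner by (simp add: inner_vec_def sum_2 power2_eq_square)

text \<open>With \<open>p\<close> the median from the newest vertex and \<open>q\<close> half of the base, a bisection replaces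
  the pair \<open>(p, q)\<close> by \<open>((q - p)/2, (p + q)/2)\<close> up to signs.  By the parallelogram law this halves
  \<open>\<bar>p\<bar>\<^sup>2 + \<bar>q\<bar>\<^sup>2\<close>, and it halves the determinant as well, so their quotient does not change.\<close>

lemma shape_bound_child:
  assumes K: "shape_bound K T" and T': "T' \<in> children T" shows "shape_bound K T'"
proof -
  obtain a b where ab: "base T = {a, b}" "T' = Marked (midpoint a b) {newest T, a}"
    using T' by (auto simp: children_def)
  define n where "n = newest T"
  define p where "p = n - midpoint a b"
  define q where "q = (b - a) /\<^sub>R 2"
  have old: "(norm p)\<^sup>2 + (norm q)\<^sup>2 \<le> K * \<bar>cross2 p q\<bar>"
    using K ab(1) unfolding shape_bound_def p_def q_def n_def by blast
  show ?thesis unfolding shape_bound_def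
  proof (intro allI impI)
    fix c d assume "base T' = {c, d}"
    then have cd: "(c = n \<and> d = a) \<or> (c = a \<and> d = n)" by (auto simp: ab n_def doubleton_eq_iff)
    let ?p = "newest T' - midpoint c d" and ?q = "(d - c) /\<^sub>R 2"
    have "midpoint c d = midpoint n a" using cd by (auto simp: midpoint_sym)
    then have p': "?p = (q - p) /\<^sub>R 2"
      by (simp add: ab p_def q_def midpoint_def vec_eq_iff forall_2 field_simps)
    have q': "?q = (p + q) /\<^sub>R 2 \<or> ?q = - ((p + q) /\<^sub>R 2)"
      using cd by (auto simp: p_def q_def midpoint_def vec_eq_iff forall_2 field_simps)
    have "norm ?q = norm ((p + q) /\<^sub>R 2)" using q' norm_minus_cancel by metis
    moreover have "(norm ((q - p) /\<^sub>R 2))\<^sup>2 + (norm ((p + q) /\<^sub>R 2))\<^sup>2 = ((norm p)\<^sup>2 + (norm q)\<^sup>2) / 2"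
      unfolding norm2_sq by (simp add: power2_eq_square field_simps)
    ultimately have n2: "(norm ?p)\<^sup>2 + (norm ?q)\<^sup>2 = ((norm p)\<^sup>2 + (norm q)\<^sup>2) / 2" unfolding p' by simp
    have c2: "\<bar>cross2 ?p ?q\<bar> = \<bar>cross2 p q\<bar> / 2"
    proof -
      have 1: "cross2 ((q - p) /\<^sub>R 2) ((p + q) /\<^sub>R 2) = - (cross2 p q / 2)"
        by (simp add: cross2_def field_simps)
      have "cross2 u (- v) = - cross2 u v" for u v by (simp add: cross2_def)
      then have "\<bar>cross2 ?p ?q\<bar> = \<bar>cross2 ((q - p) /\<^sub>R 2) ((p + q) /\<^sub>R 2)\<bar>"
        using q' unfolding p' by (metis abs_minus_cancel)
      then show ?thesis unfolding 1 by simp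
    qed
    show "(norm ?p)\<^sup>2 + (norm ?q)\<^sup>2 \<le> K * \<bar>cross2 ?p ?q\<bar>" unfolding n2 c2 using old by simp
  qed
qed

lemma child_subset: assumes "T' \<in> children T" shows "tri T' \<subseteq> tri T"
proof -
  obtain a b where ab: "base T = {a, b}" "T' = Marked (midpoint a b) {newest T, a}"
    using assms by (auto simp: children_def)
  have v: "a \<in> tri T" "b \<in> tri T" "newest T \<in> tri T" using ab by (auto simp: vertices_def intro!: vertex_in_tri)
  then have "closed_segment a b \<subseteq> tri T" using convex_tri convex_contains_segment by blast
  then have "midpoint a b \<in> tri T" using midpoint_in_closed_segment by blast
  then have "vertices T' \<subseteq> tri T" using v by (auto simp: ab vertices_def)
  then show ?thesis unfolding tri_def[of T'] using convex_tri by (rule hull_minimal)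
qed

lemma bisections_invariant:
  assumes "bisection\<^sup>*\<^sup>* \<T> \<N>" "\<forall>T\<in>\<T>. P T" "\<And>T T'. P T \<Longrightarrow> T' \<in> children T \<Longrightarrow> P T'"
  shows "\<forall>T\<in>\<N>. P T"
  using assms(1)
proof (induction rule: rtranclp_induct)
  case base then show ?case using assms(2) .
next
  case (step \<M> \<M>')
  from step.hyps(2) obtain T where "T \<in> \<M>" "\<M>' = (\<M> - {T}) \<union> children T" by (auto simp: bisection_def)
  then show ?case using step.IH assms(3) by auto
qed

lemma bisections_subset:
  assumes "bisection\<^sup>*\<^sup>* \<T> \<N>" "T' \<in> \<N>" obtains T where "T \<in> \<T>" "tri T' \<subseteq> tri T"
proof -
  have "\<forall>T'\<in>\<N>. \<exists>T\<in>\<T>. tri T' \<subseteq> tri T"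
    by (rule bisections_invariant[OF assms(1)]) (use child_subset in blast)+
  then show ?thesis using that assms(2) by blast
qed

text \<open>The sides are \<open>2q\<close> and \<open>p \<plusminus> q\<close>.\<close>

lemma shape_bound_regular:
  assumes "shape_bound K T" "nondegenerate T" shows "shape_regular (4 * K) T"
proof -
  obtain a b where ab: "base T = {a, b}" using assms(2) by (auto simp: nondegenerate_def card_2_iff)
  define n where "n = newest T"
  define p where "p = n - midpoint a b"
  define q where "q = (b - a) /\<^sub>R 2"
  have V: "vertices T = {n, a, b}" by (simp add: vertices_def ab n_def)
  have old: "(norm p)\<^sup>2 + (norm q)\<^sup>2 \<le> K * \<bar>cross2 p q\<bar>"
    using assms(1) ab(1) unfolding shape_bound_def p_def q_def n_def by blast
  have "\<bar>cross2 (a - n) (b - n)\<bar> / 2 = \<bar>cross2 p q\<bar>"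
  proof -
    have "cross2 (a - n) (b - n) / 2 = - cross2 p q"
      by (simp add: cross2_def p_def q_def midpoint_def field_simps)
    then show ?thesis by simp
  qed
  then have area: "area T = \<bar>cross2 p q\<bar>" using area_eq[OF V] by simp
  have s: "n - a = p + q" "n - b = p - q" "b - a = 2 *\<^sub>R q"
    by (simp_all add: p_def q_def midpoint_def vec_eq_iff forall_2 field_simps)
  have "(norm (p + q))\<^sup>2 + (norm (p - q))\<^sup>2 = 2 * ((norm p)\<^sup>2 + (norm q)\<^sup>2)"
    unfolding norm2_sq by (simp add: power2_eq_square algebra_simps)
  moreover have "(norm (p + q))\<^sup>2 \<ge> 0" "(norm (p - q))\<^sup>2 \<ge> 0" "(norm p)\<^sup>2 \<ge> 0" "(norm q)\<^sup>2 \<ge> 0" by auto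
  ultimately have b: "(norm (p + q))\<^sup>2 \<le> 4 * ((norm p)\<^sup>2 + (norm q)\<^sup>2)"
    "(norm (p - q))\<^sup>2 \<le> 4 * ((norm p)\<^sup>2 + (norm q)\<^sup>2)" "(norm (2 *\<^sub>R q))\<^sup>2 \<le> 4 * ((norm p)\<^sup>2 + (norm q)\<^sup>2)"
    by (linarith, linarith, simp add: power_mult_distrib)
  then have b: "(dist n a)\<^sup>2 \<le> 4 * ((norm p)\<^sup>2 + (norm q)\<^sup>2)"
    "(dist n b)\<^sup>2 \<le> 4 * ((norm p)\<^sup>2 + (norm q)\<^sup>2)" "(dist b a)\<^sup>2 \<le> 4 * ((norm p)\<^sup>2 + (norm q)\<^sup>2)"
    unfolding dist_norm s by auto
  have "(dist w w')\<^sup>2 \<le> 4 * ((norm p)\<^sup>2 + (norm q)\<^sup>2)" if "w \<in> vertices T" "w' \<in> vertices T" for w w'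
    using that b \<open>(norm p)\<^sup>2 \<ge> 0\<close> \<open>(norm q)\<^sup>2 \<ge> 0\<close> unfolding V by (auto simp: dist_commute)
  then show ?thesis unfolding shape_regular_def area using old by force
qed

lemma exists_shape_bound:
  assumes "finite \<T>" "\<forall>T\<in>\<T>. nondegenerate T" obtains K where "K \<ge> 1" "\<forall>T\<in>\<T>. shape_bound K T"
proof -
  have "\<exists>K\<ge>1. \<forall>T\<in>\<T>. shape_bound K T" using assms
  proof (induction rule: finite_induct)
    case empty then show ?case by (intro exI[of _ 1]) auto
  next
    case (insert T \<M>)
    then obtain K where K: "K \<ge> 1" "\<forall>T\<in>\<M>. shape_bound K T" by auto
    have nd: "nondegenerate T" using insert by auto
    obtain a b where ab: "base T = {a, b}" using nd by (auto simp: nondegenerate_def card_2_iff)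
    let ?P = "\<lambda>a b. newest T - midpoint a b" and ?Q = "\<lambda>a b. (b - a) /\<^sub>R 2"
    let ?N = "\<lambda>a b. (norm (?P a b))\<^sup>2 + (norm (?Q a b))\<^sup>2"
    have V: "vertices T = {newest T, a, b}" by (simp add: vertices_def ab)
    have "cross2 (a - newest T) (b - newest T) = - 2 * cross2 (?P a b) (?Q a b)"
      by (simp add: cross2_def midpoint_def field_simps)
    then have D: "cross2 (?P a b) (?Q a b) \<noteq> 0" using area_pos[OF nd] area_eq[OF V] by auto
    define M where "M = max K (?N a b / \<bar>cross2 (?P a b) (?Q a b)\<bar>)"
    have "shape_bound M T" unfolding shape_bound_def
    proof (intro allI impI)
      fix c d assume "base T = {c, d}"
      then consider "c = a" "d = b" | "c = b" "d = a" using ab by (auto simp: doubleton_eq_iff)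
      then have e: "?N c d = ?N a b \<and> \<bar>cross2 (?P c d) (?Q c d)\<bar> = \<bar>cross2 (?P a b) (?Q a b)\<bar>"
      proof cases
        case 2
        have n: "?Q b a = - ?Q a b" by (simp add: algebra_simps)
        have "cross2 u (- v) = - cross2 u v" for u v by (simp add: cross2_def)
        then show ?thesis unfolding 2 n norm_minus_cancel by (simp add: midpoint_sym)
      qed auto
      have "?N a b / \<bar>cross2 (?P a b) (?Q a b)\<bar> \<le> M" by (simp add: M_def)
      then show "?N c d \<le> M * \<bar>cross2 (?P c d) (?Q c d)\<bar>" using e D by (simp add: divide_le_eq)
    qed
    moreover have "shape_bound M T'" if "T' \<in> \<M>" for T'
    proof -
      have "shape_bound K T'" using K that by blast
      moreover have "K * \<bar>x\<bar> \<le> M * \<bar>x\<bar>" for x unfolding M_def by (intro mult_right_mono) auto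
      ultimately show ?thesis unfolding shape_bound_def using order_trans by blast
    qed
    moreover have "M \<ge> 1" using K by (simp add: M_def)
    ultimately show ?case by (intro exI[of _ M]) auto
  qed
  then show ?thesis using that by blast
qed

lemma bary_gradient_bound:
  assumes "nondegenerate T" "shape_regular C T" "z \<in> vertices T"
  shows "(norm (fst (bary T z)))\<^sup>2 \<le> C / (4 * area T)"
proof -
  obtain q r where V: "vertices T = {z, q, r}" "z \<noteq> q" "z \<noteq> r" using nondegenerateE[OF assms(1,3)] by metis
  have "(norm (fst (bary T z)) * (2 * area T))\<^sup>2 = (dist q r)\<^sup>2" using bary_gradient[OF assms(1) V] by simp
  also have "\<dots> \<le> C * area T" using assms(2) V unfolding shape_regular_def by blast
  finally have "(norm (fst (bary T z)))\<^sup>2 * (4 * area T) * area T \<le> C * area T" by (simp add: power2_eq_square algebra_simps)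
  then show ?thesis using area_pos[OF assms(1)] by (simp add: field_simps)
qed

text \<open>A side is at least as long as the height from one of its endpoints.\<close>

lemma area_le_side:
  assumes "nondegenerate T" "shape_regular C T" "z \<in> vertices T" "q \<in> vertices T" "z \<noteq> q"
  shows "4 * area T \<le> C * (dist z q)\<^sup>2"
proof -
  have "1 = fst (bary T z) \<bullet> (z - q)" 
    using bary_vertex[OF assms(1,3,3)] bary_vertex[OF assms(1,3,4)] assms(5) aff_diff[of "bary T z" z q] by simp
  also have "\<dots> \<le> norm (fst (bary T z)) * dist z q" unfolding dist_norm by (rule norm_cauchy_schwarz)
  finally have "1\<^sup>2 \<le> (norm (fst (bary T z)) * dist z q)\<^sup>2" by (intro power_mono) auto
  also have "\<dots> \<le> C / (4 * area T) * (dist z q)\<^sup>2" unfolding power_mult_distrib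
    by (intro mult_right_mono bary_gradient_bound assms) auto
  finally show ?thesis using area_pos[OF assms(1)] by (simp add: field_simps)
qed

text \<open>Around a vertex each triangle contains a homothetic copy of itself that has diameter at most
  \<open>\<rho>\<close> and area comparable to \<open>\<rho>\<^sup>2\<close>; the copies overlap in null sets only,
  which bounds their number.\<close>

lemma (in mesh) card_triangles_at_vertex:
  assumes sr: "\<forall>T\<in>\<T>. shape_regular C T"
  shows "real (card {T\<in>\<T>. z \<in> vertices T}) \<le> pi * C"
proof (cases "{T\<in>\<T>. z \<in> vertices T} = {}")
  case True
  have "\<T> \<noteq> {}" using union_tri polygonal unfolding polygonal_domain_def by auto
  then obtain T where T: "T \<in> \<T>" by auto
  have "0 \<le> C * area T" using sr T unfolding shape_regular_def vertices_def 
    by (metis insertI1 dist_self zero_power2)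
  then have "0 \<le> C" using area_pos[OF nondeg[OF T]] by (simp add: zero_le_mult_iff)
  then show ?thesis unfolding True by simp
next
  case False
  define A where "A = {T\<in>\<T>. z \<in> vertices T}"
  have A: "finite A" "A \<noteq> {}" using finite_mesh False by (auto simp: A_def)
  have nd: "nondegenerate T" if "T \<in> A" for T using that nondeg by (simp add: A_def)
  define m where "m = Min (area ` A)"
  have m: "m \<le> area T" if "T \<in> A" for T using A that by (simp add: m_def)
  have "m \<in> area ` A" unfolding m_def using A by (intro Min_in) auto
  then have mpos: "0 < m" using nd area_pos by auto
  obtain T0 where T0: "T0 \<in> A" using A by auto
  have "z \<in> vertices T0" using T0 by (simp add: A_def)
  then obtain q where q: "q \<in> vertices T0" "q \<noteq> z" using nondegenerateE[OF nd[OF T0]] by (metis insertCI)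
  have "0 < (dist z q)\<^sup>2" using q by simp
  also have "(dist z q)\<^sup>2 \<le> C * area T0" using sr T0 q unfolding shape_regular_def A_def by blast
  finally have C: "0 < C" using area_pos[OF nd[OF T0]] by (simp add: zero_less_mult_iff)
  define \<rho> where "\<rho> = sqrt (C * m)"
  have \<rho>: "0 < \<rho>" "\<rho>\<^sup>2 = C * m" using C mpos by (auto simp: \<rho>_def)
  define s where "s T = \<rho> / sqrt (C * area T)" for T
  define H where "H T = (\<lambda>x. s T *\<^sub>R x + (1 - s T) *\<^sub>R z) ` tri T" for T
  have s: "0 < s T" "s T \<le> 1" "(s T)\<^sup>2 * area T = m" "s T * sqrt (C * area T) = \<rho>" if "T \<in> A" for T
  proof -
    have ap: "0 < area T" using area_pos nd that by blast
    then have pos: "0 < C * area T" using C by simp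
    show "0 < s T" using \<rho> pos by (simp add: s_def)
    show "s T \<le> 1" using pos C m[OF that] unfolding s_def \<rho>_def by simp
    show "(s T)\<^sup>2 * area T = m" using pos C ap \<rho> by (simp add: s_def power_divide)
    show "s T * sqrt (C * area T) = \<rho>" using pos C ap by (simp add: s_def)
  qed
  have Hsub: "H T \<subseteq> tri T" if "T \<in> A" for T
  proof
    fix y assume "y \<in> H T"
    then obtain x where "x \<in> tri T" "y = s T *\<^sub>R x + (1 - s T) *\<^sub>R z" by (auto simp: H_def)
    moreover have "z \<in> tri T" using that vertex_in_tri by (auto simp: A_def)
    ultimately show "y \<in> tri T" using s[OF that] by (auto intro!: convexD[OF convex_tri])
  qed
  have Hball: "H T \<subseteq> cball z \<rho>" if "T \<in> A" for T
  proof
    fix y assume "y \<in> H T"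
    then obtain x where x: "x \<in> tri T" "y = s T *\<^sub>R x + (1 - s T) *\<^sub>R z" by (auto simp: H_def)
    have "vertices T \<subseteq> cball z (sqrt (C * area T))"
    proof
      fix w assume "w \<in> vertices T"
      then have "(dist z w)\<^sup>2 \<le> C * area T" using sr that unfolding shape_regular_def A_def by blast
      then show "w \<in> cball z (sqrt (C * area T))" by (simp add: real_le_rsqrt)
    qed
    then have "tri T \<subseteq> cball z (sqrt (C * area T))" unfolding tri_def by (intro hull_minimal convex_cball)
    then have d: "dist z x \<le> sqrt (C * area T)" using x by auto
    have "z - y = s T *\<^sub>R (z - x)" using x by (simp add: algebra_simps)
    then have "dist z y = s T * dist z x" using s(1)[OF that] by (simp add: dist_norm)
    also have "\<dots> \<le> s T * sqrt (C * area T)" using d s(1)[OF that] by (intro mult_left_mono) auto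
    finally show "y \<in> cball z \<rho>" using s(4)[OF that] by simp
  qed
  have Hm: "measure lebesgue (H T) = m" if "T \<in> A" for T
    unfolding H_def measure_lebesgue_affine using s[OF that] by simp
  have Hl: "H T \<in> lmeasurable" if "T \<in> A" for T
    unfolding H_def using compact_tri[OF nd[OF that]] 
    by (intro lmeasurable_compact compact_continuous_image continuous_intros)
  have "real (card A) * m = (\<Sum>T\<in>A. measure lebesgue (H T))" using Hm by simp
  also have "\<dots> = measure lebesgue (\<Union>(H ` A))"
  proof (rule measure_negligible_finite_Union_image[symmetric, OF A(1) Hl])
    show "pairwise (\<lambda>S T. negligible (H S \<inter> H T)) A"
    proof (rule pairwiseI)
      fix S T assume *: "S \<in> A" "T \<in> A" "S \<noteq> T"
      then have "negligible (tri S \<inter> tri T)" using negligible_tri_Int by (auto simp: A_def)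
      then show "negligible (H S \<inter> H T)" by (rule negligible_subset) (use Hsub * in blast)
    qed
  qed
  also have "\<dots> \<le> measure lebesgue (cball z \<rho>)"
    using Hl Hball A(1) by (intro measure_mono_fmeasurable) (auto intro!: fmeasurableD sets.finite_UN)
  also have "\<dots> = pi * \<rho>\<^sup>2" using \<rho>(1) content_cball[of \<rho> z] by (simp add: unit_ball_vol_2)
  finally have "real (card A) * m \<le> (pi * C) * m" using \<rho> by simp
  then show ?thesis using mpos unfolding A_def by simp
qed

section \<open>Test functions\<close>

text \<open>The functions \<open>exp (-1/t) / t\<^sup>n\<close> for \<open>t > 0\<close>, extended by zero.  The family is closed under
  differentiation up to linear combinations, which gives smoothness by a plain induction.\<close>

definition flat :: "nat \<Rightarrow> real \<Rightarrow> real" where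
  "flat n t = (if t \<le> 0 then 0 else exp (- (1 / t)) / t ^ n)"

lemma flat_derivative: "(flat n has_real_derivative (flat (n + 2) t - real n * flat (n + 1) t)) (at t)"
proof (cases t "0::real" rule: linorder_cases)
  case less
  have "((\<lambda>x. 0) has_real_derivative 0) (at t)" by simp
  then have "(flat n has_real_derivative 0) (at t)"
    by (rule has_field_derivative_transform_within_open[where S = "{..<0}"]) (use less in \<open>auto simp: flat_def\<close>)
  then show ?thesis using less by (simp add: flat_def)
next
  case greater
  have e: "real n * (- (i * i) * i ^ (n - Suc 0)) = - (real n * i ^ (n + 1))" for i :: real
    by (cases n) auto
  have "(inverse has_real_derivative - (inverse t * inverse t)) (at t)"
    using DERIV_inverse[of t UNIV] greater by (simp add: power2_eq_square)
  then have d1: "((\<lambda>x. inverse x ^ n) has_real_derivative - (real n * inverse t ^ (n + 1))) (at t)"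
    by (rule DERIV_cong[OF DERIV_power[of inverse _ t UNIV n]]) (rule e)
  have d2: "((\<lambda>x. exp (- inverse x)) has_real_derivative exp (- inverse t) * inverse t ^ 2) (at t)"
    using greater by (auto intro!: derivative_eq_intros simp: power2_eq_square)
  have "((\<lambda>x. exp (- inverse x) * inverse x ^ n) has_real_derivative 
      exp (- inverse t) * (- (real n * inverse t ^ (n + 1))) + (exp (- inverse t) * inverse t ^ 2) * inverse t ^ n) (at t)"
    by (rule DERIV_mult'[OF d2 d1])
  moreover have "exp (- inverse t) * (- (real n * inverse t ^ (n + 1))) + (exp (- inverse t) * inverse t ^ 2) * inverse t ^ n
    = flat (n + 2) t - real n * flat (n + 1) t"
    using greater by (simp add: flat_def divide_inverse power_inverse[symmetric] power2_eq_square del: power_inverse)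
  ultimately have "((\<lambda>x. exp (- inverse x) * inverse x ^ n) has_real_derivative (flat (n + 2) t - real n * flat (n + 1) t)) (at t)"
    by simp
  then show ?thesis
    by (rule has_field_derivative_transform_within_open[where S = "{0<..}"])
      (use greater in \<open>auto simp: flat_def divide_inverse power_inverse\<close>)
next
  case equal
  have "((\<lambda>h. flat n h / h) \<longlongrightarrow> 0) (at 0)"
  proof (rule filterlim_split_at)
    show "((\<lambda>h. flat n h / h) \<longlongrightarrow> 0) (at_left 0)"
      by (rule tendsto_eventually) (auto simp: eventually_at_filter flat_def)
    have "((\<lambda>h. inverse h ^ (n + 1) / exp (inverse h)) \<longlongrightarrow> (0::real)) (at_right 0)"
      by (rule filterlim_compose[OF tendsto_power_div_exp_0 filterlim_inverse_at_top_right])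
    moreover have "\<forall>\<^sub>F h in at_right (0::real). inverse h ^ (n + 1) / exp (inverse h) = flat n h / h"
      by (auto simp: eventually_at_filter flat_def exp_minus divide_simps)
    ultimately show "((\<lambda>h. flat n h / h) \<longlongrightarrow> 0) (at_right 0)"
      by (rule Lim_transform_eventually)
  qed
  then show ?thesis using equal by (simp add: DERIV_def flat_def)
qed

lemma flat_nonneg: "0 \<le> flat n t" by (simp add: flat_def)
lemma flat_le_1: "flat 0 t \<le> 1" by (simp add: flat_def)

lemma C_k_D: "C_k (Suc k) f \<Longrightarrow> C_k k f"
proof (induction k arbitrary: f)
  case 0
  then obtain g where "\<forall>x. GDERIV f x :> g x" by auto
  then have "isCont f x" for x using has_derivative_continuous unfolding gderiv_def by blast
  then show ?case by (simp add: continuous_at_imp_continuous_on)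
next
  case (Suc k)
  then obtain g where g: "\<forall>x. GDERIV f x :> g x" "\<forall>i. C_k (Suc k) (\<lambda>x. g x $ i)"
    using C_k.simps(2)[of "Suc k" f] by blast
  have "\<forall>i. C_k k (\<lambda>x. g x $ i)" using g(2) Suc.IH by blast
  then show ?case using g(1) C_k.simps(2)[of k f] by blast
qed

lemma C_k_const: "C_k k (\<lambda>x. c)"
proof (induction k arbitrary: c)
  case (Suc k)
  show ?case unfolding C_k.simps by (rule exI[of _ "\<lambda>x. 0"]) (simp add: GDERIV_const Suc)
qed simp

lemma C_k_add: "C_k k f \<Longrightarrow> C_k k g \<Longrightarrow> C_k k (\<lambda>x. f x + g x)"
proof (induction k arbitrary: f g)
  case 0 then show ?case by (auto intro: continuous_intros)
next
  case (Suc k)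
  obtain f' where f: "\<forall>x. GDERIV f x :> f' x" "\<forall>i. C_k k (\<lambda>x. f' x $ i)" using Suc.prems(1) by auto
  obtain g' where g: "\<forall>x. GDERIV g x :> g' x" "\<forall>i. C_k k (\<lambda>x. g' x $ i)" using Suc.prems(2) by auto
  show ?case unfolding C_k.simps
    by (rule exI[of _ "\<lambda>x. f' x + g' x"]) (use f g Suc.IH in \<open>auto intro: GDERIV_add\<close>)
qed

lemma C_k_mult: "C_k k f \<Longrightarrow> C_k k g \<Longrightarrow> C_k k (\<lambda>x. f x * g x)"
proof (induction k arbitrary: f g)
  case 0 then show ?case by (auto intro: continuous_intros)
next
  case (Suc k)
  obtain f' where f: "\<forall>x. GDERIV f x :> f' x" "\<forall>i. C_k k (\<lambda>x. f' x $ i)" using Suc.prems(1) by auto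
  obtain g' where g: "\<forall>x. GDERIV g x :> g' x" "\<forall>i. C_k k (\<lambda>x. g' x $ i)" using Suc.prems(2) by auto
  have fg: "C_k k f" "C_k k g" using Suc.prems C_k_D by auto
  show ?case unfolding C_k.simps
    by (rule exI[of _ "\<lambda>x. f x *\<^sub>R g' x + g x *\<^sub>R f' x"]) 
      (use f g fg Suc.IH in \<open>auto intro!: GDERIV_mult C_k_add\<close>)
qed

lemma C_k_flat: "C_k k (\<lambda>x. flat n (c * x $ i + d))"
proof (induction k arbitrary: n)
  case 0
  have "isCont (flat n) t" for t using flat_derivative DERIV_isCont by blast
  then have "continuous_on UNIV (flat n)" by (simp add: continuous_at_imp_continuous_on)
  then have "continuous_on UNIV (\<lambda>x::point. flat n (c * x $ i + d))"
    by (rule continuous_on_compose2) (auto intro!: continuous_intros)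
  then show ?case by simp
next
  case (Suc k)
  let ?d = "\<lambda>t. flat (n + 2) t - real n * flat (n + 1) t"
  have "GDERIV (\<lambda>x::point. c * x $ i + d) x :> c *\<^sub>R axis i 1" for x
    unfolding gderiv_def
    by (auto intro!: derivative_eq_intros bounded_linear_imp_has_derivative bounded_linear_vec_nth 
        simp: inner_axis)
  then have g: "GDERIV (\<lambda>x. flat n (c * x $ i + d)) x :> ?d (c * x $ i + d) *\<^sub>R (c *\<^sub>R axis i 1)" for x
    by (rule GDERIV_DERIV_compose) (rule flat_derivative)
  have "C_k k (\<lambda>x. (?d (c * x $ i + d) *\<^sub>R (c *\<^sub>R axis i 1)) $ j)" for j
  proof -
    have "C_k k (\<lambda>x. (flat (n + 2) (c * x $ i + d) + (- real n) * flat (n + 1) (c * x $ i + d)) * ((c *\<^sub>R axis i 1 :: point) $ j))"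
      by (intro C_k_mult C_k_add C_k_const Suc.IH)
    then show ?thesis by (simp add: algebra_simps)
  qed
  then show ?case unfolding C_k.simps
    by (intro exI[of _ "\<lambda>x. ?d (c * x $ i + d) *\<^sub>R (c *\<^sub>R axis i 1)"] conjI allI g)
qed

definition bump :: "point \<Rightarrow> point \<Rightarrow> real \<Rightarrow> point \<Rightarrow> real" where
  "bump a b m x = (flat 0 (m * (x$1 - a$1)) * flat 0 (m * (b$1 - x$1))) *
                  (flat 0 (m * (x$2 - a$2)) * flat 0 (m * (b$2 - x$2)))"

lemma C_k_bump: "C_k k (bump a b m)"
proof -
  have "bump a b m = (\<lambda>x. (flat 0 (m * x$1 + (- m * a$1)) * flat 0 ((- m) * x$1 + m * b$1)) *
                  (flat 0 (m * x$2 + (- m * a$2)) * flat 0 ((- m) * x$2 + m * b$2)))"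
    by (simp add: fun_eq_iff bump_def algebra_simps)
  then show ?thesis by (simp only:) (intro C_k_mult C_k_flat)
qed

lemma continuous_bump: "continuous_on A (bump a b m)"
  using C_k_bump[of 0 a b m] by (auto intro: continuous_on_subset)

lemma bump_nonneg: "0 \<le> bump a b m x" by (simp add: bump_def flat_nonneg)

lemma bump_le_1: "bump a b m x \<le> 1"
proof -
  have "bump a b m x \<le> (1 * 1) * (1 * 1)" unfolding bump_def
    by (intro mult_mono flat_le_1 flat_nonneg mult_nonneg_nonneg zero_le_one)
  then show ?thesis by simp
qed

lemma bump_pos_iff: "0 < m \<Longrightarrow> 0 < bump a b m x \<longleftrightarrow> x \<in> box a b"
  unfolding bump_def mem_box_cart forall_2 by (auto simp: flat_def zero_less_mult_iff mult_le_0_iff)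

lemma bump_zero: "0 < m \<Longrightarrow> x \<notin> box a b \<Longrightarrow> bump a b m x = 0"
  using bump_pos_iff[of m a b x] bump_nonneg[of a b m x] by linarith

lemma bump_test_function: assumes "0 < m" "cbox a b \<subseteq> U" shows "bump a b m \<in> test_functions U"
proof -
  have "{x. bump a b m x \<noteq> 0} \<subseteq> cbox a b" using bump_zero[OF assms(1)] box_subset_cbox by blast
  then have "closure {x. bump a b m x \<noteq> 0} \<subseteq> cbox a b" by (rule closure_minimal) (rule closed_cbox)
  moreover from this have "compact (closure {x. bump a b m x \<noteq> 0})"
    by (meson bounded_cbox bounded_subset closed_closure compact_eq_bounded_closed)
  ultimately show ?thesis using assms(2) C_k_bump by (auto simp: test_functions_def)
qed

text \<open>Since \<open>exp (-1/t)\<close> tends to 1 at infinity, steeper bumps approximate the indicator of the box.\<close>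

lemma bump_tendsto: "(\<lambda>n. bump a b (real (Suc n)) x) \<longlonglongrightarrow> indicator (box a b) x"
proof (cases "x \<in> box a b")
  case True
  have "(\<lambda>n. flat 0 (real (Suc n) * t)) \<longlonglongrightarrow> 1" if "t > 0" for t
  proof -
    have "(\<lambda>n. exp (- (1 / t) * inverse (real (Suc n)))) \<longlonglongrightarrow> exp (- (1 / t) * 0)"
      by (intro tendsto_intros LIMSEQ_inverse_real_of_nat)
    moreover have "exp (- (1 / t) * inverse (real (Suc n))) = flat 0 (real (Suc n) * t)" for n
      using that by (auto simp: flat_def divide_simps mult_le_0_iff)
    ultimately show ?thesis by simp
  qed
  then have "(\<lambda>n. bump a b (real (Suc n)) x) \<longlonglongrightarrow> (1 * 1) * (1 * 1)" unfolding bump_def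
    using True by (intro tendsto_mult) (auto simp: mem_box_cart)
  then show ?thesis using True by simp
next
  case False
  then show ?thesis using bump_zero[of _ x a b] by simp
qed

lemma test_function_gderiv:
  assumes "\<phi> \<in> test_functions U"
  shows "GDERIV \<phi> x :> grad \<phi> x" "continuous_on UNIV (grad \<phi>)" "continuous_on UNIV \<phi>"
proof -
  have "C_k 1 \<phi>" using assms by (simp add: test_functions_def)
  then obtain g where g: "\<And>x. GDERIV \<phi> x :> g x" "\<And>i. continuous_on UNIV (\<lambda>x. g x $ i)" by auto
  have "grad \<phi> y = g y" for y
    unfolding grad_def
  proof (rule the_equality)
    show "GDERIV \<phi> y :> g y" by (rule g(1))
    fix D assume "GDERIV \<phi> y :> D"
    then have "(\<lambda>h. h \<bullet> D) = (\<lambda>h. h \<bullet> g y)" using g(1)[of y] unfolding gderiv_def by (rule has_derivative_unique)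
    then show "D = g y" by (metis vector_eq_ldot)
  qed
  then have e: "grad \<phi> = g" by auto
  show "GDERIV \<phi> x :> grad \<phi> x" unfolding e by (rule g(1))
  show "continuous_on UNIV (grad \<phi>)" unfolding e
    using continuous_on_vec_lambda[of UNIV "\<lambda>i x. g x $ i"] g(2) by simp
  show "continuous_on UNIV \<phi>" using assms C_k.simps(1) unfolding test_functions_def by blast
qed

lemma test_function_zero:
  assumes "\<phi> \<in> test_functions U" "x \<notin> closure {x. \<phi> x \<noteq> 0}" shows "\<phi> x = 0" "grad \<phi> x = 0"
proof -
  show "\<phi> x = 0" using assms(2) closure_subset[of "{x. \<phi> x \<noteq> 0}"] by auto
  have "open (- closure {x. \<phi> x \<noteq> 0})" by auto
  then obtain e where "e > 0" and e: "ball x e \<subseteq> - closure {x. \<phi> x \<noteq> 0}" 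
    using assms(2) open_contains_ball by blast
  have "((\<lambda>y. 0) has_derivative (\<lambda>h. 0)) (at x)" by simp
  then have "(\<phi> has_derivative (\<lambda>h. 0)) (at x)"
    by (rule has_derivative_transform_within_open[of _ _ _ _ "ball x e"]) 
      (use e \<open>e > 0\<close> closure_subset[of "{x. \<phi> x \<noteq> 0}"] in auto)
  moreover have "(\<phi> has_derivative (\<lambda>h. h \<bullet> grad \<phi> x)) (at x)"
    using test_function_gderiv(1)[OF assms(1)] by (simp add: gderiv_def)
  ultimately have "(\<lambda>h. h \<bullet> grad \<phi> x) = (\<lambda>h. 0)" by (rule has_derivative_unique[rotated])
  then show "grad \<phi> x = 0" by (metis inner_eq_zero_iff)
qed

lemma test_function_support:
  assumes "\<phi> \<in> test_functions U" obtains R where "R > 0" "\<And>x. x \<notin> cball 0 R \<Longrightarrow> \<phi> x = 0 \<and> grad \<phi> x = 0"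
proof -
  have "bounded (closure {x. \<phi> x \<noteq> 0})" using assms by (auto simp: test_functions_def compact_imp_bounded)
  then obtain R where "R > 0" "\<forall>x\<in>closure {x. \<phi> x \<noteq> 0}. norm x \<le> R" by (auto simp: bounded_pos)
  moreover have "\<phi> x = 0 \<and> grad \<phi> x = 0" if "x \<notin> cball 0 R" for x
  proof -
    have "x \<notin> closure {x. \<phi> x \<noteq> 0}" using calculation(2) that by auto
    from test_function_zero[OF assms this] show ?thesis by blast
  qed
  ultimately show ?thesis using that by blast
qed

lemma bounded_by_compact_support:
  fixes f :: "point \<Rightarrow> 'a::real_normed_vector"
  assumes "continuous_on UNIV f" "\<And>x. x \<notin> cball 0 R \<Longrightarrow> f x = 0"
  obtains M where "M \<ge> 0" "\<And>x. norm (f x) \<le> M"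
proof -
  have "bounded (f ` cball 0 R)" using assms(1) 
    by (intro compact_imp_bounded compact_continuous_image) (auto intro: continuous_on_subset)
  then obtain M where "M > 0" "\<forall>x\<in>cball 0 R. norm (f x) \<le> M" by (auto simp: bounded_pos)
  then show ?thesis using that[of M] assms(2) by (metis less_imp_le norm_zero)
qed

lemma test_function_lipschitz:
  assumes "\<phi> \<in> test_functions U" obtains L where "lipschitz_on L UNIV \<phi>"
proof -
  obtain R where R: "\<And>x. x \<notin> cball 0 R \<Longrightarrow> grad \<phi> x = 0" using test_function_support[OF assms] by metis
  obtain M where M: "M \<ge> 0" "\<And>x. norm (grad \<phi> x) \<le> M"
    using bounded_by_compact_support[OF test_function_gderiv(2)[OF assms] R] by metis
  have "lipschitz_on M UNIV \<phi>"
  proof (rule bounded_derivative_imp_lipschitz[OF _ _ _ M(1)])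
    show "(\<phi> has_derivative (\<lambda>h. h \<bullet> grad \<phi> x)) (at x within UNIV)" for x
      using test_function_gderiv(1)[OF assms] by (simp add: gderiv_def)
    show "onorm (\<lambda>h. h \<bullet> grad \<phi> x) \<le> M" for x
    proof (rule onorm_le)
      fix h
      have "norm (h \<bullet> grad \<phi> x) \<le> norm h * norm (grad \<phi> x)" by (simp add: Cauchy_Schwarz_ineq2)
      also have "\<dots> \<le> M * norm h" using mult_right_mono[OF M(2)[of x] norm_ge_zero[of h]] by (simp add: mult.commute)
      finally show "norm (h \<bullet> grad \<phi> x) \<le> M * norm h" .
    qed
  qed simp
  then show ?thesis using that by blast
qed

section \<open>Uniqueness of weak gradients\<close>

lemma AE_lebesgue_iff: "(AE x in lebesgue. P x) \<longleftrightarrow> negligible {x::'a::euclidean_space. \<not> P x}"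
proof
  assume "AE x in lebesgue. P x"
  then obtain N where "N \<in> null_sets lebesgue" "{x::'a. \<not> P x} \<subseteq> N" 
    unfolding eventually_ae_filter by auto
  then show "negligible {x::'a. \<not> P x}" using negligible_iff_null_sets negligible_subset by blast
next
  assume "negligible {x::'a. \<not> P x}"
  then have "{x::'a. \<not> P x} \<in> null_sets lebesgue" by (simp add: negligible_iff_null_sets)
  then show "AE x in lebesgue. P x" by (rule AE_I') auto
qed

lemma AE_lebesgue_on_iff:
  assumes "S \<in> sets lebesgue" 
  shows "(AE x in lebesgue_on S. P x) \<longleftrightarrow> negligible {x::'a::euclidean_space. x \<in> S \<and> \<not> P x}"
  using assms by (subst AE_restrict_space_iff) (auto simp: AE_lebesgue_iff)

text \<open>The boxes are an intersection-stable generator of the Borel sets, so the sets on which the integral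
  vanishes include all Borel sets.\<close>

lemma null_by_boxes:
  fixes h :: "point \<Rightarrow> real"
  assumes h: "integrable lebesgue h" and all: "integral\<^sup>L lebesgue h = 0"
    and box: "\<And>a b. integral\<^sup>L lebesgue (\<lambda>x. indicator (box a b) x * h x) = 0"
  shows "AE x in lebesgue. h x = 0"
proof -
  obtain h' where h': "h' \<in> borel_measurable lborel" "AE x in lborel. h x = h' x"
    using completion_ex_borel_measurable_real borel_measurable_integrable[OF h] by blast
  have ae: "AE x in lebesgue. h x = h' x" using h'(2) by (rule AE_completion)
  have h'l: "h' \<in> borel_measurable lebesgue" using h'(1) by (rule measurable_completion)
  have int': "integrable lborel h'"
  proof -
    have "integrable lebesgue h'" using h ae h'l integrable_cong_AE[of h lebesgue h'] borel_measurable_integrable[OF h] by blast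
    then show ?thesis using integrable_completion[OF h'(1)] by blast
  qed
  have eq: "(LINT x:A|lborel. h' x) = integral\<^sup>L lebesgue (\<lambda>x. indicator A x * h x)" if A: "A \<in> sets borel" for A
  proof -
    have m: "(\<lambda>x. indicator A x * h' x) \<in> borel_measurable lborel" using h'(1) A by auto
    have Al: "A \<in> sets lebesgue" using A by (simp add: sets_completionI_sets)
    have "(LINT x:A|lborel. h' x) = integral\<^sup>L lebesgue (\<lambda>x. indicator A x * h' x)"
      unfolding set_lebesgue_integral_def using integral_completion[OF m] by simp
    also have "\<dots> = integral\<^sup>L lebesgue (\<lambda>x. indicator A x * h x)"
      using ae Al h'l borel_measurable_integrable[OF h] by (intro integral_cong_AE) auto
    finally show ?thesis .
  qed
  have si: "set_integrable lborel A h'" if "A \<in> sets borel" for A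
    using int' that unfolding set_integrable_def by (intro integrable_mult_indicator) auto
  have all': "(LINT x:UNIV|lborel. h' x) = 0" using eq[of UNIV] all by simp
  have zero: "(LINT x:A|lborel. h' x) = 0" if "A \<in> sets borel" for A
  proof -
    have "Int_stable (range (\<lambda>(a, b). box a b :: point set))"
      by (auto simp: Int_stable_def box_Int_box)
    moreover have "(range (\<lambda>(a, b). box a b :: point set)) \<subseteq> Pow UNIV" by auto
    moreover have "A \<in> sigma_sets UNIV (range (\<lambda>(a, b). box a b))"
      using that unfolding borel_eq_box by simp
    ultimately show ?thesis
    proof (induction rule: sigma_sets_induct_disjoint)
      case (basic A) then show ?case using eq box by auto
    next
      case empty then show ?case by (simp add: set_lebesgue_integral_def)
    next
      case (compl A)
      then have [measurable]: "A \<in> sets borel" by (simp add: borel_eq_box)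
      have "(LINT x:A \<union> (UNIV - A)|lborel. h' x) = (LINT x:A|lborel. h' x) + (LINT x:UNIV - A|lborel. h' x)"
        by (intro set_integral_Un si) auto
      then show ?case using all' compl by simp
    next
      case (union F)
      then have F: "\<And>i. F i \<in> sets borel" by (simp add: borel_eq_box subset_eq)
      have "(LINT x:(\<Union>i. F i)|lborel. h' x) = (\<Sum>i. (LINT x:(F i)|lborel. h' x))"
        using F union(1) by (intro lebesgue_integral_countable_add si) (auto simp: disjoint_family_on_def)
      then show ?case using union by simp
    qed
  qed
  have "AE x in lborel. h' x = 0" by (rule sigma_finite_measure.density_zero[OF lborel.sigma_finite_measure_axioms int']) (use zero in simp)
  then have "AE x in lebesgue. h' x = 0" by (rule AE_completion)
  with ae show ?thesis by eventually_elim simp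
qed

text \<open>Bump functions converge boundedly to the indicators of boxes, so the integral over each box inside
  \<open>U\<close> vanishes.\<close>

lemma fundamental_lemma:
  fixes G :: "point \<Rightarrow> real"
  assumes U: "open U" and G: "integrable (lebesgue_on U) G"
    and test: "\<And>\<phi>. \<phi> \<in> test_functions U \<Longrightarrow> integral\<^sup>L (lebesgue_on U) (\<lambda>x. \<phi> x * G x) = 0"
  shows "AE x in lebesgue_on U. G x = 0"
proof -
  have Ul: "U \<in> sets lebesgue" using U by (simp add: borel_open sets_completionI_sets)
  define H where "H x = (if x \<in> U then G x else 0)" for x
  have H: "integrable lebesgue H" unfolding H_def using Lebesgue_Measure.integrable_restrict_UNIV[OF Ul] G by blast
  have box0: "integral\<^sup>L lebesgue (\<lambda>x. indicator (box a b) x * H x) = 0" if ab: "cbox a b \<subseteq> U" for a b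
  proof -
    have "(\<lambda>n. integral\<^sup>L lebesgue (\<lambda>x. bump a b (real (Suc n)) x * H x)) \<longlonglongrightarrow> 
      integral\<^sup>L lebesgue (\<lambda>x. indicator (box a b) x * H x)"
    proof (rule integral_dominated_convergence[where w = "\<lambda>x. norm (H x)"])
      show "(\<lambda>x. indicator (box a b) x * H x) \<in> borel_measurable lebesgue"
        using H by (intro borel_measurable_times borel_measurable_indicator) (auto simp: sets_completionI_sets)
      have "bump a b (real (Suc n)) \<in> borel_measurable lebesgue" for n
        using borel_measurable_continuous_onI[OF continuous_bump[of UNIV a b "real (Suc n)"]]
        by (intro measurable_completion) simp
      then show "(\<lambda>x. bump a b (real (Suc n)) x * H x) \<in> borel_measurable lebesgue" for n
        using borel_measurable_integrable[OF H] by (intro borel_measurable_times)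
      show "integrable lebesgue (\<lambda>x. norm (H x))" using H by (rule integrable_norm)
      show "AE x in lebesgue. (\<lambda>n. bump a b (real (Suc n)) x * H x) \<longlonglongrightarrow> indicator (box a b) x * H x"
        by (intro AE_I2 tendsto_mult bump_tendsto tendsto_const)
      have "norm (bump a b m x * H x) \<le> norm (H x)" for m x
        using bump_nonneg[of a b m x] bump_le_1[of a b m x] by (simp add: abs_mult mult_left_le_one_le)
      then show "AE x in lebesgue. norm (bump a b (real (Suc n)) x * H x) \<le> norm (H x)" for n by simp
    qed
    moreover have "integral\<^sup>L lebesgue (\<lambda>x. bump a b (real (Suc n)) x * H x) = 0" for n
    proof -
      have "integral\<^sup>L lebesgue (\<lambda>x. bump a b (real (Suc n)) x * H x)
         = integral\<^sup>L lebesgue (\<lambda>x. if x \<in> U then bump a b (real (Suc n)) x * G x else 0)"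
        by (rule Bochner_Integration.integral_cong) (auto simp: H_def)
      also have "\<dots> = integral\<^sup>L (lebesgue_on U) (\<lambda>x. bump a b (real (Suc n)) x * G x)"
        by (rule Lebesgue_Measure.integral_restrict_UNIV[OF Ul])
      also have "\<dots> = 0" using ab by (intro test bump_test_function) auto
      finally show ?thesis .
    qed
    ultimately show ?thesis by (simp add: LIMSEQ_const_iff)
  qed
  have null: "negligible {x \<in> cbox c d. G x \<noteq> 0}" if cd: "cbox c d \<subseteq> U" for c d
  proof -
    define h where "h x = indicator (box c d) x * H x" for x
    have "AE x in lebesgue. h x = 0"
    proof (rule null_by_boxes)
      have "integrable lebesgue (\<lambda>x. indicator (box c d) x *\<^sub>R H x)"
        using H by (intro integrable_mult_indicator) (auto simp: sets_completionI_sets)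
      then show "integrable lebesgue h" by (simp add: h_def[abs_def])
      show "integral\<^sup>L lebesgue h = 0" unfolding h_def[abs_def] by (rule box0[OF cd])
      fix a b :: point
      obtain a' b' where e: "box a b \<inter> box c d = box a' b'" using box_Int_box by blast
      have "integral\<^sup>L lebesgue (\<lambda>x. indicator (box a b) x * h x) = integral\<^sup>L lebesgue (\<lambda>x. indicator (box a' b') x * H x)"
        unfolding e[symmetric] by (rule Bochner_Integration.integral_cong) (auto simp: h_def indicator_def)
      also have "\<dots> = 0"
      proof (cases "box a' b' = {}")
        case False
        then have "cbox a' b' = closure (box a' b')" by (simp add: closure_box)
        also have "\<dots> \<subseteq> closure (box c d)" unfolding e[symmetric] by (intro closure_mono) auto
        also have "\<dots> \<subseteq> cbox c d" by (intro closure_minimal box_subset_cbox closed_cbox)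
        finally show ?thesis using cd box0 by blast
      qed simp
      finally show "integral\<^sup>L lebesgue (\<lambda>x. indicator (box a b) x * h x) = 0" .
    qed
    then have "negligible {x. h x \<noteq> 0}" by (simp add: AE_lebesgue_iff)
    then have "negligible ({x. h x \<noteq> 0} \<union> (cbox c d - box c d))" using negligible_frontier_interval by (rule negligible_Un)
    then show ?thesis by (rule negligible_subset) (use cd in \<open>auto simp: h_def H_def indicator_def\<close>)
  qed
  obtain \<D> where D: "countable \<D>" "\<D> \<subseteq> Pow U" "\<And>X. X \<in> \<D> \<Longrightarrow> \<exists>a b. X = cbox a b" "\<Union>\<D> = U"
    using open_countable_Union_open_cbox[OF U] by metis
  have "negligible (\<Union>((\<lambda>X. {x \<in> X. G x \<noteq> 0}) ` \<D>))"
    using D null by (intro negligible_countable_Union) (auto, blast)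
  then have "negligible {x. x \<in> U \<and> \<not> G x = 0}" by (rule negligible_subset) (use D(4) in auto)
  then show ?thesis using AE_lebesgue_on_iff[OF Ul] by blast
qed

lemma L2_integrable:
  fixes f :: "point \<Rightarrow> 'a::euclidean_space"
  assumes "f \<in> L2 U" "U \<in> lmeasurable" shows "integrable (lebesgue_on U) f"
proof (rule Bochner_Integration.integrable_bound)
  interpret finite_measure "lebesgue_on U" using assms(2) by (rule finite_measure_lebesgue_on)
  show "integrable (lebesgue_on U) (\<lambda>x. 1 + (norm (f x))\<^sup>2)" using assms(1) by (auto simp: L2_def)
  show "f \<in> borel_measurable (lebesgue_on U)" using assms(1) by (simp add: L2_def)
  have "norm (f x) \<le> 1 + (norm (f x))\<^sup>2" for x
  proof -
    have "0 \<le> (norm (f x) - 1)\<^sup>2" by simp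
    then have "2 * norm (f x) \<le> 1 + (norm (f x))\<^sup>2" by (simp add: power2_eq_square algebra_simps)
    then show ?thesis using norm_ge_zero[of "f x"] by linarith
  qed
  then show "AE x in lebesgue_on U. norm (f x) \<le> norm (1 + (norm (f x))\<^sup>2)" by simp
qed

lemma test_times_integrable:
  fixes f :: "point \<Rightarrow> 'a::euclidean_space"
  assumes "\<phi> \<in> test_functions U" "integrable (lebesgue_on V) f" "V \<in> sets lebesgue"
  shows "integrable (lebesgue_on V) (\<lambda>x. \<phi> x *\<^sub>R f x)"
proof -
  obtain R where "\<And>x. x \<notin> cball 0 R \<Longrightarrow> \<phi> x = 0" using test_function_support[OF assms(1)] by metis
  then obtain M where M: "M \<ge> 0" "\<And>x. norm (\<phi> x) \<le> M"
    using bounded_by_compact_support[OF test_function_gderiv(3)[OF assms(1)]] by metis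
  show ?thesis
  proof (rule Bochner_Integration.integrable_bound)
    show "integrable (lebesgue_on V) (\<lambda>x. M *\<^sub>R f x)" using assms(2) by simp
    have "\<phi> \<in> borel_measurable (lebesgue_on V)"
      by (rule continuous_imp_measurable_on_sets_lebesgue) 
        (use test_function_gderiv(3)[OF assms(1)] continuous_on_subset assms(3) in auto)
    then show "(\<lambda>x. \<phi> x *\<^sub>R f x) \<in> borel_measurable (lebesgue_on V)"
      using assms(2) by (intro borel_measurable_scaleR) auto
    show "AE x in lebesgue_on V. norm (\<phi> x *\<^sub>R f x) \<le> norm (M *\<^sub>R f x)"
      using M by (auto intro!: AE_I2 mult_right_mono)
  qed
qed

lemma weak_grad_unique:
  assumes U: "open U" "bounded U" and G: "weak_grad U u G" "weak_grad U u G'"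
  shows "AE x in lebesgue_on U. G x = G' x"
proof -
  have Um: "U \<in> lmeasurable" using U by (simp add: lmeasurable_open)
  then have Ul: "U \<in> sets lebesgue" by (rule fmeasurableD)
  have int: "integrable (lebesgue_on U) G" "integrable (lebesgue_on U) G'"
    using G Um by (auto simp: weak_grad_def intro: L2_integrable)
  have "AE x in lebesgue_on U. (G x - G' x) \<bullet> axis i 1 = 0" for i
  proof (rule fundamental_lemma[OF U(1)])
    show "integrable (lebesgue_on U) (\<lambda>x. (G x - G' x) \<bullet> axis i 1)" using int by simp
    fix \<phi> assume \<phi>: "\<phi> \<in> test_functions U"
    have i2: "integrable (lebesgue_on U) (\<lambda>x. \<phi> x *\<^sub>R G x)" "integrable (lebesgue_on U) (\<lambda>x. \<phi> x *\<^sub>R G' x)"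
      using test_times_integrable[OF \<phi> _ Ul] int by auto
    have "integral\<^sup>L (lebesgue_on U) (\<lambda>x. \<phi> x *\<^sub>R G x) = integral\<^sup>L (lebesgue_on U) (\<lambda>x. \<phi> x *\<^sub>R G' x)"
    proof -
      have "integral\<^sup>L (lebesgue_on U) (\<lambda>x. u x *\<^sub>R grad \<phi> x) = - integral\<^sup>L (lebesgue_on U) (\<lambda>x. \<phi> x *\<^sub>R G x)"
        "integral\<^sup>L (lebesgue_on U) (\<lambda>x. u x *\<^sub>R grad \<phi> x) = - integral\<^sup>L (lebesgue_on U) (\<lambda>x. \<phi> x *\<^sub>R G' x)"
        using G \<phi> unfolding weak_grad_def by blast+
      then show ?thesis by simp
    qed
    then have "integral\<^sup>L (lebesgue_on U) (\<lambda>x. \<phi> x *\<^sub>R G x - \<phi> x *\<^sub>R G' x) \<bullet> axis i 1 = 0" using i2 by simp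
    then have "integral\<^sup>L (lebesgue_on U) (\<lambda>x. (\<phi> x *\<^sub>R G x - \<phi> x *\<^sub>R G' x) \<bullet> axis i 1) = 0" using i2 by simp
    then show "integral\<^sup>L (lebesgue_on U) (\<lambda>x. \<phi> x * ((G x - G' x) \<bullet> axis i 1)) = 0" 
      by (simp add: scaleR_diff_right[symmetric])
  qed
  then have "AE x in lebesgue_on U. \<forall>i\<in>UNIV. (G x - G' x) \<bullet> axis i 1 = 0"
    by (intro AE_finite_allI) auto
  then show ?thesis by eventually_elim (simp add: inner_axis vec_eq_iff)
qed

section \<open>Integration by parts for Lipschitz functions\<close>

lemma gderiv_directional_sequence:
  assumes "GDERIV f x :> D"
  shows "(\<lambda>n. (f (x + (1 / real (Suc n)) *\<^sub>R e) - f x) * real (Suc n)) \<longlonglongrightarrow> D \<bullet> e"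
proof -
  have d: "(f has_derivative (\<lambda>h. h \<bullet> D)) (at (x + 0 *\<^sub>R e))" using assms by (simp add: gderiv_def)
  have "((\<lambda>t::real. x + t *\<^sub>R e) has_derivative (\<lambda>t. t *\<^sub>R e)) (at 0)"
    by (auto intro!: derivative_eq_intros)
  have e: "(\<lambda>t. t * (D \<bullet> e)) = (*) (D \<bullet> e)" by (simp add: fun_eq_iff mult.commute)
  from has_derivative_compose[OF \<open>((\<lambda>t::real. x + t *\<^sub>R e) has_derivative (\<lambda>t. t *\<^sub>R e)) (at 0)\<close> d]
  have "((\<lambda>t. f (x + t *\<^sub>R e)) has_real_derivative (D \<bullet> e)) (at 0)"
    unfolding has_field_derivative_def by (simp add: e inner_commute[of e])
  then have "((\<lambda>t. (f (x + t *\<^sub>R e) - f x) / t) \<longlongrightarrow> D \<bullet> e) (at 0)" by (simp add: DERIV_def)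
  moreover have "filterlim (\<lambda>n. 1 / real (Suc n)) (at 0) sequentially"
    unfolding filterlim_at using LIMSEQ_inverse_real_of_nat by (auto simp: divide_inverse)
  ultimately have "((\<lambda>n. (f (x + (1 / real (Suc n)) *\<^sub>R e) - f x) / (1 / real (Suc n))) \<longlongrightarrow> D \<bullet> e) sequentially"
    by (rule filterlim_compose)
  then show ?thesis by simp
qed

lemma gderiv_norm_le_lipschitz:
  assumes "GDERIV f x :> D" "lipschitz_on K UNIV f" shows "norm D \<le> K"
proof (cases "D = 0")
  case True then show ?thesis using lipschitz_on_nonneg[OF assms(2)] by simp
next
  case False
  have "\<bar>(f (x + (1 / real (Suc n)) *\<^sub>R D) - f x) * real (Suc n)\<bar> \<le> K * norm D" for n
  proof -
    have "\<bar>f (x + (1 / real (Suc n)) *\<^sub>R D) - f x\<bar> \<le> K * ((1 / real (Suc n)) * norm D)"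
      using lipschitz_onD[OF assms(2), of "x + (1 / real (Suc n)) *\<^sub>R D" x] by (simp add: dist_norm)
    then have "\<bar>f (x + (1 / real (Suc n)) *\<^sub>R D) - f x\<bar> * real (Suc n) \<le> K * ((1 / real (Suc n)) * norm D) * real (Suc n)"
      by (rule mult_right_mono) simp
    then show ?thesis by (simp add: abs_mult)
  qed
  then have "\<bar>D \<bullet> D\<bar> \<le> K * norm D"
    using tendsto_rabs[OF gderiv_directional_sequence[OF assms(1), of D]]
    by (intro LIMSEQ_le_const2[of _ "\<bar>D \<bullet> D\<bar>"]) auto
  then have "norm D * norm D \<le> K * norm D" by (simp add: dot_square_norm power2_eq_square)
  then show ?thesis using False by simp
qed

lemma lborel_integral_shift:
  fixes f :: "point \<Rightarrow> real"
  assumes "f \<in> borel_measurable borel" shows "integral\<^sup>L lborel (\<lambda>x. f (c + x)) = integral\<^sup>L lborel f"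
  using integral_distr[of "(+) c" lborel borel f] assms by (simp add: lborel_distr_plus)

lemma lborel_integral_reflect:
  fixes f :: "point \<Rightarrow> real"
  assumes "f \<in> borel_measurable borel" shows "integral\<^sup>L lborel (\<lambda>y. f (x - y)) = integral\<^sup>L lborel f"
proof -
  have "lborel = density (distr lborel borel (\<lambda>y::point. x + (-1) *\<^sub>R y)) (\<lambda>_. 1)"
    using lborel_affine[of "-1" x] by simp
  then have "distr lborel borel (\<lambda>y::point. x - y) = lborel" by (simp add: density_1)
  then show ?thesis using integral_distr[of "\<lambda>y. x - y" lborel borel f] assms by simp
qed

lemma lborel_integrable_compact_support:
  fixes f :: "point \<Rightarrow> real"
  assumes "continuous_on UNIV f" "\<And>x. x \<notin> cball 0 R \<Longrightarrow> f x = 0" shows "integrable lborel f"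
proof -
  have "integrable lborel (\<lambda>x. indicator (cball 0 R) x *\<^sub>R f x)"
    using assms(1) by (intro borel_integrable_compact) (auto intro: continuous_on_subset)
  moreover have "(\<lambda>x. indicator (cball 0 R) x *\<^sub>R f x) = f" using assms(2) by (auto simp: indicator_def fun_eq_iff)
  ultimately show ?thesis by simp
qed

text \<open>The difference quotients in a fixed direction have integral zero by translation invariance,
  are dominated because of the Lipschitz condition, and converge to the directional derivative.\<close>

lemma integral_gradient_zero:
  fixes f :: "point \<Rightarrow> real" and g :: "point \<Rightarrow> point"
  assumes lip: "lipschitz_on K UNIV f" and supp: "\<And>x. x \<notin> cball 0 R \<Longrightarrow> f x = 0"
    and N: "negligible N" and der: "\<And>x. x \<notin> N \<Longrightarrow> GDERIV f x :> g x" and gm: "g \<in> borel_measurable lebesgue"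
    and int: "integrable lebesgue g"
  shows "integral\<^sup>L lebesgue g = 0"
proof -
  have cont: "continuous_on UNIV f" using lip by (rule lipschitz_on_continuous_on)
  then have fb: "f \<in> borel_measurable borel" by (rule borel_measurable_continuous_onI)
  have fi: "integrable lborel f" using lborel_integrable_compact_support[OF cont supp] .
  have "integral\<^sup>L lebesgue (\<lambda>x. g x \<bullet> e) = 0" for e
  proof -
    define q where "q n x = (f (x + (1 / real (Suc n)) *\<^sub>R e) - f x) * real (Suc n)" for n x
    have qc: "continuous_on UNIV (q n)" for n
      unfolding q_def using cont by (auto intro!: continuous_intros continuous_on_compose2[OF cont])
    have qb: "q n \<in> borel_measurable lborel" for n using borel_measurable_continuous_onI[OF qc] by simp
    have q0: "integral\<^sup>L lebesgue (q n) = 0" for n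
    proof -
      let ?c = "(1 / real (Suc n)) *\<^sub>R e"
      have i2: "integrable lborel (\<lambda>x. f (?c + x))"
        using integrable_distr_eq[of "(+) ?c" lborel borel f] fb fi by (simp add: lborel_distr_plus)
      have "q n = (\<lambda>x. (f (?c + x) - f x) * real (Suc n))" by (simp add: q_def fun_eq_iff add.commute)
      then have "integral\<^sup>L lborel (q n) = integral\<^sup>L lborel (\<lambda>x. f (?c + x) - f x) * real (Suc n)"
        by simp
      also have "integral\<^sup>L lborel (\<lambda>x. f (?c + x) - f x) = integral\<^sup>L lborel (\<lambda>x. f (?c + x)) - integral\<^sup>L lborel f"
        by (rule Bochner_Integration.integral_diff[OF i2 fi])
      finally have "integral\<^sup>L lborel (q n) = (integral\<^sup>L lborel (\<lambda>x. f (?c + x)) - integral\<^sup>L lborel f) * real (Suc n)" .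
      then show ?thesis using lborel_integral_shift[OF fb] integral_completion[OF qb[of n]] by simp
    qed
    have "(\<lambda>n. integral\<^sup>L lebesgue (q n)) \<longlonglongrightarrow> integral\<^sup>L lebesgue (\<lambda>x. g x \<bullet> e)"
    proof (rule integral_dominated_convergence[where w = "\<lambda>x. indicator (cball 0 (R + norm e)) x *\<^sub>R (K * norm e)"])
      show "(\<lambda>x. g x \<bullet> e) \<in> borel_measurable lebesgue" using gm by simp
      show "q n \<in> borel_measurable lebesgue" for n using qb by (rule measurable_completion)
      have "integrable lborel (\<lambda>x::point. indicator (cball 0 (R + norm e)) x *\<^sub>R (K * norm e))"
        by (intro borel_integrable_compact) auto
      then show "integrable lebesgue (\<lambda>x::point. indicator (cball 0 (R + norm e)) x *\<^sub>R (K * norm e))"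
        by (subst integrable_completion) auto
      have "(\<lambda>n. q n x) \<longlonglongrightarrow> g x \<bullet> e" if "x \<notin> N" for x
        unfolding q_def by (rule gderiv_directional_sequence[OF der[OF that]])
      then have "negligible {x. \<not> (\<lambda>n. q n x) \<longlonglongrightarrow> g x \<bullet> e}"
        by (intro negligible_subset[OF N]) blast
      then show "AE x in lebesgue. (\<lambda>n. q n x) \<longlonglongrightarrow> g x \<bullet> e" by (simp add: AE_lebesgue_iff)
      have "norm (q n x) \<le> indicator (cball 0 (R + norm e)) x *\<^sub>R (K * norm e)" for n x
      proof (cases "x \<in> cball 0 (R + norm e)")
        case True
        have "\<bar>f (x + (1 / real (Suc n)) *\<^sub>R e) - f x\<bar> \<le> K * ((1 / real (Suc n)) * norm e)"
          using lipschitz_onD[OF lip, of "x + (1 / real (Suc n)) *\<^sub>R e" x] by (simp add: dist_norm)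
        then have "\<bar>f (x + (1 / real (Suc n)) *\<^sub>R e) - f x\<bar> * real (Suc n) \<le> K * ((1 / real (Suc n)) * norm e) * real (Suc n)"
          by (rule mult_right_mono) simp
        then show ?thesis using True by (simp add: q_def abs_mult)
      next
        case False
        have "norm ((1 / real (Suc n)) *\<^sub>R e) \<le> norm e" 
          using mult_right_mono[of "1 / real (Suc n)" 1 "norm e"] by simp
        moreover have "norm x \<le> norm (x + (1 / real (Suc n)) *\<^sub>R e) + norm ((1 / real (Suc n)) *\<^sub>R e)"
          by (metis add_diff_cancel_right' norm_triangle_ineq4)
        ultimately have "R < norm (x + (1 / real (Suc n)) *\<^sub>R e)" using False by simp
        moreover have "R + norm e < norm x" using False by simp
        then have "R < norm x" using norm_ge_zero[of e] by linarith
        ultimately have "q n x = 0" using supp by (simp add: q_def)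
        then show ?thesis using False by simp
      qed
      then show "AE x in lebesgue. norm (q n x) \<le> indicator (cball 0 (R + norm e)) x *\<^sub>R (K * norm e)" for n by simp
    qed
    then show ?thesis using q0 by (simp add: LIMSEQ_const_iff)
  qed
  then have "integral\<^sup>L lebesgue g \<bullet> e = 0" for e using int by simp
  then show ?thesis by (metis inner_eq_zero_iff)
qed

lemma lipschitz_mult_compact_support:
  fixes u \<phi> :: "point \<Rightarrow> real"
  assumes u: "lipschitz_on K UNIV u" and \<phi>: "lipschitz_on L UNIV \<phi>" and supp: "\<And>x. x \<notin> cball 0 R \<Longrightarrow> \<phi> x = 0"
  obtains C where "lipschitz_on C UNIV (\<lambda>x. u x * \<phi> x)"
proof -
  have "bounded (u ` cball 0 R)" 
    using lipschitz_on_continuous_on[OF u] by (intro compact_imp_bounded compact_continuous_image) (auto intro: continuous_on_subset)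
  then obtain M where M: "M > 0" "\<And>x. x \<in> cball 0 R \<Longrightarrow> \<bar>u x\<bar> \<le> M" by (auto simp: bounded_pos)
  obtain P where P: "P \<ge> 0" "\<And>x. norm (\<phi> x) \<le> P"
    using bounded_by_compact_support[OF lipschitz_on_continuous_on[OF \<phi>] supp] by metis
  have K: "0 \<le> K" "0 \<le> L" using lipschitz_on_nonneg u \<phi> by auto
  have *: "\<bar>u x * \<phi> x - u y * \<phi> y\<bar> \<le> (M * L + K * P) * dist x y" if x: "x \<in> cball 0 R" for x y
  proof -
    have "u x * \<phi> x - u y * \<phi> y = u x * (\<phi> x - \<phi> y) + (u x - u y) * \<phi> y" by (simp add: algebra_simps)
    then have "\<bar>u x * \<phi> x - u y * \<phi> y\<bar> \<le> \<bar>u x\<bar> * \<bar>\<phi> x - \<phi> y\<bar> + \<bar>u x - u y\<bar> * \<bar>\<phi> y\<bar>"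
      by (metis abs_mult abs_triangle_ineq)
    also have "\<dots> \<le> M * (L * dist x y) + (K * dist x y) * P"
      using lipschitz_onD[OF u, of x y] lipschitz_onD[OF \<phi>, of x y] M(2)[OF x] P(2)[of y] M(1) K
      by (intro add_mono mult_mono) (auto simp: dist_real_def)
    finally show ?thesis by (simp add: algebra_simps)
  qed
  have "lipschitz_on (M * L + K * P) UNIV (\<lambda>x. u x * \<phi> x)"
  proof (rule lipschitz_onI)
    show "0 \<le> M * L + K * P" using M P K by simp
    fix x y :: point
    consider "x \<in> cball 0 R" | "y \<in> cball 0 R" | "x \<notin> cball 0 R" "y \<notin> cball 0 R" by blast
    then show "dist (u x * \<phi> x) (u y * \<phi> y) \<le> (M * L + K * P) * dist x y"
    proof cases
      case 1 then show ?thesis using * by (simp add: dist_real_def)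
    next
      case 2 then show ?thesis using *[of y x] by (simp add: dist_real_def dist_commute abs_minus_commute)
    next
      case 3 then show ?thesis using supp \<open>0 \<le> M * L + K * P\<close> by simp
    qed
  qed
  then show ?thesis using that by blast
qed

lemma bounded_in_L2:
  fixes f :: "point \<Rightarrow> 'a::euclidean_space"
  assumes "U \<in> lmeasurable" "f \<in> borel_measurable (lebesgue_on U)" "\<And>x. x \<in> U \<Longrightarrow> norm (f x) \<le> M"
  shows "f \<in> L2 U"
proof -
  interpret finite_measure "lebesgue_on U" using assms(1) by (rule finite_measure_lebesgue_on)
  have "integrable (lebesgue_on U) (\<lambda>x. (norm (f x))\<^sup>2)"
  proof (rule integrable_const_bound[of _ "M\<^sup>2"])
    show "AE x in lebesgue_on U. norm ((norm (f x))\<^sup>2) \<le> M\<^sup>2"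
      using assms(3) by (intro AE_I2) (auto simp: intro: power_mono)
    show "(\<lambda>x. (norm (f x))\<^sup>2) \<in> borel_measurable (lebesgue_on U)" using assms(2) by simp
  qed
  then show ?thesis using assms(2) by (simp add: L2_def)
qed

text \<open>The product of \<open>u\<close> with a test function is Lipschitz continuous with compact support, and its gradient
  is given by the product rule almost everywhere; the integral of this gradient is zero.\<close>

lemma weak_gradI:
  assumes U: "open U" "bounded U" and u: "lipschitz_on K UNIV u" and N: "negligible N"
    and der: "\<And>x. x \<in> U \<Longrightarrow> x \<notin> N \<Longrightarrow> GDERIV u x :> G x"
    and Gm: "G \<in> borel_measurable lebesgue" and GM: "\<And>x. x \<in> U \<Longrightarrow> norm (G x) \<le> M"
  shows "weak_grad U u G"
proof -
  have Um: "U \<in> lmeasurable" using U by (simp add: lmeasurable_open)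
  then have Ul: "U \<in> sets lebesgue" by (rule fmeasurableD)
  have uc: "continuous_on UNIV u" using u by (rule lipschitz_on_continuous_on)
  have mono: "f \<in> borel_measurable (lebesgue_on U)" if "f \<in> borel_measurable lebesgue" for f :: "point \<Rightarrow> 'a::euclidean_space"
    using that by (rule measurable_restrict_space1)
  have um: "u \<in> borel_measurable lebesgue" using borel_measurable_continuous_onI[OF uc] by (intro measurable_completion) simp
  have "bounded (u ` closure U)" using uc U 
    by (intro compact_imp_bounded compact_continuous_image) (auto intro: continuous_on_subset)
  then obtain P where P: "\<And>x. x \<in> closure U \<Longrightarrow> norm (u x) \<le> P" by (auto simp: bounded_iff)
  have uL2: "u \<in> L2 U" using P closure_subset by (intro bounded_in_L2[OF Um mono[OF um], of P]) blast
  have GL2: "G \<in> L2 U" using GM by (intro bounded_in_L2[OF Um mono[OF Gm]])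
  have "(\<integral>x. u x *\<^sub>R grad \<phi> x \<partial>lebesgue_on U) = - (\<integral>x. \<phi> x *\<^sub>R G x \<partial>lebesgue_on U)"
    if \<phi>: "\<phi> \<in> test_functions U" for \<phi>
  proof -
    obtain R where R: "\<And>x. x \<notin> cball 0 R \<Longrightarrow> \<phi> x = 0 \<and> grad \<phi> x = 0" using test_function_support[OF \<phi>] by metis
    obtain L where L: "lipschitz_on L UNIV \<phi>" using test_function_lipschitz[OF \<phi>] by metis
    obtain C where C: "lipschitz_on C UNIV (\<lambda>x. u x * \<phi> x)" 
      using lipschitz_mult_compact_support[OF u L] R by blast
    define g where "g x = (if x \<in> U then u x *\<^sub>R grad \<phi> x + \<phi> x *\<^sub>R G x else 0)" for x
    have gm: "grad \<phi> \<in> borel_measurable lebesgue" 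
      using borel_measurable_continuous_onI[OF test_function_gderiv(2)[OF \<phi>]] by (intro measurable_completion) simp
    have "bounded (grad \<phi> ` closure U)" using test_function_gderiv(2)[OF \<phi>] U
      by (intro compact_imp_bounded compact_continuous_image) (auto intro: continuous_on_subset)
    then obtain Q where Q: "\<And>x. x \<in> closure U \<Longrightarrow> norm (grad \<phi> x) \<le> Q" by (auto simp: bounded_iff)
    have gL2: "(\<lambda>x. u x *\<^sub>R grad \<phi> x) \<in> L2 U"
    proof (rule bounded_in_L2[OF Um, where M = "P * Q"])
      show "(\<lambda>x. u x *\<^sub>R grad \<phi> x) \<in> borel_measurable (lebesgue_on U)" using um gm by (intro mono borel_measurable_scaleR)
      show "norm (u x *\<^sub>R grad \<phi> x) \<le> P * Q" if "x \<in> U" for x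
      proof -
        have x: "x \<in> closure U" using that closure_subset by blast
        then have "0 \<le> P" using P order_trans[OF norm_ge_zero] by blast
        then show ?thesis using P[OF x] Q[OF x] by (auto intro: mult_mono)
      qed
    qed
    have i1: "integrable (lebesgue_on U) (\<lambda>x. u x *\<^sub>R grad \<phi> x)" using L2_integrable[OF gL2 Um] .
    have i2: "integrable (lebesgue_on U) (\<lambda>x. \<phi> x *\<^sub>R G x)" 
      using test_times_integrable[OF \<phi> L2_integrable[OF GL2 Um] Ul] .
    have gi: "integrable lebesgue g" unfolding g_def using i1 i2 
      by (subst Lebesgue_Measure.integrable_restrict_UNIV[OF Ul]) auto
    have "integral\<^sup>L lebesgue g = 0"
    proof (rule integral_gradient_zero[OF C _ N])
      show "u x * \<phi> x = 0" if "x \<notin> cball 0 R" for x using R[OF that] by simp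
      show "g \<in> borel_measurable lebesgue" using gi by (rule borel_measurable_integrable)
      show "integrable lebesgue g" by (rule gi)
      show "GDERIV (\<lambda>x. u x * \<phi> x) x :> g x" if x: "x \<notin> N" for x
      proof (cases "x \<in> U")
        case True
        from GDERIV_mult[OF der[OF True x] test_function_gderiv(1)[OF \<phi>]] True show ?thesis
          by (simp add: g_def)
      next
        case False
        define S where "S = closure {x. \<phi> x \<noteq> 0}"
        have "S \<subseteq> U" using \<phi> by (simp add: test_functions_def S_def)
        then have o: "open (- S)" "x \<in> - S" using False by (auto simp: S_def)
        have z: "\<phi> y = 0" if "y \<in> - S" for y using test_function_zero(1)[OF \<phi>, of y] that by (simp add: S_def)
        have "((\<lambda>y. 0) has_derivative (\<lambda>h. 0)) (at x)" by simp
        then have "((\<lambda>x. u x * \<phi> x) has_derivative (\<lambda>h. 0)) (at x)"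
          by (rule has_derivative_transform_within_open[OF _ o]) (simp add: z)
        then show ?thesis using False by (simp add: g_def gderiv_def)
      qed
    qed
    moreover have "integral\<^sup>L lebesgue g = integral\<^sup>L (lebesgue_on U) (\<lambda>x. u x *\<^sub>R grad \<phi> x + \<phi> x *\<^sub>R G x)"
      unfolding g_def by (rule Lebesgue_Measure.integral_restrict_UNIV[OF Ul])
    ultimately have "(\<integral>x. u x *\<^sub>R grad \<phi> x \<partial>lebesgue_on U) + (\<integral>x. \<phi> x *\<^sub>R G x \<partial>lebesgue_on U) = 0"
      using i1 i2 by simp
    then show ?thesis by (simp add: add_eq_0_iff2)
  qed
  then show ?thesis using uL2 GL2 by (simp add: weak_grad_def)
qed

section \<open>Mollification\<close>

definition convolution :: "point \<Rightarrow> point \<Rightarrow> (point \<Rightarrow> real) \<Rightarrow> (point \<Rightarrow> real) \<Rightarrow> point \<Rightarrow> real" where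
  "convolution a b f \<psi> x = integral (cbox a b) (\<lambda>y. f y * \<psi> (x - y))"

text \<open>All derivatives fall on the second factor.\<close>

lemma C_k_convolution:
  assumes f: "continuous_on UNIV f" shows "C_k k \<psi> \<Longrightarrow> C_k k (convolution a b f \<psi>)"
proof (induction k arbitrary: \<psi>)
  case 0
  then have \<psi>: "continuous_on UNIV \<psi>" by simp
  have "continuous_on (UNIV \<times> cbox a b) (\<lambda>(x, y). f y * \<psi> (x - y))"
    unfolding split_def 
    by (intro continuous_intros continuous_on_compose2[OF f] continuous_on_compose2[OF \<psi>]) auto
  then show ?case unfolding convolution_def[abs_def] C_k.simps by (rule integral_continuous_on_param)
next
  case (Suc k)
  then obtain g where g: "\<And>x. GDERIV \<psi> x :> g x" "\<And>i. C_k k (\<lambda>x. g x $ i)" by auto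
  have \<psi>: "continuous_on UNIV \<psi>"
    using g(1) has_derivative_continuous unfolding gderiv_def by (metis continuous_at_imp_continuous_on)
  have gi: "continuous_on UNIV (\<lambda>x. g x $ i)" for i
  proof -
    have "C_k 0 (\<lambda>x. g x $ i)" using g(2)[of i] by (induction k) (auto dest: C_k_D simp del: C_k.simps)
    then show ?thesis by simp
  qed
  then have gc: "continuous_on UNIV g" using continuous_on_vec_lambda[of UNIV "\<lambda>i x. g x $ i"] by simp
  define F where "F x y = f y *\<^sub>R blinfun_inner_left (g (x - y))" for x y
  let ?D = "\<lambda>x. \<chi> i. convolution a b f (\<lambda>z. g z $ i) x"
  have "GDERIV (convolution a b f \<psi>) x :> ?D x" for x
  proof -
    have "(convolution a b f \<psi> has_derivative blinfun_apply (integral (cbox a b) (F x))) (at x within UNIV)"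
      unfolding convolution_def[abs_def]
    proof (rule leibniz_rule)
      fix x t
      have 1: "(\<psi> has_derivative (\<lambda>h. h \<bullet> g (x - t))) (at (x - t))" using g(1) by (simp add: gderiv_def)
      have 2: "((\<lambda>x. x - t) has_derivative (\<lambda>h. h)) (at x)" by (auto intro!: derivative_eq_intros)
      from has_derivative_mult_right[OF has_derivative_compose[OF 2 1], of "f t"]
      show "((\<lambda>x. f t * \<psi> (x - t)) has_derivative blinfun_apply (F x t)) (at x within UNIV)"
        by (simp add: F_def scaleR_blinfun.rep_eq)
      show "(\<lambda>y. f y * \<psi> (x - y)) integrable_on cbox a b"
        by (intro integrable_continuous continuous_intros continuous_on_compose2[OF f] continuous_on_compose2[OF \<psi>]) auto
      show "continuous_on (UNIV \<times> cbox a b) (\<lambda>(x, t). F x t)"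
        unfolding split_def F_def 
        by (intro continuous_intros continuous_on_compose2[OF f] continuous_on_compose2[OF gc]
           bounded_linear.continuous_on[OF bounded_linear_blinfun_inner_left]) auto
    qed auto
    moreover have "blinfun_apply (integral (cbox a b) (F x)) h = h \<bullet> ?D x" for h
    proof -
      have "continuous_on (cbox a b) (F x)" unfolding F_def 
        by (intro continuous_intros continuous_on_compose2[OF f] continuous_on_compose2[OF gc]
           bounded_linear.continuous_on[OF bounded_linear_blinfun_inner_left]) auto
      then have "F x integrable_on cbox a b" by (rule integrable_continuous)
      then have "blinfun_apply (integral (cbox a b) (F x)) h = integral (cbox a b) (\<lambda>y. blinfun_apply (F x y) h)"
        by (simp add: blinfun_apply_integral)
      also have "\<dots> = integral (cbox a b) (\<lambda>y. (f y * g (x - y) $ 1) * h $ 1 + (f y * g (x - y) $ 2) * h $ 2)"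
        by (rule Henstock_Kurzweil_Integration.integral_cong) 
          (simp add: F_def scaleR_blinfun.rep_eq inner_vec_def sum_2 algebra_simps)
      also have "\<dots> = integral (cbox a b) (\<lambda>y. (f y * g (x - y) $ 1) * h $ 1) + integral (cbox a b) (\<lambda>y. (f y * g (x - y) $ 2) * h $ 2)"
        by (intro Henstock_Kurzweil_Integration.integral_add integrable_continuous continuous_intros 
            continuous_on_compose2[OF f] continuous_on_compose2[OF gi]) auto
      also have "\<dots> = h \<bullet> ?D x" by (simp add: convolution_def inner_vec_def sum_2 mult.commute)
      finally show ?thesis .
    qed
    then have "blinfun_apply (integral (cbox a b) (F x)) = (\<lambda>h. h \<bullet> ?D x)" by (rule ext)
    ultimately show ?thesis by (simp add: gderiv_def)
  qed
  moreover have "C_k k (\<lambda>x. ?D x $ i)" for i using Suc.IH[OF g(2)[of i]] by simp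
  ultimately show ?case unfolding C_k.simps by (intro exI[of _ ?D] conjI allI)
qed

text \<open>Values and differences of values of the mollification are averages of those of \<open>f\<close> at shifted
  arguments.  Comparing with an arbitrary number \<open>c\<close> yields closeness to \<open>f\<close>, the same Lipschitz
  constant, and, with \<open>\<epsilon> = 0\<close>, exact increments where \<open>f\<close> is affine.\<close>

lemma mollification:
  assumes f: "lipschitz_on K UNIV f" and supp: "\<And>x. x \<notin> cball 0 R \<Longrightarrow> f x = 0" and \<delta>: "\<delta> > 0"
  obtains \<phi> where "\<And>k. C_k k \<phi>" 
    "\<And>x c \<epsilon>. (\<And>y. norm y \<le> \<delta> \<Longrightarrow> \<bar>f (x - y) - c\<bar> \<le> \<epsilon>) \<Longrightarrow> \<bar>\<phi> x - c\<bar> \<le> \<epsilon>"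
    "\<And>x x' c \<epsilon>. (\<And>y. norm y \<le> \<delta> \<Longrightarrow> \<bar>f (x' - y) - f (x - y) - c\<bar> \<le> \<epsilon>) \<Longrightarrow> \<bar>\<phi> x' - \<phi> x - c\<bar> \<le> \<epsilon>"
proof -
  \<comment> \<open>The kernel lives on a square of side \<open>\<delta>\<close>, whose points have norm at most \<open>\<delta>\<close>.\<close>
  define l u :: point where "l = (\<chi> i. - (\<delta> / 2))" and "u = (\<chi> i. \<delta> / 2)"
  define \<beta> where "\<beta> = bump l u 1"
  have \<beta>c: "continuous_on UNIV \<beta>" unfolding \<beta>_def by (rule continuous_bump)
  have \<beta>0: "0 \<le> \<beta> y" for y unfolding \<beta>_def by (rule bump_nonneg)
  have \<beta>s: "\<beta> y = 0" if "\<not> norm y \<le> \<delta>" for y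
  proof -
    have "y \<notin> box l u"
    proof
      assume "y \<in> box l u"
      then have "\<bar>y $ 1\<bar> \<le> \<delta> / 2" "\<bar>y $ 2\<bar> \<le> \<delta> / 2" by (auto simp: mem_box_cart forall_2 l_def u_def abs_le_iff)
      moreover have "norm y \<le> \<bar>y $ 1\<bar> + \<bar>y $ 2\<bar>" using norm_le_l1_cart[of y] by (simp add: sum_2)
      ultimately show False using that by linarith
    qed
    then show ?thesis unfolding \<beta>_def by (simp add: bump_zero)
  qed
  have \<beta>i: "integrable lborel \<beta>" using \<beta>c by (rule lborel_integrable_compact_support[of _ \<delta>]) (use \<beta>s in auto)
  have \<beta>b: "\<beta> \<in> borel_measurable borel" using \<beta>c by (rule borel_measurable_continuous_onI)
  define m where "m = integral\<^sup>L lborel \<beta>"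
  have "m > 0"
  proof -
    have "m \<noteq> 0"
    proof
      assume "m = 0"
      then have "AE x in lborel. \<beta> x = 0" using integral_nonneg_eq_0_iff_AE[OF \<beta>i] \<beta>0 by (simp add: m_def)
      then have "AE x in lebesgue. \<beta> x = 0" by (rule AE_completion)
      then have "negligible {x. \<beta> x \<noteq> 0}" by (simp add: AE_lebesgue_iff)
      moreover have "box l u \<subseteq> {x. \<beta> x \<noteq> 0}" using bump_pos_iff[of 1 l u] unfolding \<beta>_def by force
      ultimately have "negligible (box l u)" using negligible_subset by blast
      moreover have "0 \<in> box l u" using \<delta> by (simp add: mem_box_cart l_def u_def)
      ultimately show False using open_not_negligible[OF open_box] by blast
    qed
    moreover have "0 \<le> m" unfolding m_def using \<beta>0 by simp
    ultimately show ?thesis by simp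
  qed
  define \<rho> where "\<rho> y = \<beta> y / m" for y
  have \<rho>0: "0 \<le> \<rho> y" for y using \<beta>0 \<open>m > 0\<close> by (simp add: \<rho>_def)
  have \<rho>s: "\<rho> y = 0" if "\<not> norm y \<le> \<delta>" for y using \<beta>s that by (simp add: \<rho>_def)
  have \<rho>c: "continuous_on UNIV \<rho>" unfolding \<rho>_def using \<beta>c \<open>m > 0\<close> by (intro continuous_intros) auto
  have \<rho>i: "integrable lborel \<rho>" unfolding \<rho>_def using \<beta>i by simp
  have \<rho>1: "integral\<^sup>L lborel \<rho> = 1" unfolding \<rho>_def using \<open>m > 0\<close> by (simp add: m_def[symmetric])
  have \<rho>k: "C_k k \<rho>" for k
  proof -
    have "C_k k (\<lambda>y. (1 / m) * \<beta> y)" unfolding \<beta>_def by (intro C_k_mult C_k_const C_k_bump)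
    then show ?thesis by (simp add: \<rho>_def[abs_def])
  qed
  have fc: "continuous_on UNIV f" using f by (rule lipschitz_on_continuous_on)
  define a b :: point where "a = (\<chi> i. - R)" and "b = (\<chi> i. R)"
  have R: "cball 0 R \<subseteq> cbox a b"
  proof
    fix x :: point assume "x \<in> cball 0 R"
    then have "norm x \<le> R" by simp
    then have "\<bar>x $ i\<bar> \<le> R" for i using component_le_norm_cart[of x i] by linarith
    then show "x \<in> cbox a b" unfolding mem_box_cart a_def b_def by (auto simp: abs_le_iff minus_le_iff)
  qed
  define \<phi> where "\<phi> = convolution a b f \<rho>"
  have cf: "continuous_on UNIV (\<lambda>y. f (x - y))" for x by (intro continuous_on_compose2[OF fc] continuous_intros) auto
  have ig: "integrable lborel (\<lambda>y. h y * \<rho> y)" if "continuous_on UNIV h" for h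
    by (rule lborel_integrable_compact_support[of _ \<delta>]) (use \<rho>s that \<rho>c in \<open>auto intro!: continuous_intros\<close>)
  have \<phi>: "\<phi> x = integral\<^sup>L lborel (\<lambda>y. f (x - y) * \<rho> y)" for x
  proof -
    have c: "continuous_on UNIV (\<lambda>y. f y * \<rho> (x - y))" 
      by (intro continuous_intros continuous_on_compose2[OF \<rho>c] fc) auto
    have i: "integrable lborel (\<lambda>y. f y * \<rho> (x - y))" 
      using c by (rule lborel_integrable_compact_support[of _ R]) (use supp in auto)
    have "\<phi> x = integral UNIV (\<lambda>y. if y \<in> cbox a b then f y * \<rho> (x - y) else 0)"
      unfolding \<phi>_def convolution_def by (rule Henstock_Kurzweil_Integration.integral_restrict_UNIV[symmetric])
    also have "(\<lambda>y. if y \<in> cbox a b then f y * \<rho> (x - y) else 0) = (\<lambda>y. f y * \<rho> (x - y))"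
    proof -
      have "f y = 0" if "y \<notin> cbox a b" for y using supp R that by blast
      then show ?thesis by (auto simp: fun_eq_iff)
    qed
    also have "integral UNIV (\<lambda>y. f y * \<rho> (x - y)) = integral\<^sup>L lborel (\<lambda>y. f y * \<rho> (x - y))"
      by (rule integral_lborel[OF i])
    also have "\<dots> = integral\<^sup>L lborel (\<lambda>y. f (x - y) * \<rho> y)"
      using lborel_integral_reflect[OF borel_measurable_continuous_onI[OF c], of x] by simp
    finally show ?thesis .
  qed
  have bound: "\<bar>integral\<^sup>L lborel (\<lambda>y. h y * \<rho> y)\<bar> \<le> \<epsilon>" 
    if h: "continuous_on UNIV h" and e: "\<And>y. norm y \<le> \<delta> \<Longrightarrow> \<bar>h y\<bar> \<le> \<epsilon>" for h \<epsilon>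
  proof -
    have "\<bar>integral\<^sup>L lborel (\<lambda>y. h y * \<rho> y)\<bar> \<le> integral\<^sup>L lborel (\<lambda>y. \<bar>h y * \<rho> y\<bar>)" by (rule integral_abs_bound)
    also have "\<dots> \<le> integral\<^sup>L lborel (\<lambda>y. \<epsilon> * \<rho> y)"
    proof (rule integral_mono)
      show "integrable lborel (\<lambda>y. \<bar>h y * \<rho> y\<bar>)" using ig[OF h] by simp
      show "integrable lborel (\<lambda>y. \<epsilon> * \<rho> y)" using \<rho>i by simp
      show "\<bar>h y * \<rho> y\<bar> \<le> \<epsilon> * \<rho> y" for y
        using e[of y] \<rho>0[of y] \<rho>s[of y] by (cases "norm y \<le> \<delta>") (auto simp: abs_mult intro: mult_right_mono)
    qed
    also have "\<dots> = \<epsilon>" using \<rho>1 by simp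
    finally show ?thesis .
  qed
  show ?thesis
  proof (rule that[of \<phi>])
    show "C_k k \<phi>" for k unfolding \<phi>_def by (rule C_k_convolution[OF fc \<rho>k])
    show "\<bar>\<phi> x - c\<bar> \<le> \<epsilon>" if e: "\<And>y. norm y \<le> \<delta> \<Longrightarrow> \<bar>f (x - y) - c\<bar> \<le> \<epsilon>" for x c \<epsilon>
    proof -
      have "integral\<^sup>L lborel (\<lambda>y. (f (x - y) - c) * \<rho> y) = \<phi> x - c"
        using ig[OF cf[of x]] \<rho>i \<rho>1 by (simp add: left_diff_distrib \<phi>)
      moreover have "\<bar>integral\<^sup>L lborel (\<lambda>y. (f (x - y) - c) * \<rho> y)\<bar> \<le> \<epsilon>"
        using e by (intro bound) (auto intro!: continuous_intros cf)
      ultimately show ?thesis by simp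
    qed
    show "\<bar>\<phi> x' - \<phi> x - c\<bar> \<le> \<epsilon>" if e: "\<And>y. norm y \<le> \<delta> \<Longrightarrow> \<bar>f (x' - y) - f (x - y) - c\<bar> \<le> \<epsilon>" for x x' c \<epsilon>
    proof -
      have "integral\<^sup>L lborel (\<lambda>y. (f (x' - y) - f (x - y) - c) * \<rho> y) = \<phi> x' - \<phi> x - c"
        using ig[OF cf[of x]] ig[OF cf[of x']] \<rho>i \<rho>1 by (simp add: left_diff_distrib \<phi>)
      moreover have "\<bar>integral\<^sup>L lborel (\<lambda>y. (f (x' - y) - f (x - y) - c) * \<rho> y)\<bar> \<le> \<epsilon>"
        using e by (intro bound) (auto intro!: continuous_intros cf)
      ultimately show ?thesis by simp
    qed
  qed
qed

lemma L2_norm_tendsto_zero: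
  fixes f :: "nat \<Rightarrow> point \<Rightarrow> 'a::euclidean_space"
  assumes Um: "U \<in> lmeasurable" and N: "negligible N"
    and m: "\<And>n. f n \<in> borel_measurable (lebesgue_on U)" and b: "\<And>n x. x \<in> U \<Longrightarrow> norm (f n x) \<le> B"
    and l: "\<And>x. x \<in> U \<Longrightarrow> x \<notin> N \<Longrightarrow> (\<lambda>n. f n x) \<longlonglongrightarrow> 0"
  shows "(\<lambda>n. L2_norm U (f n)) \<longlonglongrightarrow> 0"
proof -
  interpret finite_measure "lebesgue_on U" using Um by (rule finite_measure_lebesgue_on)
  have "(\<lambda>n. integral\<^sup>L (lebesgue_on U) (\<lambda>x. (norm (f n x))\<^sup>2)) \<longlonglongrightarrow> integral\<^sup>L (lebesgue_on U) (\<lambda>x. 0::real)"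
  proof (rule integral_dominated_convergence[where w = "\<lambda>x. B\<^sup>2"])
    show "(\<lambda>x. (norm (f n x))\<^sup>2) \<in> borel_measurable (lebesgue_on U)" for n using m by simp
    have "negligible {x. x \<in> U \<and> \<not> (\<lambda>n. (norm (f n x))\<^sup>2) \<longlonglongrightarrow> 0}"
    proof (rule negligible_subset[OF N], rule subsetI, rule ccontr)
      fix x assume x: "x \<in> {x. x \<in> U \<and> \<not> (\<lambda>n. (norm (f n x))\<^sup>2) \<longlonglongrightarrow> 0}" "x \<notin> N"
      then have "(\<lambda>n. f n x) \<longlonglongrightarrow> 0" using l by blast
      then have "(\<lambda>n. (norm (f n x))\<^sup>2) \<longlonglongrightarrow> (norm (0::'a))\<^sup>2" by (intro tendsto_intros)
      then show False using x by simp
    qed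
    then show "AE x in lebesgue_on U. (\<lambda>n. (norm (f n x))\<^sup>2) \<longlonglongrightarrow> 0"
      using AE_lebesgue_on_iff[OF fmeasurableD[OF Um]] by blast
    show "AE x in lebesgue_on U. norm ((norm (f n x))\<^sup>2) \<le> B\<^sup>2" for n
      using b by (intro AE_I2) (auto intro!: power_mono)
  qed auto
  then have "(\<lambda>n. sqrt (integral\<^sup>L (lebesgue_on U) (\<lambda>x. (norm (f n x))\<^sup>2))) \<longlonglongrightarrow> sqrt 0"
    by (intro tendsto_real_sqrt) simp
  then show ?thesis by (simp add: L2_norm_def)
qed

lemma lipschitz_truncation:
  "\<bar>(s - max (- \<epsilon>) (min \<epsilon> s)) - (t - max (- \<epsilon>) (min \<epsilon> t))\<bar> \<le> \<bar>s - t\<bar>" if "0 \<le> \<epsilon>" for s t \<epsilon> :: real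
  using that by (auto simp: max_def min_def abs_if)

text \<open>Truncation at level \<open>\<epsilon>\<close> keeps the support at a distance of order \<open>\<epsilon>\<close> from the complement of \<open>U\<close>,
  so a mollification with a radius of that order yields test functions.  Where \<open>u\<close> is locally
  affine, their gradients eventually agree with that of \<open>u\<close>, except where \<open>u\<close> vanishes and its
  gradient does not.\<close>

lemma H10I:
  assumes U: "open U" "bounded U" and u: "lipschitz_on K UNIV u" and u0: "\<And>x. x \<notin> U \<Longrightarrow> u x = 0"
    and N: "negligible N" and Gm: "G \<in> borel_measurable lebesgue" and GM: "\<And>x. x \<in> U \<Longrightarrow> norm (G x) \<le> M"
    and nz: "\<And>x. x \<in> U \<Longrightarrow> x \<notin> N \<Longrightarrow> u x \<noteq> 0 \<or> G x = 0"
    and loc: "\<And>x. x \<in> U \<Longrightarrow> x \<notin> N \<Longrightarrow> \<exists>r>0. \<forall>y\<in>ball x r. u y = u x + G x \<bullet> (y - x)"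
  shows "u \<in> H10 U"
proof -
  have Um: "U \<in> lmeasurable" using U by (simp add: lmeasurable_open)
  have affine_gderiv: "GDERIV f x :> a" if "r > 0" "\<forall>y\<in>ball x r. f y = f x + a \<bullet> (y - x)" 
    for f :: "point \<Rightarrow> real" and x a :: point and r
  proof -
    have "((\<lambda>y. f x + a \<bullet> (y - x)) has_derivative (\<lambda>h. h \<bullet> a)) (at x)"
      by (auto intro!: derivative_eq_intros simp: inner_commute)
    then show ?thesis unfolding gderiv_def
    proof (rule has_derivative_transform_within_open[OF _ open_ball])
      show "x \<in> ball x r" using that(1) by simp
      show "f x + a \<bullet> (y - x) = f y" if "y \<in> ball x r" for y
        using bspec[OF \<open>\<forall>y\<in>ball x r. f y = f x + a \<bullet> (y - x)\<close> that] by (rule sym)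
    qed
  qed
  have wg: "weak_grad U u G"
    by (rule weak_gradI[OF U u N _ Gm GM]) (use loc affine_gderiv in blast)+
  have K: "0 \<le> K" using u by (rule lipschitz_on_nonneg)
  have ucont: "continuous_on UNIV u" using u by (rule lipschitz_on_continuous_on)
  obtain R where "\<forall>x\<in>U. norm x \<le> R" using U(2) by (auto simp: bounded_iff)
  then have R: "U \<subseteq> cball 0 R" by auto
  define \<epsilon> where "\<epsilon> n = 1 / real (Suc n)" for n
  \<comment> \<open>Within the radius \<open>\<delta> n\<close> the function \<open>u\<close> varies by at most \<open>\<epsilon> n / 2\<close>; adding 1 covers \<open>K = 0\<close>.\<close>
  define \<delta> where "\<delta> n = \<epsilon> n / (2 * (K + 1))" for n
  define t where "t n s = s - max (- \<epsilon> n) (min (\<epsilon> n) s)" for n and s :: real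
  have e: "0 < \<epsilon> n" for n by (simp add: \<epsilon>_def)
  have d: "0 < \<delta> n" "K * \<delta> n \<le> \<epsilon> n / 2" "\<delta> n \<le> \<epsilon> n" for n
    using e[of n] K by (auto simp: \<delta>_def field_simps)
  have e0: "\<epsilon> \<longlonglongrightarrow> 0" using LIMSEQ_inverse_real_of_nat by (simp add: \<epsilon>_def[abs_def] divide_inverse)
  have tu: "lipschitz_on K UNIV (\<lambda>x. t n (u x))" for n
  proof (rule lipschitz_onI[OF _ K])
    fix x y
    have "dist (t n (u x)) (t n (u y)) \<le> dist (u x) (u y)"
      unfolding t_def dist_real_def using e[of n] by (intro lipschitz_truncation) simp
    also have "\<dots> \<le> K * dist x y" using lipschitz_onD[OF u] by simp
    finally show "dist (t n (u x)) (t n (u y)) \<le> K * dist x y" .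
  qed
  have "\<exists>\<phi>. (\<forall>k. C_k k \<phi>) \<and> 
    (\<forall>x c \<epsilon>. (\<forall>y. norm y \<le> \<delta> n \<longrightarrow> \<bar>t n (u (x - y)) - c\<bar> \<le> \<epsilon>) \<longrightarrow> \<bar>\<phi> x - c\<bar> \<le> \<epsilon>) \<and>
    (\<forall>x x' c \<epsilon>. (\<forall>y. norm y \<le> \<delta> n \<longrightarrow> \<bar>t n (u (x' - y)) - t n (u (x - y)) - c\<bar> \<le> \<epsilon>) \<longrightarrow> \<bar>\<phi> x' - \<phi> x - c\<bar> \<le> \<epsilon>)" for n
  proof -
    have z: "t n (u x) = 0" if "x \<notin> cball 0 R" for x
    proof -
      have "u x = 0" using that R u0 by blast
      then show ?thesis using e[of n] by (simp add: t_def)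
    qed
    show ?thesis using mollification[OF tu[of n] z d(1)[of n]] by metis
  qed
  then obtain \<phi> where \<phi>: "\<And>n k. C_k k (\<phi> n)"
    "\<And>n x c \<epsilon>. (\<And>y. norm y \<le> \<delta> n \<Longrightarrow> \<bar>t n (u (x - y)) - c\<bar> \<le> \<epsilon>) \<Longrightarrow> \<bar>\<phi> n x - c\<bar> \<le> \<epsilon>"
    "\<And>n x x' c \<epsilon>. (\<And>y. norm y \<le> \<delta> n \<Longrightarrow> \<bar>t n (u (x' - y)) - t n (u (x - y)) - c\<bar> \<le> \<epsilon>) \<Longrightarrow> \<bar>\<phi> n x' - \<phi> n x - c\<bar> \<le> \<epsilon>"
    by metis
  have ud: "\<bar>u (x - y) - u x\<bar> \<le> \<epsilon> n / 2" if "norm y \<le> \<delta> n" for x y n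
  proof -
    have "\<bar>u (x - y) - u x\<bar> \<le> K * norm y" using lipschitz_onD[OF u, of "x - y" x] by (simp add: dist_norm)
    also have "\<dots> \<le> K * \<delta> n" using that K by (rule mult_left_mono)
    finally show ?thesis using d(2)[of n] by linarith
  qed
  have close: "\<bar>\<phi> n x - u x\<bar> \<le> 2 * \<epsilon> n" for n x
  proof (rule \<phi>(2))
    fix y :: point assume "norm y \<le> \<delta> n"
    then have "\<bar>u (x - y) - u x\<bar> \<le> \<epsilon> n / 2" by (rule ud)
    moreover have "\<bar>t n s - s\<bar> \<le> \<epsilon> n" for s using e[of n] by (auto simp: t_def)
    from this[of "u (x - y)"] calculation
    show "\<bar>t n (u (x - y)) - u x\<bar> \<le> 2 * \<epsilon> n" using e[of n] by linarith
  qed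
  have lip: "lipschitz_on K UNIV (\<phi> n)" for n
  proof (rule lipschitz_onI[OF _ K])
    fix x' x
    have "\<bar>\<phi> n x' - \<phi> n x - 0\<bar> \<le> K * dist x' x"
    proof (rule \<phi>(3))
      fix y :: point
      show "\<bar>t n (u (x' - y)) - t n (u (x - y)) - 0\<bar> \<le> K * dist x' x"
        using lipschitz_onD[OF tu, of "x' - y" "x - y" n] by (simp add: dist_norm)
    qed
    then show "dist (\<phi> n x') (\<phi> n x) \<le> K * dist x' x" by (simp add: dist_real_def)
  qed
  have test: "\<phi> n \<in> test_functions U" for n
  proof -
    define F where "F = {x. \<epsilon> n / 2 \<le> \<bar>u x\<bar>}"
    have "closed F" unfolding F_def using ucont by (intro closed_Collect_le continuous_intros)
    have FU: "F \<subseteq> U"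
    proof
      fix x assume "x \<in> F"
      then have "u x \<noteq> 0" using e[of n] by (auto simp: F_def)
      then show "x \<in> U" using u0 by blast
    qed
    have "\<phi> n x = 0" if "x \<notin> F" for x
    proof -
      have "\<bar>\<phi> n x - 0\<bar> \<le> 0"
      proof (rule \<phi>(2))
        fix y :: point assume "norm y \<le> \<delta> n"
        then have "\<bar>u (x - y) - u x\<bar> \<le> \<epsilon> n / 2" by (rule ud)
        then have "\<bar>u (x - y)\<bar> \<le> \<epsilon> n" using that unfolding F_def by (simp add: abs_if split: if_splits)
        then show "\<bar>t n (u (x - y)) - 0\<bar> \<le> 0" by (auto simp: t_def)
      qed
      then show ?thesis by simp
    qed
    then have "closure {x. \<phi> n x \<noteq> 0} \<subseteq> F" using \<open>closed F\<close> by (intro closure_minimal) auto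
    moreover from this have "compact (closure {x. \<phi> n x \<noteq> 0})"
      using FU U(2) bounded_subset compact_eq_bounded_closed closed_closure by metis
    ultimately show ?thesis using FU \<phi>(1) by (auto simp: test_functions_def)
  qed
  have cm: "f \<in> borel_measurable (lebesgue_on U)" if "continuous_on UNIV f" for f :: "point \<Rightarrow> 'z::euclidean_space"
    by (rule continuous_imp_measurable_on_sets_lebesgue) (use that continuous_on_subset fmeasurableD[OF Um] in auto)
  have Gm': "G \<in> borel_measurable (lebesgue_on U)" using Gm by (rule measurable_restrict_space1)
  have 1: "(\<lambda>n. L2_norm U (\<lambda>x. \<phi> n x - u x)) \<longlonglongrightarrow> 0"
  proof (rule L2_norm_tendsto_zero[OF Um N, where B = 2])
    show "(\<lambda>x. \<phi> n x - u x) \<in> borel_measurable (lebesgue_on U)" for n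
      using lipschitz_on_continuous_on[OF lip] ucont by (intro cm continuous_intros)
    have "\<epsilon> n \<le> 1" for n by (simp add: \<epsilon>_def)
    then show "norm (\<phi> n x - u x) \<le> 2" for n x using close[of n x] order_trans[of _ "2 * \<epsilon> n" 2] by fastforce
    show "(\<lambda>n. \<phi> n x - u x) \<longlonglongrightarrow> 0" for x
    proof (rule Lim_null_comparison)
      show "\<forall>\<^sub>F n in sequentially. norm (\<phi> n x - u x) \<le> 2 * \<epsilon> n" using close by simp
      show "(\<lambda>n. 2 * \<epsilon> n) \<longlonglongrightarrow> 0" using tendsto_mult[OF tendsto_const e0, of 2] by simp
    qed
  qed
  have evg: "\<forall>\<^sub>F n in sequentially. grad (\<phi> n) x = G x" if x: "x \<in> U" "x \<notin> N" for x
  proof -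
    obtain r0 where r0: "r0 > 0" "\<forall>y\<in>ball x r0. u y = u x + G x \<bullet> (y - x)" using loc[OF x] by blast
    \<comment> \<open>If \<open>u x \<noteq> 0\<close>, the radius is reduced so that \<open>u\<close> keeps its sign and \<open>\<bar>u\<bar>\<close> exceeds
      the truncation level once that is below \<open>\<bar>u x\<bar> / 2\<close>.\<close>
    define r where "r = (if u x = 0 then r0 else min r0 (\<bar>u x\<bar> / (2 * (K + 1))))"
    have r: "r > 0" "r \<le> r0" using r0(1) K by (auto simp: r_def)
    have key: "t n (u z') - t n (u z) = G x \<bullet> (z' - z)" 
      if n: "u x \<noteq> 0 \<Longrightarrow> \<epsilon> n < \<bar>u x\<bar> / 2" and z: "z \<in> ball x r" "z' \<in> ball x r" for n z z'
    proof (cases "u x = 0")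
      case True
      then have "G x = 0" using nz[OF x] by blast
      moreover have "z \<in> ball x r0" "z' \<in> ball x r0" using r z by auto
      ultimately have "u z = 0" "u z' = 0" using bspec[OF r0(2), of z] bspec[OF r0(2), of z'] True by simp_all
      with \<open>G x = 0\<close> show ?thesis by simp
    next
      case False
      have near: "\<bar>u w - u x\<bar> < \<bar>u x\<bar> / 2" if "w \<in> ball x r" for w
      proof -
        have "\<bar>u w - u x\<bar> \<le> K * dist x w" using lipschitz_onD[OF u, of w x] by (simp add: dist_real_def dist_commute)
        also have "\<dots> \<le> K * r" using that K by (intro mult_left_mono) auto
        also have "\<dots> \<le> K * (\<bar>u x\<bar> / (2 * (K + 1)))" using K False by (intro mult_left_mono) (auto simp: r_def)
        also have "\<dots> < \<bar>u x\<bar> / 2" using K False by (simp add: field_simps)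
        finally show ?thesis .
      qed
      have "z \<in> ball x r0" "z' \<in> ball x r0" using r z by auto
      then have "u z = u x + G x \<bullet> (z - x)" "u z' = u x + G x \<bullet> (z' - x)" 
        using bspec[OF r0(2), of z] bspec[OF r0(2), of z'] by blast+
      then have "u z' - u z = G x \<bullet> (z' - z)" by (simp add: inner_diff_right)
      moreover have "t n (u z') - t n (u z) = u z' - u z"
      proof (cases "u x > 0")
        case True
        then have "u z > \<epsilon> n" "u z' > \<epsilon> n" using near[OF z(1)] near[OF z(2)] n[OF False] by linarith+
        then have "t n (u z) = u z - \<epsilon> n" "t n (u z') = u z' - \<epsilon> n" using e[of n] by (auto simp: t_def)
        then show ?thesis by simp
      next
        case False
        then have "u z < - \<epsilon> n" "u z' < - \<epsilon> n" 
          using near[OF z(1)] near[OF z(2)] n[OF \<open>u x \<noteq> 0\<close>] by linarith+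
        then have "t n (u z) = u z + \<epsilon> n" "t n (u z') = u z' + \<epsilon> n" using e[of n] by (auto simp: t_def)
        then show ?thesis by simp
      qed
      ultimately show ?thesis by simp
    qed
    have "\<forall>\<^sub>F n in sequentially. \<epsilon> n < r / 2 \<and> (u x \<noteq> 0 \<longrightarrow> \<epsilon> n < \<bar>u x\<bar> / 2)"
    proof (rule eventually_conj)
      show "\<forall>\<^sub>F n in sequentially. \<epsilon> n < r / 2" using order_tendstoD(2)[OF e0, of "r / 2"] r by simp
      show "\<forall>\<^sub>F n in sequentially. u x \<noteq> 0 \<longrightarrow> \<epsilon> n < \<bar>u x\<bar> / 2" 
        using order_tendstoD(2)[OF e0, of "\<bar>u x\<bar> / 2"] by (cases "u x = 0") auto
    qed
    then show ?thesis
    proof (rule eventually_mono)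
      fix n assume n: "\<epsilon> n < r / 2 \<and> (u x \<noteq> 0 \<longrightarrow> \<epsilon> n < \<bar>u x\<bar> / 2)"
      have "\<phi> n x' = \<phi> n x + G x \<bullet> (x' - x)" if x': "x' \<in> ball x (r / 2)" for x'
      proof -
        have "\<bar>\<phi> n x' - \<phi> n x - G x \<bullet> (x' - x)\<bar> \<le> 0"
        proof (rule \<phi>(3))
          fix y :: point assume y: "norm y \<le> \<delta> n"
          then have y2: "norm y < r / 2" using d(3)[of n] n by linarith
          have "dist x (x' - y) \<le> dist x x' + norm y"
            using norm_triangle_ineq[of "x - x'" y] by (simp add: dist_norm algebra_simps)
          then have "x' - y \<in> ball x r" using x' y2 by simp
          moreover have "norm y < r" using y2 norm_ge_zero[of y] r by linarith
          then have "x - y \<in> ball x r" by (simp add: dist_norm)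
          ultimately have "t n (u (x' - y)) - t n (u (x - y)) = G x \<bullet> ((x' - y) - (x - y))"
            using n by (intro key) auto
          then show "\<bar>t n (u (x' - y)) - t n (u (x - y)) - G x \<bullet> (x' - x)\<bar> \<le> 0" by simp
        qed
        then show ?thesis by simp
      qed
      then have "\<forall>y\<in>ball x (r / 2). \<phi> n y = \<phi> n x + G x \<bullet> (y - x)" by blast
      then have "GDERIV (\<phi> n) x :> G x" by (rule affine_gderiv[rotated]) (use r in simp)
      then have "(\<lambda>h. h \<bullet> G x) = (\<lambda>h. h \<bullet> grad (\<phi> n) x)"
        using test_function_gderiv(1)[OF test] unfolding gderiv_def by (rule has_derivative_unique)
      then show "grad (\<phi> n) x = G x" by (metis vector_eq_ldot)
    qed
  qed
  have 2: "(\<lambda>n. L2_norm U (\<lambda>x. grad (\<phi> n) x - G x)) \<longlonglongrightarrow> 0"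
  proof (rule L2_norm_tendsto_zero[OF Um N, where B = "K + M"])
    show "(\<lambda>x. grad (\<phi> n) x - G x) \<in> borel_measurable (lebesgue_on U)" for n
      using cm[OF test_function_gderiv(2)[OF test]] Gm' by (intro borel_measurable_diff)
    show "norm (grad (\<phi> n) x - G x) \<le> K + M" if "x \<in> U" for n x
      using norm_triangle_ineq4[of "grad (\<phi> n) x" "G x"] GM[OF that]
        gderiv_norm_le_lipschitz[OF test_function_gderiv(1)[OF test] lip, of n x] by linarith
    show "(\<lambda>n. grad (\<phi> n) x - G x) \<longlonglongrightarrow> 0" if "x \<in> U" "x \<notin> N" for x
      by (rule tendsto_eventually, rule eventually_mono[OF evg[OF that]]) simp
  qed
  show ?thesis unfolding H10_def using wg test 1 2 by blast
qed

section \<open>Piecewise affine functions on a triangulation\<close>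

lemma tri_lmeasurable: "nondegenerate T \<Longrightarrow> tri T \<in> lmeasurable"
  by (rule lmeasurable_compact[OF compact_tri])

lemma tri_sets: "nondegenerate T \<Longrightarrow> tri T \<in> sets lebesgue"
  by (rule fmeasurableD[OF tri_lmeasurable])

lemma AE_tri_iff_interior:
  assumes "nondegenerate T"
  shows "(AE x in lebesgue_on (tri T). P x) \<longleftrightarrow> (AE x in lebesgue_on (interior (tri T)). P x)"
proof -
  have i: "interior (tri T) \<in> sets lebesgue" by (simp add: borel_open sets_completionI_sets)
  have "negligible {x \<in> tri T. \<not> P x} \<longleftrightarrow> negligible {x \<in> interior (tri T). \<not> P x}"
  proof
    assume "negligible {x \<in> tri T. \<not> P x}"
    then show "negligible {x \<in> interior (tri T). \<not> P x}" 
      by (rule negligible_subset) (use interior_subset in blast)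
  next
    assume "negligible {x \<in> interior (tri T). \<not> P x}"
    then have "negligible ({x \<in> interior (tri T). \<not> P x} \<union> (tri T - interior (tri T)))"
      using negligible_tri_boundary by (rule negligible_Un)
    then show "negligible {x \<in> tri T. \<not> P x}" by (rule negligible_subset) blast
  qed
  then show ?thesis using AE_lebesgue_on_iff[OF i] AE_lebesgue_on_iff[OF tri_sets[OF assms]] by blast
qed

lemma continuous_AE_eq_on_tri:
  fixes f g :: "point \<Rightarrow> real"
  assumes nd: "nondegenerate T" and c: "continuous_on (tri T) f" "continuous_on (tri T) g"
    and ae: "AE x in lebesgue_on (tri T). f x = g x" and x: "x \<in> tri T"
  shows "f x = g x"
proof -
  let ?D = "{x \<in> interior (tri T). f x \<noteq> g x}"
  have c': "continuous_on (interior (tri T)) f" "continuous_on (interior (tri T)) g"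
    using c interior_subset continuous_on_subset by blast+
  have "?D = interior (tri T) \<inter> (\<lambda>x. f x - g x) -` (- {0})" by auto
  moreover have "open \<dots>" using c' by (intro continuous_open_preimage continuous_intros) auto
  ultimately have "open ?D" by simp
  moreover have "negligible ?D"
    using ae AE_lebesgue_on_iff[OF tri_sets[OF nd]] 
    by (intro negligible_subset[of "{x \<in> tri T. f x \<noteq> g x}" ?D]) (use interior_subset in \<open>auto\<close>)
  ultimately have "?D = {}" using open_not_negligible by blast
  then have sub: "interior (tri T) \<subseteq> {x \<in> tri T. f x - g x = 0}" using interior_subset by auto
  have "closed {x \<in> tri T. f x - g x = 0}"
    using c closed_tri[OF nd] by (intro continuous_closed_preimage_constant continuous_intros)
  with sub have "closure (interior (tri T)) \<subseteq> {x \<in> tri T. f x - g x = 0}" by (rule closure_minimal)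
  then show ?thesis using x closure_interior_tri[OF nd] by auto
qed

text \<open>A continuous representative is unique on the closed triangle, which is the closure of its interior.\<close>

lemma restr_eq:
  assumes "nondegenerate T" "AE x in lebesgue_on (tri T). u x = aff p x" "x \<in> tri T"
  shows "restr u T x = aff p x"
proof -
  have "continuous_on (tri T) (aff p) \<and> (AE x in lebesgue_on (tri T). u x = aff p x)"
    using assms(2) continuous_aff by blast
  then have "continuous_on (tri T) (restr u T) \<and> (AE x in lebesgue_on (tri T). u x = restr u T x)"
    unfolding restr_def by (rule someI[where P = "\<lambda>g. continuous_on (tri T) g \<and> (AE x in lebesgue_on (tri T). u x = g x)"])
  then have r: "continuous_on (tri T) (restr u T)" "AE x in lebesgue_on (tri T). u x = restr u T x" by auto
  have "AE x in lebesgue_on (tri T). restr u T x = aff p x" using r(2) assms(2) by eventually_elim simp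
  from continuous_AE_eq_on_tri[OF assms(1) r(1) continuous_aff this assms(3)] show ?thesis .
qed

definition coef :: "(point \<Rightarrow> real) \<Rightarrow> marked_triangle \<Rightarrow> point \<times> real" where
  "coef v T = (SOME p. AE x in lebesgue_on (tri T). v x = aff p x)"

lemma coef_AE: assumes "affine_on_triangle v T" shows "AE x in lebesgue_on (tri T). v x = aff (coef v T) x"
proof -
  obtain a b where "AE x in lebesgue_on (tri T). v x = a \<bullet> x + b" using assms by (auto simp: affine_on_triangle_def)
  then have "AE x in lebesgue_on (tri T). v x = aff (a, b) x" by (simp add: aff_def)
  then show ?thesis unfolding coef_def by (rule someI)
qed

lemma coef_cong:
  assumes "AE x in lebesgue_on (tri T). v x = v' x" shows "coef v T = coef v' T"
proof -
  have "(AE x in lebesgue_on (tri T). v x = aff p x) = (AE x in lebesgue_on (tri T). v' x = aff p x)" for p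
  proof
    assume "AE x in lebesgue_on (tri T). v x = aff p x"
    with assms show "AE x in lebesgue_on (tri T). v' x = aff p x" by eventually_elim simp
  next
    assume "AE x in lebesgue_on (tri T). v' x = aff p x"
    with assms show "AE x in lebesgue_on (tri T). v x = aff p x" by eventually_elim simp
  qed
  then show ?thesis unfolding coef_def by simp
qed

lemma weak_grad_cong_AE:
  assumes w: "weak_grad U u G" and ae: "AE x in lebesgue_on U. v x = u x" 
    and m: "v \<in> borel_measurable (lebesgue_on U)" and U: "U \<in> sets lebesgue"
  shows "weak_grad U v G"
proof -
  have u: "u \<in> borel_measurable (lebesgue_on U)" "integrable (lebesgue_on U) (\<lambda>x. (norm (u x))\<^sup>2)"
    using w by (auto simp: weak_grad_def L2_def)
  have "integrable (lebesgue_on U) (\<lambda>x. (norm (v x))\<^sup>2)"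
  proof (rule integrable_cong_AE_imp[OF u(2)])
    show "(\<lambda>x. (norm (v x))\<^sup>2) \<in> borel_measurable (lebesgue_on U)" using m by simp
    show "AE x in lebesgue_on U. (norm (u x))\<^sup>2 = (norm (v x))\<^sup>2" using ae by eventually_elim simp
  qed
  then have "v \<in> L2 U" using m by (simp add: L2_def)
  moreover have "(\<integral>x. v x *\<^sub>R grad \<phi> x \<partial>lebesgue_on U) = (\<integral>x. u x *\<^sub>R grad \<phi> x \<partial>lebesgue_on U)"
    if "\<phi> \<in> test_functions U" for \<phi>
  proof (rule integral_cong_AE)
    have g: "grad \<phi> \<in> borel_measurable (lebesgue_on U)"
      by (rule continuous_imp_measurable_on_sets_lebesgue) 
        (use test_function_gderiv(2)[OF that] continuous_on_subset U in auto)
    show "(\<lambda>x. v x *\<^sub>R grad \<phi> x) \<in> borel_measurable (lebesgue_on U)" using m g by (rule borel_measurable_scaleR)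
    show "(\<lambda>x. u x *\<^sub>R grad \<phi> x) \<in> borel_measurable (lebesgue_on U)" using u(1) g by (rule borel_measurable_scaleR)
    show "AE x in lebesgue_on U. v x *\<^sub>R grad \<phi> x = u x *\<^sub>R grad \<phi> x" using ae by eventually_elim simp
  qed
  ultimately show ?thesis using w by (simp add: weak_grad_def)
qed

lemma aff_lipschitz: "lipschitz_on (norm (fst p)) UNIV (aff p)"
proof (rule lipschitz_onI)
  fix x y
  have "dist (aff p x) (aff p y) = \<bar>fst p \<bullet> (x - y)\<bar>" by (simp add: dist_real_def aff_diff)
  also have "\<dots> \<le> norm (fst p) * dist x y" unfolding dist_norm by (rule Cauchy_Schwarz_ineq2)
  finally show "dist (aff p x) (aff p y) \<le> norm (fst p) * dist x y" .
qed simp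

lemma aff_gderiv: "GDERIV (aff p) x :> fst p"
  unfolding gderiv_def aff_def[abs_def] by (auto intro!: derivative_eq_intros simp: inner_commute)

context mesh begin

lemma domain_lmeasurable: "\<Omega> \<in> lmeasurable"
  using polygonal by (intro lmeasurable_open) (auto simp: polygonal_domain_def)

lemma domain_sets: "\<Omega> \<in> sets lebesgue" by (rule fmeasurableD[OF domain_lmeasurable])

lemma negligible_frontier_domain: "negligible (frontier \<Omega>)"
proof -
  obtain F :: "(point \<times> point) set" where F: "finite F" "frontier \<Omega> = (\<Union>(a, b)\<in>F. closed_segment a b)"
    using polygonal by (auto simp: polygonal_domain_def)
  have "negligible (closed_segment a b)" for a b :: point
    by (rule negligible_convex_interior[THEN iffD2]) (auto simp: interior_closed_segment_ge2)
  then show ?thesis unfolding F(2) using F(1) by (intro negligible_Union) auto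
qed

lemma interior_tri_subset: "T \<in> \<T> \<Longrightarrow> interior (tri T) \<subseteq> \<Omega>"
  using interior_subset_domain tri_subset_closure by blast

text \<open>The triangles cover the domain, and what they cover in addition lies on its boundary, a null set.\<close>

lemma AE_domain_iff:
  "(AE x in lebesgue_on \<Omega>. P x) \<longleftrightarrow> (\<forall>T\<in>\<T>. AE x in lebesgue_on (tri T). P x)"
proof -
  have "negligible {x \<in> \<Omega>. \<not> P x} \<longleftrightarrow> (\<forall>T\<in>\<T>. negligible {x \<in> tri T. \<not> P x})"
  proof
    assume l: "negligible {x \<in> \<Omega>. \<not> P x}"
    show "\<forall>T\<in>\<T>. negligible {x \<in> tri T. \<not> P x}"
    proof
      fix T assume "T \<in> \<T>"
      then have "{x \<in> tri T. \<not> P x} \<subseteq> {x \<in> \<Omega>. \<not> P x} \<union> frontier \<Omega>"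
        using tri_subset_closure frontier_eq by blast
      then show "negligible {x \<in> tri T. \<not> P x}" 
        using negligible_subset negligible_Un l negligible_frontier_domain by blast
    qed
  next
    assume r: "\<forall>T\<in>\<T>. negligible {x \<in> tri T. \<not> P x}"
    have "negligible (\<Union>T\<in>\<T>. {x \<in> tri T. \<not> P x})" using finite_mesh r by (intro negligible_Union) auto
    then show "negligible {x \<in> \<Omega>. \<not> P x}"
      by (rule negligible_subset) (use union_tri closure_subset in blast)
  qed
  then show ?thesis using AE_lebesgue_on_iff[OF domain_sets] AE_lebesgue_on_iff[OF tri_sets[OF nondeg]] by simp
qed

definition represents :: "(marked_triangle \<Rightarrow> point \<times> real) \<Rightarrow> (point \<Rightarrow> real) \<Rightarrow> bool" where
  "represents c v \<longleftrightarrow> (\<forall>T\<in>\<T>. AE x in lebesgue_on (tri T). v x = aff (c T) x)"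

text \<open>This equals \<open>f T\<close> inside each triangle \<open>T\<close> and zero on all sides; as a finite sum it inherits
  measurability from the pieces.\<close>

definition glue :: "(marked_triangle \<Rightarrow> point \<Rightarrow> 'a::real_vector) \<Rightarrow> point \<Rightarrow> 'a" where
  "glue f x = (\<Sum>T\<in>\<T>. indicator (interior (tri T)) x *\<^sub>R f T x)"

lemma glue_interior: assumes "T \<in> \<T>" "x \<in> interior (tri T)" shows "glue f x = f T x"
proof -
  have "glue f x = (\<Sum>T'\<in>\<T>. if T' = T then f T x else 0)"
    unfolding glue_def
  proof (rule sum.cong)
    fix T' assume T': "T' \<in> \<T>"
    have "x \<notin> interior (tri T')" if "T' \<noteq> T" 
      using interior_point_unique[OF assms(1) T' assms(2)] that interior_subset by blast
    then show "indicator (interior (tri T')) x *\<^sub>R f T' x = (if T' = T then f T x else 0)" using assms(2) by auto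
  qed simp
  then show ?thesis using assms(1) finite_mesh by simp
qed

lemma glue_measurable:
  fixes f :: "marked_triangle \<Rightarrow> point \<Rightarrow> 'a::euclidean_space"
  assumes "\<And>T. T \<in> \<T> \<Longrightarrow> f T \<in> borel_measurable borel" shows "glue f \<in> borel_measurable lebesgue"
proof -
  have "glue f \<in> borel_measurable lborel"
    unfolding glue_def[abs_def] using assms by (intro borel_measurable_sum borel_measurable_scaleR borel_measurable_indicator) auto
  then show ?thesis by (rule measurable_completion)
qed

lemma represents_glue: "represents c (glue (\<lambda>T. aff (c T)))"
  unfolding represents_def
proof
  fix T assume T: "T \<in> \<T>"
  have "AE x in lebesgue_on (interior (tri T)). glue (\<lambda>T. aff (c T)) x = aff (c T) x"
    using glue_interior[OF T] by (intro AE_I2) simp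
  then show "AE x in lebesgue_on (tri T). glue (\<lambda>T. aff (c T)) x = aff (c T) x"
    using AE_tri_iff_interior[OF nondeg[OF T]] by blast
qed

text \<open>The piecewise constant gradient satisfies the defining property, and every other function that does
  so agrees with it almost everywhere.\<close>

lemma nc_grad_AE:
  assumes v: "v \<in> borel_measurable (lebesgue_on \<Omega>)" "represents c v" and T: "T \<in> \<T>"
  shows "AE x in lebesgue_on (tri T). nc_grad \<T> v x = fst (c T)"
proof -
  define G where "G = glue (\<lambda>T x. fst (c T))"
  have Gm: "G \<in> borel_measurable lebesgue" unfolding G_def by (rule glue_measurable) simp
  have "weak_grad (interior (tri T)) v G" if T: "T \<in> \<T>" for T
  proof (rule weak_grad_cong_AE)
    show "interior (tri T) \<in> sets lebesgue" by (simp add: borel_open sets_completionI_sets)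
    show "AE x in lebesgue_on (interior (tri T)). v x = aff (c T) x"
      using v(2) T AE_tri_iff_interior[OF nondeg[OF T]] unfolding represents_def by blast
    show "v \<in> borel_measurable (lebesgue_on (interior (tri T)))"
      using v(1) interior_tri_subset[OF T] by (rule measurable_restrict_mono)
    show "weak_grad (interior (tri T)) (aff (c T)) G"
    proof (rule weak_gradI[OF open_interior _ aff_lipschitz negligible_empty _ Gm])
      show "bounded (interior (tri T))" 
        using compact_imp_bounded[OF compact_tri[OF nondeg[OF T]]] bounded_interior by blast
      show "GDERIV (aff (c T)) x :> G x" if "x \<in> interior (tri T)" for x
        unfolding G_def glue_interior[OF T that] by (rule aff_gderiv)
      show "norm (G x) \<le> norm (fst (c T))" if "x \<in> interior (tri T)" for x
        unfolding G_def glue_interior[OF T that] by simp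
    qed
  qed
  then have G: "\<forall>T\<in>\<T>. weak_grad (interior (tri T)) v G" by blast
  then have "\<forall>T\<in>\<T>. weak_grad (interior (tri T)) v (nc_grad \<T> v)" 
    unfolding nc_grad_def by (rule someI[where P = "\<lambda>G. \<forall>T\<in>\<T>. weak_grad (interior (tri T)) v G"])
  then have "AE x in lebesgue_on (interior (tri T)). nc_grad \<T> v x = G x"
    using G T bounded_interior[OF compact_imp_bounded[OF compact_tri[OF nondeg[OF T]]]]
    by (intro weak_grad_unique) auto
  moreover have "AE x in lebesgue_on (interior (tri T)). G x = fst (c T)"
    using glue_interior[OF T] by (intro AE_I2) (simp add: G_def)
  ultimately have "AE x in lebesgue_on (interior (tri T)). nc_grad \<T> v x = fst (c T)" by eventually_elim simp
  then show ?thesis using AE_tri_iff_interior[OF nondeg[OF T]] by blast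
qed

end

section \<open>Jumps across sides\<close>

definition side_mid :: "point set \<Rightarrow> point" where
  "side_mid S = midpoint (fst (side_ends S)) (snd (side_ends S))"

lemma side_ends:
  assumes "S \<in> tri_sides T" 
  shows "fst (side_ends S) \<noteq> snd (side_ends S)" "S = closed_segment (fst (side_ends S)) (snd (side_ends S))"
proof -
  obtain a b where "a \<noteq> b \<and> S = closed_segment a b" using assms by (auto simp: tri_sides_def)
  then have "case (a, b) of (a, b) \<Rightarrow> a \<noteq> b \<and> S = closed_segment a b" by simp
  then have "case side_ends S of (a, b) \<Rightarrow> a \<noteq> b \<and> S = closed_segment a b"
    unfolding side_ends_def by (rule someI)
  then show "fst (side_ends S) \<noteq> snd (side_ends S)" "S = closed_segment (fst (side_ends S)) (snd (side_ends S))"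
    by (auto simp: case_prod_unfold)
qed

lemma side_mid_eq:
  assumes "S \<in> tri_sides T" "S = closed_segment a b" shows "side_mid S = midpoint a b"
proof -
  have "{fst (side_ends S), snd (side_ends S)} = {a, b}" using side_ends(2)[OF assms(1)] assms(2) closed_segment_eq by metis
  then show ?thesis unfolding side_mid_def by (auto simp: doubleton_eq_iff midpoint_sym)
qed

lemma side_mid_in: "S \<in> tri_sides T \<Longrightarrow> side_mid S \<in> S"
  using side_ends(2) midpoint_in_closed_segment unfolding side_mid_def by metis

lemma side_length_pos: "S \<in> tri_sides T \<Longrightarrow> 0 < side_length S"
  using side_ends(1) by (simp add: side_length_def)

lemma side_parametrization:
  assumes "S \<in> tri_sides T" "0 \<le> s" "s \<le> side_length S"
  shows "fst (side_ends S) + s *\<^sub>R tangent S \<in> S"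
proof -
  let ?a = "fst (side_ends S)" and ?b = "snd (side_ends S)" and ?h = "side_length S"
  have h: "0 < ?h" using side_length_pos assms(1) by blast
  have "?a + s *\<^sub>R tangent S = (1 - s / ?h) *\<^sub>R ?a + (s / ?h) *\<^sub>R ?b"
    unfolding tangent_def by (simp add: algebra_simps divide_inverse)
  moreover have "0 \<le> s / ?h" "s / ?h \<le> 1" using assms h by auto
  ultimately have "?a + s *\<^sub>R tangent S \<in> closed_segment ?a ?b" unfolding closed_segment_def by blast
  then show ?thesis using side_ends(2)[OF assms(1)] by simp
qed

lemma integral_affine_interval:
  fixes h :: real assumes "0 \<le> h"
  shows "(\<integral>s. \<alpha> + \<beta> * s \<partial>lebesgue_on {0..h}) = \<alpha> * h + \<beta> * h\<^sup>2 / 2"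
proof -
  have c: "continuous_on {0..h} (\<lambda>s. \<alpha> + \<beta> * s)" by (intro continuous_intros)
  have "(\<integral>s. \<alpha> + \<beta> * s \<partial>lebesgue_on {0..h}) = integral {0..h} (\<lambda>s. \<alpha> + \<beta> * s)"
    using c by (intro lebesgue_integral_eq_integral continuous_imp_integrable_real) auto
  also have "((\<lambda>s. \<alpha> + \<beta> * s) has_integral ((\<alpha> * h + \<beta> * h\<^sup>2 / 2) - (\<alpha> * 0 + \<beta> * 0\<^sup>2 / 2))) {0..h}"
    using assms by (intro fundamental_theorem_of_calculus)
      (auto intro!: derivative_eq_intros simp: has_real_derivative_iff_has_vector_derivative[symmetric] )
  then have "integral {0..h} (\<lambda>s. \<alpha> + \<beta> * s) = \<alpha> * h + \<beta> * h\<^sup>2 / 2" by (simp add: integral_unique)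
  finally show ?thesis .
qed

lemma side_integral_cong:
  assumes "S \<in> tri_sides T" "\<And>x. x \<in> S \<Longrightarrow> f x = g x" shows "side_integral S f = side_integral S g"
  unfolding side_integral_def
  using assms side_parametrization[OF assms(1)] by (intro Bochner_Integration.integral_cong) auto

text \<open>The midpoint rule is exact for affine functions.\<close>

lemma side_integral_affine:
  assumes "S \<in> tri_sides T" "\<And>x. x \<in> S \<Longrightarrow> f x = aff p x"
  shows "side_integral S f = side_length S * aff p (side_mid S)"
proof -
  let ?a = "fst (side_ends S)" and ?b = "snd (side_ends S)" and ?h = "side_length S"
  have h: "0 < ?h" using side_length_pos assms(1) by blast
  have "side_integral S f = side_integral S (aff p)" using assms by (rule side_integral_cong)
  also have "\<dots> = (\<integral>s. aff p ?a + (fst p \<bullet> tangent S) * s \<partial>lebesgue_on {0..?h})"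
    unfolding side_integral_def by (simp add: aff_add mult.commute)
  also have "\<dots> = aff p ?a * ?h + (fst p \<bullet> tangent S) * ?h\<^sup>2 / 2" using h by (intro integral_affine_interval) simp
  also have "\<dots> = ?h * (aff p ?a + fst p \<bullet> (?h *\<^sub>R tangent S) / 2)" by (simp add: power2_eq_square algebra_simps)
  also have "?h *\<^sub>R tangent S = ?b - ?a" using h by (simp add: tangent_def)
  also have "aff p ?a + fst p \<bullet> (?b - ?a) / 2 = aff p (side_mid S)"
    unfolding side_mid_def aff_midpoint using aff_diff[of p ?b ?a] by simp
  finally show ?thesis .
qed

lemma L2_norm_side_const:
  assumes "S \<in> tri_sides T" "\<And>x. x \<in> S \<Longrightarrow> f x = \<kappa>"
  shows "(L2_norm_side S f)\<^sup>2 = side_length S * \<kappa>\<^sup>2"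
proof -
  have "side_integral S (\<lambda>x. (f x)\<^sup>2) = side_length S * aff (0, \<kappa>\<^sup>2) (side_mid S)"
    using assms by (intro side_integral_affine) (auto simp: aff_def)
  then show ?thesis using side_length_pos[OF assms(1)] by (simp add: L2_norm_side_def aff_def)
qed

lemma side_end_offset:
  assumes "S \<in> tri_sides T" "z = fst (side_ends S) \<or> z = snd (side_ends S)" "aff p (side_mid S) = 0"
  shows "(2 * aff p z)\<^sup>2 = (side_length S * (fst p \<bullet> tangent S))\<^sup>2"
proof -
  let ?a = "fst (side_ends S)" and ?b = "snd (side_ends S)" and ?h = "side_length S"
  have h: "0 < ?h" using side_length_pos assms(1) by blast
  have "?h *\<^sub>R tangent S = ?b - ?a" using h by (simp add: tangent_def)
  then have "?h * (fst p \<bullet> tangent S) = fst p \<bullet> (?b - ?a)" by (metis inner_scaleR_right)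
  then have e: "?h * (fst p \<bullet> tangent S) = aff p ?b - aff p ?a" using aff_diff[of p ?b ?a] by simp
  have "aff p ?a = - aff p ?b" using assms(3) unfolding side_mid_def aff_midpoint by simp
  then have "2 * aff p z = ?h * (fst p \<bullet> tangent S) \<or> 2 * aff p z = - (?h * (fst p \<bullet> tangent S))"
    using assms(2) e by auto
  then show ?thesis by (metis power2_minus)
qed

context mesh begin

lemma jump_boundary:
  assumes "represents c u" "T \<in> \<T>" "S \<in> tri_sides T" "S \<subseteq> frontier \<Omega>" "x \<in> S"
  shows "jump \<Omega> \<T> u S x = aff (c T) x"
proof -
  have "jump \<Omega> \<T> u S x = restr u T x" unfolding jump_def boundary_side_unique[OF assms(2-4)] using assms(4) by simp
  also have "x \<in> tri T" using side_subset_tri[OF assms(3)] assms(5) by blast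
  then have "restr u T x = aff (c T) x" 
    using assms(1,2) by (intro restr_eq nondeg) (auto simp: represents_def)
  finally show ?thesis .
qed

text \<open>At most two triangles contain a side, so the pair selected in the definition of the jump is the given
  pair in one of the two orders.\<close>

lemma jump_interior:
  assumes "represents c u" "T \<in> \<T>" "T' \<in> \<T>" "T \<noteq> T'" "S \<in> tri_sides T" "S \<in> tri_sides T'"
  obtains "\<And>x. x \<in> S \<Longrightarrow> jump \<Omega> \<T> u S x = aff (c T - c T') x"
    | "\<And>x. x \<in> S \<Longrightarrow> jump \<Omega> \<T> u S x = aff (c T' - c T) x"
proof -
  let ?P = "\<lambda>(T1, T2). T1 \<in> \<T> \<and> T2 \<in> \<T> \<and> T1 \<noteq> T2 \<and> S = tri T1 \<inter> tri T2"
  have nf: "\<not> S \<subseteq> frontier \<Omega>" using shared_side_not_boundary assms(2-6) by blast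
  obtain T1 T2 where some: "(SOME p. ?P p) = (T1, T2)" by (rule prod.exhaust)
  have "?P (T, T')" using neighbours_Int[OF assms(2-6)] assms(2-4) by simp
  then have "?P (SOME p. ?P p)" by (rule someI)
  then have P: "T1 \<in> \<T>" "T2 \<in> \<T>" "T1 \<noteq> T2" "S = tri T1 \<inter> tri T2" unfolding some by auto
  have S1: "S \<in> tri_sides T1" "S \<in> tri_sides T2"
    using side_of_neighbour[OF assms(5,2) P(1)] side_of_neighbour[OF assms(5,2) P(2)] P(4) by auto
  have r: "restr u T x = aff (c T) x" if "T \<in> \<T>" "S \<in> tri_sides T" "x \<in> S" for T x
  proof -
    have "x \<in> tri T" using side_subset_tri[OF that(2)] that(3) by blast
    then show ?thesis using that(1) assms(1) by (intro restr_eq nondeg) (auto simp: represents_def)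
  qed
  have j: "jump \<Omega> \<T> u S x = aff (c T1 - c T2) x" if "x \<in> S" for x
    unfolding jump_def some using nf r[OF P(1) S1(1) that] r[OF P(2) S1(2) that] by (simp add: aff_minus_coefs)
  have "(T1 = T \<and> T2 = T') \<or> (T1 = T' \<and> T2 = T)"
  proof (cases "T1 = T")
    case True
    then have "T2 = T'" using two_triangles_at_side[of T T2 T' S] P S1 assms by auto
    then show ?thesis using True by simp
  next
    case False
    then have "T1 = T'" using two_triangles_at_side[of T T1 T' S] P S1 assms by auto
    moreover from this have "T2 = T" using two_triangles_at_side[of T' T2 T S] P S1 assms by auto
    ultimately show ?thesis by simp
  qed
  then show ?thesis using that j by blast
qed

text \<open>By the midpoint rule, the conditions on the mean values of the jumps are conditions on the values at the
  midpoints of the sides.\<close>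

lemma CR10_mid_boundary:
  assumes "v \<in> CR10 \<Omega> (Mesh \<T>)" "represents c v" "T \<in> \<T>" "S \<in> tri_sides T" "S \<subseteq> frontier \<Omega>"
  shows "aff (c T) (side_mid S) = 0"
proof -
  have "side_integral S (jump \<Omega> \<T> v S) = 0" using assms(1,3,4) by auto
  moreover have "side_integral S (jump \<Omega> \<T> v S) = side_length S * aff (c T) (side_mid S)"
    by (rule side_integral_affine[OF assms(4)]) (rule jump_boundary[OF assms(2-5)])
  ultimately show ?thesis using side_length_pos[OF assms(4)] by simp
qed

lemma CR10_mid_interior:
  assumes "v \<in> CR10 \<Omega> (Mesh \<T>)" "represents c v" "T \<in> \<T>" "T' \<in> \<T>" "S \<in> tri_sides T" "S \<in> tri_sides T'"
  shows "aff (c T) (side_mid S) = aff (c T') (side_mid S)"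
proof (cases "T = T'")
  case False
  have 0: "side_integral S (jump \<Omega> \<T> v S) = 0" using assms(1,3,5) by auto
  from assms(2,3,4) False assms(5,6) show ?thesis
  proof (cases rule: jump_interior)
    case 1
    have "side_integral S (jump \<Omega> \<T> v S) = side_length S * aff (c T - c T') (side_mid S)"
      by (rule side_integral_affine[OF assms(5)]) (rule 1)
    then show ?thesis using side_length_pos[OF assms(5)] 0 by (simp add: aff_minus_coefs)
  next
    case 2
    have "side_integral S (jump \<Omega> \<T> v S) = side_length S * aff (c T' - c T) (side_mid S)"
      by (rule side_integral_affine[OF assms(5)]) (rule 2)
    then show ?thesis using side_length_pos[OF assms(5)] 0 by (simp add: aff_minus_coefs)
  qed
qed simp

lemma CR10_I:
  assumes "v \<in> L2 \<Omega>" "represents c v"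
    and b: "\<And>T S. T \<in> \<T> \<Longrightarrow> S \<in> tri_sides T \<Longrightarrow> S \<subseteq> frontier \<Omega> \<Longrightarrow> aff (c T) (side_mid S) = 0"
    and i: "\<And>T T' S. T \<in> \<T> \<Longrightarrow> T' \<in> \<T> \<Longrightarrow> T \<noteq> T' \<Longrightarrow> S \<in> tri_sides T \<Longrightarrow> S \<in> tri_sides T' \<Longrightarrow>
      aff (c T) (side_mid S) = aff (c T') (side_mid S)"
  shows "v \<in> CR10 \<Omega> (Mesh \<T>)"
proof -
  have "affine_on_triangle v T" if "T \<in> \<T>" for T
    unfolding affine_on_triangle_def
    by (rule exI[of _ "fst (c T)"], rule exI[of _ "snd (c T)"]) 
      (use assms(2) that in \<open>auto simp: represents_def aff_def\<close>)
  moreover have "side_integral S (jump \<Omega> \<T> v S) = 0" if S: "S \<in> sides (Mesh \<T>)" for S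
  proof -
    obtain T where T: "T \<in> \<T>" "S \<in> tri_sides T" using S by auto
    show ?thesis
    proof (cases "S \<subseteq> frontier \<Omega>")
      case True
      have "side_integral S (jump \<Omega> \<T> v S) = side_length S * aff (c T) (side_mid S)"
        by (rule side_integral_affine[OF T(2)]) (rule jump_boundary[OF assms(2) T True])
      then show ?thesis using b[OF T True] by simp
    next
      case False
      then obtain T' where T': "T' \<in> \<T>" "S \<in> tri_sides T'" "T' \<noteq> T" using interior_sideE[OF T] by metis
      note z = i[OF T(1) T'(1) T'(3)[symmetric] T(2) T'(2)]
      from assms(2) T(1) T'(1) T'(3)[symmetric] T(2) T'(2) show ?thesis
      proof (cases rule: jump_interior)
        case 1
        have "side_integral S (jump \<Omega> \<T> v S) = side_length S * aff (c T - c T') (side_mid S)"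
          by (rule side_integral_affine[OF T(2)]) (rule 1)
        then show ?thesis using z by (simp add: aff_minus_coefs)
      next
        case 2
        have "side_integral S (jump \<Omega> \<T> v S) = side_length S * aff (c T' - c T) (side_mid S)"
          by (rule side_integral_affine[OF T(2)]) (rule 2)
        then show ?thesis using z by (simp add: aff_minus_coefs)
      qed
    qed
  qed
  ultimately show ?thesis unfolding CR10.simps using assms(1) by blast
qed

lemma represents_coef: "v \<in> CR10 \<Omega> (Mesh \<T>) \<Longrightarrow> represents (coef v) v"
  using coef_AE by (auto simp: represents_def)

definition side_indicator :: "(point \<Rightarrow> real) \<Rightarrow> point set \<Rightarrow> real" where
  "side_indicator v S = side_length S * (L2_norm_side S (tangential_jump \<Omega> \<T> v S))\<^sup>2"

lemma side_indicator_nonneg: "0 \<le> side_indicator v S"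
  by (simp add: side_indicator_def side_length_def)

lemma represents_tangential:
  assumes "v \<in> CR10 \<Omega> (Mesh \<T>)" "represents c v"
  shows "represents (\<lambda>T. (0, fst (c T) \<bullet> t)) (\<lambda>x. nc_grad \<T> v x \<bullet> t)"
  unfolding represents_def
proof
  fix T assume T: "T \<in> \<T>"
  have "v \<in> borel_measurable (lebesgue_on \<Omega>)" using assms(1) by (simp add: L2_def)
  from nc_grad_AE[OF this assms(2) T]
  show "AE x in lebesgue_on (tri T). nc_grad \<T> v x \<bullet> t = aff (0, fst (c T) \<bullet> t) x"
    by eventually_elim (simp add: aff_def)
qed

lemma side_ends_vertices:
  assumes "T \<in> \<T>" "S \<in> tri_sides T" "z \<in> S" "z \<in> vertices T"
  shows "z = fst (side_ends S) \<or> z = snd (side_ends S)"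
proof -
  obtain a b where ab: "a \<in> vertices T" "b \<in> vertices T" "S = closed_segment a b" using assms(2) by (auto simp: tri_sides_def)
  have "z = a \<or> z = b" using vertex_on_side[OF nondeg[OF assms(1)] assms(4) _ ab(1,2)] assms(3) ab(3) by simp
  moreover have "{fst (side_ends S), snd (side_ends S)} = {a, b}" using side_ends(2)[OF assms(2)] ab(3) closed_segment_eq by metis
  ultimately show ?thesis by (auto simp: doubleton_eq_iff)
qed

text \<open>Along a side the jump is affine and vanishes at the midpoint, so its value at an endpoint is half
  the length of the side times the jump of the tangential derivative.\<close>

lemma vertex_jump_boundary:
  assumes v: "v \<in> CR10 \<Omega> (Mesh \<T>)" "represents c v" and T: "T \<in> \<T>" "S \<in> tri_sides T" "S \<subseteq> frontier \<Omega>"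
    and z: "z \<in> S" "z \<in> vertices T"
  shows "(aff (c T) z)\<^sup>2 \<le> side_indicator v S"
proof -
  have "(L2_norm_side S (tangential_jump \<Omega> \<T> v S))\<^sup>2 = side_length S * (fst (c T) \<bullet> tangent S)\<^sup>2"
    unfolding tangential_jump_def
    by (rule L2_norm_side_const[OF T(2)], subst jump_boundary[OF represents_tangential[OF v] T]) (auto simp: aff_def)
  then have "side_indicator v S = (side_length S * (fst (c T) \<bullet> tangent S))\<^sup>2"
    by (simp add: side_indicator_def power2_eq_square)
  also have "\<dots> = (2 * aff (c T) z)\<^sup>2"
    using side_end_offset[OF T(2) side_ends_vertices[OF T(1,2) z] CR10_mid_boundary[OF v T]] by simp
  also have "\<dots> \<ge> (aff (c T) z)\<^sup>2" by (simp add: power2_eq_square)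
  finally show ?thesis .
qed

lemma vertex_jump_interior:
  assumes v: "v \<in> CR10 \<Omega> (Mesh \<T>)" "represents c v" and T: "T \<in> \<T>" "T' \<in> \<T>" "S \<in> tri_sides T" "S \<in> tri_sides T'"
    and z: "z \<in> S" "z \<in> vertices T"
  shows "(aff (c T) z - aff (c T') z)\<^sup>2 \<le> side_indicator v S"
proof (cases "T = T'")
  case True then show ?thesis using side_indicator_nonneg by simp
next
  case False
  let ?\<kappa> = "fst (c T - c T') \<bullet> tangent S"
  have "(L2_norm_side S (tangential_jump \<Omega> \<T> v S))\<^sup>2 = side_length S * ?\<kappa>\<^sup>2"
    using represents_tangential[OF v, of "tangent S"] T(1,2) False T(3,4)
  proof (cases rule: jump_interior)
    case 1
    then have "tangential_jump \<Omega> \<T> v S x = ?\<kappa>" if "x \<in> S" for x 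
      using that by (simp add: tangential_jump_def aff_def inner_diff_left)
    then show ?thesis by (rule L2_norm_side_const[OF T(3)])
  next
    case 2
    then have "tangential_jump \<Omega> \<T> v S x = - ?\<kappa>" if "x \<in> S" for x 
      using that by (simp add: tangential_jump_def aff_def inner_diff_left)
    then have "(L2_norm_side S (tangential_jump \<Omega> \<T> v S))\<^sup>2 = side_length S * (- ?\<kappa>)\<^sup>2" by (rule L2_norm_side_const[OF T(3)])
    then show ?thesis by simp
  qed
  then have "side_indicator v S = (side_length S * ?\<kappa>)\<^sup>2"
    by (simp add: side_indicator_def power2_eq_square)
  also have "\<dots> = (2 * aff (c T - c T') z)\<^sup>2"
    using side_end_offset[OF T(3) side_ends_vertices[OF T(1,3) z], of "c T - c T'"] CR10_mid_interior[OF v T]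
    by (simp add: aff_minus_coefs)
  also have "\<dots> = 4 * (aff (c T) z - aff (c T') z)\<^sup>2" by (simp add: aff_minus_coefs power2_eq_square algebra_simps)
  also have "\<dots> \<ge> (aff (c T) z - aff (c T') z)\<^sup>2" by simp
  finally show ?thesis .
qed

end

section \<open>Nodal values from the patches of refined sides\<close>

lemma aff_eq_on_segment:
  assumes "aff p a = aff q a" "aff p b = aff q b" "x \<in> closed_segment a b" shows "aff p x = aff q x"
proof -
  obtain u where "x = (1 - u) *\<^sub>R a + u *\<^sub>R b" using assms(3) by (auto simp: closed_segment_def)
  then show ?thesis using assms(1,2) aff_convex[of "1 - u" u] by auto
qed

lemma aff_zero: "aff 0 x = 0"
  by (simp add: aff_def)

lemma bary_le_1: assumes "nondegenerate T" "x \<in> tri T" "z \<in> vertices T" shows "bc T z x \<le> 1"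
proof -
  have "bc T z x \<le> (\<Sum>w\<in>vertices T. bc T w x)"
    using tri_iff[OF assms(1)] assms by (intro member_le_sum) auto
  then show ?thesis using bary_sum[OF assms(1)] by simp
qed

text \<open>An affine function on a triangle takes its extreme values at the vertices.\<close>

lemma aff_bound_on_tri:
  assumes nd: "nondegenerate T" and b: "\<And>z. z \<in> vertices T \<Longrightarrow> \<bar>aff d z\<bar> \<le> e" and x: "x \<in> tri T"
  shows "\<bar>aff d x\<bar> \<le> e"
proof -
  have "\<bar>aff d x\<bar> \<le> (\<Sum>z\<in>vertices T. \<bar>aff d z * bc T z x\<bar>)"
    unfolding affine_interpolation[OF nd, of d x] by (rule sum_abs)
  also have "\<dots> \<le> (\<Sum>z\<in>vertices T. e * bc T z x)"
    using b tri_iff[OF nd] x by (intro sum_mono) (auto simp: abs_mult intro: mult_right_mono)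
  also have "\<dots> = e" by (simp add: sum_distrib_left[symmetric] bary_sum[OF nd])
  finally show ?thesis .
qed

lemma gradient_bound:
  assumes nd: "nondegenerate T" and sr: "shape_regular C T" and b: "\<And>z. z \<in> vertices T \<Longrightarrow> \<bar>m z\<bar> \<le> e"
  shows "(norm (fst (\<Sum>z\<in>vertices T. m z *\<^sub>R bary T z)))\<^sup>2 \<le> 9 * e\<^sup>2 * (C / (4 * area T))"
proof -
  define g where "g = sqrt (C / (4 * area T))"
  have V: "newest T \<in> vertices T" by (simp add: vertices_def)
  have g0: "0 \<le> C / (4 * area T)"
    using bary_gradient_bound[OF nd sr V] order_trans[OF zero_le_power2] by blast
  have g: "norm (fst (bary T z)) \<le> g" if "z \<in> vertices T" for z
    unfolding g_def using bary_gradient_bound[OF nd sr that] by (rule real_le_rsqrt)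
  have e: "0 \<le> e" using b[OF V] by linarith
  have "norm (fst (\<Sum>z\<in>vertices T. m z *\<^sub>R bary T z)) \<le> (\<Sum>z\<in>vertices T. norm (m z *\<^sub>R fst (bary T z)))"
    unfolding fst_sum fst_scaleR by (rule norm_sum)
  also have "\<dots> \<le> (\<Sum>z\<in>vertices T. e * g)"
    using b g e by (intro sum_mono) (auto intro!: mult_mono)
  also have "\<dots> = 3 * (e * g)" using card_vertices[OF nd] by simp
  finally have "(norm (fst (\<Sum>z\<in>vertices T. m z *\<^sub>R bary T z)))\<^sup>2 \<le> (3 * (e * g))\<^sup>2" by (intro power_mono) auto
  also have "\<dots> = 9 * e\<^sup>2 * (C / (4 * area T))" using g0 by (simp add: power_mult_distrib g_def)
  finally show ?thesis .
qed

lemma finite_tri_sides: "nondegenerate T \<Longrightarrow> finite (tri_sides T)"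
  by (rule finite_subset[of _ "opp_side T ` vertices T"]) (auto simp: tri_sides_opp_side)

context mesh begin

lemma finite_sides: "finite (sides (Mesh \<T>))"
  using finite_mesh finite_tri_sides[OF nondeg] by simp

definition touches_boundary :: "point set set \<Rightarrow> point \<Rightarrow> marked_triangle \<Rightarrow> bool" where
  "touches_boundary R z T \<longleftrightarrow> (\<exists>T' S. (T, T') \<in> (adjacent R z)\<^sup>* \<and> S \<in> R \<and> S \<in> tri_sides T' \<and> z \<in> S \<and> S \<subseteq> frontier \<Omega>)"

text \<open>Any triangle of the class can serve as its representative; the class, and hence the value, is the same
  for all triangles in it.\<close>

definition nodal_value :: "point set set \<Rightarrow> (marked_triangle \<Rightarrow> point \<times> real) \<Rightarrow> point \<Rightarrow> marked_triangle \<Rightarrow> real" where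
  "nodal_value R c z T = (if touches_boundary R z T then 0
     else aff (c (SOME T'. (T, T') \<in> (adjacent R z)\<^sup>*)) z)"

definition interpolant :: "point set set \<Rightarrow> (marked_triangle \<Rightarrow> point \<times> real) \<Rightarrow> marked_triangle \<Rightarrow> point \<times> real" where
  "interpolant R c T = (\<Sum>z\<in>vertices T. nodal_value R c z T *\<^sub>R bary T z)"

lemma nodal_value_cong:
  assumes "(T, T') \<in> (adjacent R z)\<^sup>*" shows "nodal_value R c z T = nodal_value R c z T'"
proof -
  have conv: "(T', T) \<in> (adjacent R z)\<^sup>*" using assms sym_rtrancl[OF sym_adjacent] by (meson symD)
  have *: "((T, T'') \<in> (adjacent R z)\<^sup>*) = ((T', T'') \<in> (adjacent R z)\<^sup>*)" for T''
  proof
    assume "(T, T'') \<in> (adjacent R z)\<^sup>*"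
    with conv show "(T', T'') \<in> (adjacent R z)\<^sup>*" by (rule rtrancl_trans)
  next
    assume "(T', T'') \<in> (adjacent R z)\<^sup>*"
    with assms show "(T, T'') \<in> (adjacent R z)\<^sup>*" by (rule rtrancl_trans)
  qed
  then have e: "(\<lambda>T''. (T, T'') \<in> (adjacent R z)\<^sup>*) = (\<lambda>T''. (T', T'') \<in> (adjacent R z)\<^sup>*)"
    by (rule ext)
  have "touches_boundary R z T = touches_boundary R z T'" unfolding touches_boundary_def using * by (simp only:)
  then show ?thesis unfolding nodal_value_def e by (simp only:)
qed

lemma interpolant_vertex:
  assumes "T \<in> \<T>" "w \<in> vertices T" shows "aff (interpolant R c T) w = nodal_value R c w T"
proof -
  note nd = nondeg[OF assms(1)]
  have "(\<Sum>z\<in>vertices T. nodal_value R c z T * bc T z w) = (\<Sum>z\<in>vertices T. if z = w then nodal_value R c w T else 0)"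
    by (rule sum.cong) (auto simp: bary_vertex[OF nd _ assms(2)])
  then show ?thesis using assms nd by (simp add: interpolant_def aff_sum_coefs)
qed

lemma interpolant_agree:
  assumes "S \<in> R" "T \<in> \<T>" "T' \<in> \<T>" "S \<in> tri_sides T" "S \<in> tri_sides T'" "x \<in> S"
  shows "aff (interpolant R c T) x = aff (interpolant R c T') x"
proof (cases "T = T'")
  case False
  obtain a b z z' where 1: "S = closed_segment a b" "vertices T = {z, a, b}" "vertices T' = {z', a, b}"
    using neighbour_vertices[OF assms(2,3) False assms(4,5)] by metis
  have "aff (interpolant R c T) w = aff (interpolant R c T') w" if w: "w = a \<or> w = b" for w
  proof -
    have wv: "w \<in> vertices T" "w \<in> vertices T'" "w \<in> S" using w 1 by auto
    then have "(T, T') \<in> adjacent R w" using assms by (auto simp: adjacent_def)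
    then show ?thesis using nodal_value_cong[of T T' R w c] interpolant_vertex assms(2,3) wv by auto
  qed
  then show ?thesis using aff_eq_on_segment assms(6) 1(1) by blast
qed simp

lemma interpolant_boundary:
  assumes "S \<in> R" "T \<in> \<T>" "S \<in> tri_sides T" "S \<subseteq> frontier \<Omega>" "x \<in> S"
  shows "aff (interpolant R c T) x = 0"
proof -
  obtain a b where ab: "a \<in> vertices T" "b \<in> vertices T" "S = closed_segment a b" using assms(3) by (auto simp: tri_sides_def)
  have "aff (interpolant R c T) w = 0" if w: "w = a \<or> w = b" for w
  proof -
    have "w \<in> vertices T" "w \<in> S" using w ab by auto
    moreover from this have "touches_boundary R w T" unfolding touches_boundary_def using assms by blast
    ultimately show ?thesis using interpolant_vertex[OF assms(2)] by (simp add: nodal_value_def)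
  qed
  then have "aff (interpolant R c T) a = aff 0 a" "aff (interpolant R c T) b = aff 0 b" 
    unfolding aff_zero by blast+
  then have "aff (interpolant R c T) x = aff 0 x"
    by (rule aff_eq_on_segment) (use assms(5) ab(3) in simp)
  then show ?thesis by (simp add: aff_zero)
qed

text \<open>Values of the pieces at a common vertex are compared along a chain of triangles that crosses
  sides of \<open>R\<close> only.  A shortest chain is no longer than the number of pairs of triangles at the
  vertex.\<close>

lemma nodal_error:
  assumes T: "T \<in> \<T>" "z \<in> vertices T" and A: "0 \<le> A"
    and i: "\<And>T T' S. T \<in> \<T> \<Longrightarrow> T' \<in> \<T> \<Longrightarrow> S \<in> R \<Longrightarrow> S \<in> tri_sides T \<Longrightarrow> S \<in> tri_sides T' \<Longrightarrow> z \<in> S \<Longrightarrow>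
      z \<in> vertices T \<Longrightarrow> \<bar>aff (c T) z - aff (c T') z\<bar> \<le> A"
    and b: "\<And>T S. T \<in> \<T> \<Longrightarrow> S \<in> R \<Longrightarrow> S \<in> tri_sides T \<Longrightarrow> S \<subseteq> frontier \<Omega> \<Longrightarrow> z \<in> S \<Longrightarrow>
      z \<in> vertices T \<Longrightarrow> \<bar>aff (c T) z\<bar> \<le> A"
  shows "\<bar>aff (c T) z - nodal_value R c z T\<bar> \<le> ((real (card {T\<in>\<T>. z \<in> vertices T}))\<^sup>2 + 1) * A"
proof -
  define X where "X = {T\<in>\<T>. z \<in> vertices T}"
  have finX: "finite X" using finite_mesh by (simp add: X_def)
  have sub: "adjacent R z \<subseteq> X \<times> X" by (auto simp: adjacent_def X_def)
  then have fin: "finite (adjacent R z)" using finX finite_subset by blast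
  have "card (adjacent R z) \<le> card (X \<times> X)" using sub finX by (intro card_mono) auto
  then have card: "card (adjacent R z) \<le> (card X)\<^sup>2" by (simp add: card_cartesian_product power2_eq_square)
  have pow: "\<bar>aff (c T1) z - aff (c T2) z\<bar> \<le> real k * A" if "(T1, T2) \<in> adjacent R z ^^ k" for k T1 T2
    using that
  proof (induction k arbitrary: T2)
    case 0 then show ?case by simp
  next
    case (Suc k)
    then obtain T3 where T3: "(T1, T3) \<in> adjacent R z ^^ k" "(T3, T2) \<in> adjacent R z" by auto
    have "\<bar>aff (c T3) z - aff (c T2) z\<bar> \<le> A" using T3(2) i unfolding adjacent_def by blast
    then show ?case using Suc.IH[OF T3(1)] by (simp add: algebra_simps)
  qed
  have star: "\<bar>aff (c T) z - aff (c T') z\<bar> \<le> (real (card X))\<^sup>2 * A" if "(T, T') \<in> (adjacent R z)\<^sup>*" for T'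
  proof -
    obtain k where k: "k \<le> card (adjacent R z)" "(T, T') \<in> adjacent R z ^^ k"
      using \<open>(T, T') \<in> (adjacent R z)\<^sup>*\<close> rtrancl_finite_eq_relpow[OF fin] by auto
    have "real k \<le> (real (card X))\<^sup>2" using k(1) card by (metis le_trans of_nat_le_iff of_nat_power)
    then have "real k * A \<le> (real (card X))\<^sup>2 * A" using A by (rule mult_right_mono)
    then show ?thesis using pow[OF k(2)] by linarith
  qed
  have "\<bar>aff (c T) z - nodal_value R c z T\<bar> \<le> (real (card X))\<^sup>2 * A + A"
  proof (cases "touches_boundary R z T")
    case True
    then obtain T' S where S: "(T, T') \<in> (adjacent R z)\<^sup>*" "S \<in> R" "S \<in> tri_sides T'" "z \<in> S" "S \<subseteq> frontier \<Omega>"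
      unfolding touches_boundary_def by blast
    have "T' \<in> \<T>" "z \<in> vertices T'" using adjacent_rtrancl_mesh[OF S(1) T] by auto
    then have "\<bar>aff (c T') z\<bar> \<le> A" using b S by blast
    then show ?thesis using star[OF S(1)] True by (simp add: nodal_value_def)
  next
    case False
    have "(T, SOME T'. (T, T') \<in> (adjacent R z)\<^sup>*) \<in> (adjacent R z)\<^sup>*" by (rule someI) (rule rtrancl.rtrancl_refl)
    then have "\<bar>aff (c T) z - nodal_value R c z T\<bar> \<le> (real (card X))\<^sup>2 * A" 
      using star False by (simp add: nodal_value_def)
    then show ?thesis using A by linarith
  qed
  then show ?thesis unfolding X_def by (simp add: algebra_simps)
qed

text \<open>The number \<open>pi * C\<close> bounds the number of triangles at a vertex and its square the length of a chain;
  the additional 1 accounts for the last step to a boundary side.\<close>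

definition local_error :: "real \<Rightarrow> point set set \<Rightarrow> (point \<Rightarrow> real) \<Rightarrow> marked_triangle \<Rightarrow> real" where
  "local_error C R v T = ((pi * C)\<^sup>2 + 1)\<^sup>2 * (\<Sum>z\<in>vertices T. \<Sum>S\<in>{S\<in>R. z \<in> S}. side_indicator v S)"

lemma local_error_nonneg: "0 \<le> local_error C R v T"
  unfolding local_error_def by (intro mult_nonneg_nonneg sum_nonneg side_indicator_nonneg) auto

lemma interpolant_error:
  assumes v: "v \<in> CR10 \<Omega> (Mesh \<T>)" "represents c v" and R: "R \<subseteq> sides (Mesh \<T>)"
    and sr: "\<forall>T\<in>\<T>. shape_regular C T" and T: "T \<in> \<T>" "z \<in> vertices T"
  shows "\<bar>aff (c T - interpolant R c T) z\<bar> \<le> sqrt (local_error C R v T)"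
proof -
  have finR: "finite R" using R finite_sides by (rule finite_subset)
  define s where "s = (\<Sum>S\<in>{S\<in>R. z \<in> S}. side_indicator v S)"
  have s0: "0 \<le> s" unfolding s_def by (intro sum_nonneg side_indicator_nonneg)
  have single: "side_indicator v S \<le> s" if "S \<in> R" "z \<in> S" for S
    unfolding s_def using that finR side_indicator_nonneg by (intro member_le_sum) auto
  define n where "n = real (card {T\<in>\<T>. z \<in> vertices T})"
  have n: "0 \<le> n" "n \<le> pi * C" using card_triangles_at_vertex[OF sr] by (auto simp: n_def)
  have "\<bar>aff (c T) z - nodal_value R c z T\<bar> \<le> (n\<^sup>2 + 1) * sqrt s"
    unfolding n_def
  proof (rule nodal_error[OF T])
    show "0 \<le> sqrt s" using s0 by simp
    fix T T' S assume *: "T \<in> \<T>" "T' \<in> \<T>" "S \<in> R" "S \<in> tri_sides T" "S \<in> tri_sides T'" "z \<in> S" "z \<in> vertices T"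
    have "\<bar>aff (c T) z - aff (c T') z\<bar>\<^sup>2 \<le> s"
      using vertex_jump_interior[OF v *(1,2,4,5,6,7)] single[OF *(3,6)] by simp
    then show "\<bar>aff (c T) z - aff (c T') z\<bar> \<le> sqrt s" by (rule real_le_rsqrt)
  next
    fix T S assume *: "T \<in> \<T>" "S \<in> R" "S \<in> tri_sides T" "S \<subseteq> frontier \<Omega>" "z \<in> S" "z \<in> vertices T"
    have "\<bar>aff (c T) z\<bar>\<^sup>2 \<le> s"
      using vertex_jump_boundary[OF v *(1,3,4,5,6)] single[OF *(2,5)] by simp
    then show "\<bar>aff (c T) z\<bar> \<le> sqrt s" by (rule real_le_rsqrt)
  qed
  also have "\<dots> \<le> ((pi * C)\<^sup>2 + 1) * sqrt s"
    using n s0 by (intro mult_right_mono add_mono power_mono) auto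
  also have "\<dots> = sqrt (((pi * C)\<^sup>2 + 1)\<^sup>2 * s)" by (simp add: real_sqrt_mult)
  also have "\<dots> \<le> sqrt (local_error C R v T)"
  proof -
    have "s \<le> (\<Sum>z\<in>vertices T. \<Sum>S\<in>{S\<in>R. z \<in> S}. side_indicator v S)"
      unfolding s_def using T nondeg side_indicator_nonneg
      by (intro member_le_sum[of z "vertices T" "\<lambda>z. \<Sum>S\<in>{S\<in>R. z \<in> S}. side_indicator v S"]) (auto intro!: sum_nonneg)
    then show ?thesis unfolding local_error_def by (intro real_sqrt_le_mono mult_left_mono) auto
  qed
  finally show ?thesis using interpolant_vertex[OF T] by (simp add: aff_minus_coefs)
qed

text \<open>A vertex that lies on a side is a vertex of each triangle with this side.  Hence a side is met by at
  most three vertices and contributes to a bounded number of local errors.\<close>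

lemma sum_local_error:
  assumes R: "R \<subseteq> sides (Mesh \<T>)" and sr: "\<forall>T\<in>\<T>. shape_regular C T"
  shows "(\<Sum>T\<in>\<T>. local_error C R v T) \<le> ((pi * C)\<^sup>2 + 1)\<^sup>2 * (3 * (pi * C)) * (\<Sum>S\<in>R. side_indicator v S)"
proof -
  have finR: "finite R" using R finite_sides by (rule finite_subset)
  have count: "(\<Sum>T\<in>\<T>. \<Sum>z\<in>vertices T. if z \<in> S then (1::real) else 0) \<le> 3 * (pi * C)" if S: "S \<in> R" for S
  proof -
    obtain T1 where T1: "T1 \<in> \<T>" "S \<in> tri_sides T1" using S R by auto
    have "(\<Sum>z\<in>vertices T. if z \<in> S then (1::real) else 0) \<le> (\<Sum>z\<in>vertices T1. if z \<in> vertices T then 1 else 0)" if T: "T \<in> \<T>" for T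
    proof -
      have "(\<Sum>z\<in>vertices T. if z \<in> S then (1::real) else 0) = real (card (vertices T \<inter> S))"
        using nondeg[OF T] by (simp add: sum.If_cases)
      also have "vertices T \<inter> S \<subseteq> vertices T1 \<inter> vertices T"
        using vertex_of_neighbour[OF T T1(1)] side_subset_tri[OF T1(2)] by blast
      then have "real (card (vertices T \<inter> S)) \<le> real (card (vertices T1 \<inter> vertices T))"
        using nondeg[OF T] by (intro of_nat_mono card_mono) auto
      also have "\<dots> = (\<Sum>z\<in>vertices T1. if z \<in> vertices T then 1 else 0)"
        using nondeg[OF T1(1)] by (simp add: sum.If_cases)
      finally show ?thesis .
    qed
    then have "(\<Sum>T\<in>\<T>. \<Sum>z\<in>vertices T. if z \<in> S then (1::real) else 0) 
      \<le> (\<Sum>T\<in>\<T>. \<Sum>z\<in>vertices T1. if z \<in> vertices T then 1 else 0)" by (rule sum_mono)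
    also have "\<dots> = (\<Sum>z\<in>vertices T1. \<Sum>T\<in>\<T>. if z \<in> vertices T then 1 else 0)" by (rule sum.swap)
    also have "\<dots> = (\<Sum>z\<in>vertices T1. real (card {T\<in>\<T>. z \<in> vertices T}))"
      using finite_mesh by (intro sum.cong) (auto simp: sum.If_cases Int_def)
    also have "\<dots> \<le> (\<Sum>z\<in>vertices T1. pi * C)" using card_triangles_at_vertex[OF sr] by (intro sum_mono)
    also have "\<dots> = 3 * (pi * C)" using card_vertices[OF nondeg[OF T1(1)]] by simp
    finally show ?thesis .
  qed
  have "(\<Sum>S\<in>{S\<in>R. z \<in> S}. side_indicator v S) = (\<Sum>S\<in>R. (if z \<in> S then 1 else 0) * side_indicator v S)" for z
    unfolding sum.inter_filter[OF finR] by (intro sum.cong) auto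
  then have "(\<Sum>T\<in>\<T>. \<Sum>z\<in>vertices T. \<Sum>S\<in>{S\<in>R. z \<in> S}. side_indicator v S)
     = (\<Sum>T\<in>\<T>. \<Sum>z\<in>vertices T. \<Sum>S\<in>R. (if z \<in> S then 1 else 0) * side_indicator v S)"
    by (simp only:)
  also have "\<dots> = (\<Sum>T\<in>\<T>. \<Sum>S\<in>R. \<Sum>z\<in>vertices T. (if z \<in> S then 1 else 0) * side_indicator v S)"
    by (intro sum.cong refl sum.swap)
  also have "\<dots> = (\<Sum>S\<in>R. \<Sum>T\<in>\<T>. \<Sum>z\<in>vertices T. (if z \<in> S then 1 else 0) * side_indicator v S)" by (rule sum.swap)
  also have "\<dots> = (\<Sum>S\<in>R. (\<Sum>T\<in>\<T>. \<Sum>z\<in>vertices T. (if z \<in> S then 1 else 0)) * side_indicator v S)"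
    by (simp add: sum_distrib_right)
  also have "\<dots> \<le> (\<Sum>S\<in>R. 3 * (pi * C) * side_indicator v S)"
    using count side_indicator_nonneg by (intro sum_mono mult_right_mono)
  finally have "(\<Sum>T\<in>\<T>. \<Sum>z\<in>vertices T. \<Sum>S\<in>{S\<in>R. z \<in> S}. side_indicator v S)
     \<le> 3 * (pi * C) * (\<Sum>S\<in>R. side_indicator v S)" by (simp add: sum_distrib_left)
  then have "((pi * C)\<^sup>2 + 1)\<^sup>2 * (\<Sum>T\<in>\<T>. \<Sum>z\<in>vertices T. \<Sum>S\<in>{S\<in>R. z \<in> S}. side_indicator v S)
     \<le> ((pi * C)\<^sup>2 + 1)\<^sup>2 * (3 * (pi * C) * (\<Sum>S\<in>R. side_indicator v S))" by (rule mult_left_mono) simp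
  then show ?thesis by (simp add: local_error_def sum_distrib_left mult.assoc)
qed

lemma glue_affine_L2: "glue (\<lambda>T. aff (c T)) \<in> L2 \<Omega>"
proof (rule bounded_in_L2[OF domain_lmeasurable])
  show "glue (\<lambda>T. aff (c T)) \<in> borel_measurable (lebesgue_on \<Omega>)"
    by (intro measurable_restrict_space1 glue_measurable borel_measurable_continuous_onI continuous_aff)
  fix x
  have "norm (indicator (interior (tri T)) x *\<^sub>R aff (c T) x) \<le> (\<Sum>z\<in>vertices T. \<bar>aff (c T) z\<bar>)" if T: "T \<in> \<T>" for T
  proof (cases "x \<in> interior (tri T)")
    case True
    have "\<bar>aff (c T) x\<bar> \<le> (\<Sum>z\<in>vertices T. \<bar>aff (c T) z\<bar>)"
    proof (rule aff_bound_on_tri[OF nondeg[OF T]])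
      show "x \<in> tri T" using True interior_subset by blast
      show "\<bar>aff (c T) z\<bar> \<le> (\<Sum>z\<in>vertices T. \<bar>aff (c T) z\<bar>)" if "z \<in> vertices T" for z
        using that nondeg[OF T] by (intro member_le_sum) auto
    qed
    then show ?thesis using True by simp
  qed (auto intro: sum_nonneg)
  then show "norm (glue (\<lambda>T. aff (c T)) x) \<le> (\<Sum>T\<in>\<T>. \<Sum>z\<in>vertices T. \<bar>aff (c T) z\<bar>)"
    unfolding glue_def by (intro order_trans[OF norm_sum] sum_mono)
qed

section \<open>The conforming companion\<close>

text \<open>When all sides are refined, a patch at a vertex either reaches the boundary or consists of all
  triangles at the vertex.  Hence the nodal values do not depend on the triangle.\<close>

lemma interpolant_continuous:
  assumes R: "R = sides (Mesh \<T>)" and T: "T \<in> \<T>" "T' \<in> \<T>" "x \<in> tri T" "x \<in> tri T'"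
  shows "aff (interpolant R c T) x = aff (interpolant R c T') x"
proof (cases "T = T'")
  case False
  from intersection_cases[OF T(1,2) False T(3,4)] show ?thesis
  proof cases
    case 1
    have *: "(T, T') \<in> (adjacent R x)\<^sup>*" if nb: "\<not> touches_boundary R x T" and T: "T \<in> \<T>" "T' \<in> \<T>" "x \<in> vertices T" "x \<in> tri T'" for T T'
    proof (rule star_without_boundary(2)[OF T(1,3) _ _ T(2,4)])
      show "S \<in> R" if "S \<in> sides (Mesh \<T>)" for S using that R by simp
      fix T1 S assume s: "(T, T1) \<in> (adjacent R x)\<^sup>*" "S \<in> tri_sides T1" "x \<in> S"
      then have "T1 \<in> \<T>" using adjacent_rtrancl_mesh T by blast
      then have "S \<in> R" using s(2) R by auto
      then show "\<not> S \<subseteq> frontier \<Omega>" using nb s unfolding touches_boundary_def by blast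
    qed
    have "nodal_value R c x T = nodal_value R c x T'"
    proof (cases "touches_boundary R x T \<and> touches_boundary R x T'")
      case True then show ?thesis by (simp add: nodal_value_def)
    next
      case False
      then have "(T, T') \<in> (adjacent R x)\<^sup>* \<or> (T', T) \<in> (adjacent R x)\<^sup>*" using * T 1 by blast
      then show ?thesis using nodal_value_cong by metis
    qed
    then show ?thesis using interpolant_vertex T 1 by simp
  next
    case 2
    then have "tri T \<inter> tri T' \<in> R" using R T by auto
    then show ?thesis using interpolant_agree[OF _ T(1,2) 2] T by simp
  qed
qed simp

text \<open>A patch at a boundary vertex reaches the boundary, since otherwise it would fill a neighbourhood of the
  vertex.\<close>

lemma interpolant_zero_boundary:
  assumes R: "R = sides (Mesh \<T>)" and T: "T \<in> \<T>" "x \<in> tri T" "x \<in> frontier \<Omega>"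
  shows "aff (interpolant R c T) x = 0"
proof (cases "x \<in> vertices T")
  case True
  have "touches_boundary R x T"
  proof (rule ccontr)
    assume nb: "\<not> touches_boundary R x T"
    have "x \<in> \<Omega>"
    proof (rule star_without_boundary(1)[OF T(1) True])
      show "S \<in> R" if "S \<in> sides (Mesh \<T>)" for S using that R by simp
      fix T1 S assume s: "(T, T1) \<in> (adjacent R x)\<^sup>*" "S \<in> tri_sides T1" "x \<in> S"
      then have "T1 \<in> \<T>" using adjacent_rtrancl_mesh T True by blast
      then have "S \<in> R" using s(2) R by auto
      then show "\<not> S \<subseteq> frontier \<Omega>" using nb s unfolding touches_boundary_def by blast
    qed
    then show False using T(3) frontier_eq by blast
  qed
  then show ?thesis using interpolant_vertex[OF T(1) True] by (simp add: nodal_value_def)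
next
  case False
  have "x \<notin> interior (tri T)" using interior_tri_subset[OF T(1)] T(3) frontier_eq by blast
  then obtain z where z: "z \<in> vertices T" "x \<in> opp_side T z" using boundary_point_on_side[OF nondeg[OF T(1)] T(2)] by metis
  then have S: "opp_side T z \<in> tri_sides T" using tri_sides_opp_side[OF nondeg[OF T(1)]] by blast
  have "opp_side T z \<subseteq> frontier \<Omega>"
  proof (rule ccontr)
    assume "\<not> opp_side T z \<subseteq> frontier \<Omega>"
    then obtain T' where "T' \<in> \<T>" "opp_side T z \<in> tri_sides T'" "T' \<noteq> T" using interior_sideE[OF T(1) S] by metis
    then have "x \<in> \<Omega>" using interior_side_not_in_frontier[OF T(1) _ _ S _ z(2) False] by metis
    then show False using T(3) frontier_eq by blast
  qed
  moreover have "opp_side T z \<in> R" using S R T(1) by auto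
  ultimately show ?thesis using interpolant_boundary T(1) S z(2) by blast
qed

definition companion :: "(marked_triangle \<Rightarrow> point \<times> real) \<Rightarrow> point \<Rightarrow> real" where
  "companion c x = (if x \<in> \<Omega> then aff (interpolant (sides (Mesh \<T>)) c (SOME T. T \<in> \<T> \<and> x \<in> tri T)) x else 0)"

lemma companion_eq:
  assumes "T \<in> \<T>" "x \<in> tri T" shows "companion c x = aff (interpolant (sides (Mesh \<T>)) c T) x"
proof (cases "x \<in> \<Omega>")
  case True
  have "T \<in> \<T> \<and> x \<in> tri T" using assms by simp
  then have "(SOME T. T \<in> \<T> \<and> x \<in> tri T) \<in> \<T> \<and> x \<in> tri (SOME T. T \<in> \<T> \<and> x \<in> tri T)" by (rule someI)
  then show ?thesis using True interpolant_continuous[OF refl _ assms(1) _ assms(2)] by (simp add: companion_def)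
next
  case False
  then have "x \<in> frontier \<Omega>" using tri_subset_closure assms frontier_eq by blast
  then show ?thesis using False interpolant_zero_boundary[OF refl assms] by (simp add: companion_def)
qed

text \<open>A segment is covered by the finitely many closed pieces on which the function is Lipschitz continuous,
  and a function of one real variable inherits the Lipschitz constant from such a cover.\<close>

lemma companion_lipschitz: obtains K where "lipschitz_on K UNIV (companion c)"
proof -
  let ?g = "\<lambda>T. interpolant (sides (Mesh \<T>)) c T"
  define K where "K = (\<Sum>T\<in>\<T>. norm (fst (?g T)))"
  have K0: "0 \<le> K" unfolding K_def by (intro sum_nonneg) auto
  define P where "P = insert (- \<Omega>) (tri ` \<T>)"
  have piece: "lipschitz_on K X (companion c)" if X: "X \<in> P" for X
  proof (cases "X = - \<Omega>")
    case True
    then show ?thesis using K0 by (intro lipschitz_onI) (auto simp: companion_def)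
  next
    case False
    then obtain T where T: "T \<in> \<T>" "X = tri T" using X by (auto simp: P_def)
    have "norm (fst (?g T)) \<le> K" unfolding K_def using T finite_mesh by (intro member_le_sum) auto
    then have l: "lipschitz_on K UNIV (aff (?g T))" using aff_lipschitz lipschitz_on_le by blast
    show ?thesis
    proof (rule lipschitz_onI[OF _ K0])
      fix x y assume "x \<in> X" "y \<in> X"
      then show "dist (companion c x) (companion c y) \<le> K * dist x y"
        using companion_eq[OF T(1)] lipschitz_onD[OF l] T(2) by simp
    qed
  qed
  have "lipschitz_on K UNIV (companion c)"
  proof (rule lipschitz_onI[OF _ K0])
    fix x y :: point
    define f where "f t = x + t *\<^sub>R (y - x)" for t :: real
    have fc: "continuous_on UNIV f" unfolding f_def by (intro continuous_intros)
    have "lipschitz_on (K * norm (y - x)) {0..1} (companion c \<circ> f)"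
    proof (rule lipschitz_on_closed_Union[where I = P and U = "\<lambda>X. f -` X"])
      show "finite P" using finite_mesh by (simp add: P_def)
      show "0 \<le> K * norm (y - x)" using K0 by simp
      fix X assume X: "X \<in> P"
      have "closed X" using X open_domain closed_tri[OF nondeg] by (auto simp: P_def)
      then show "closed (f -` X)" using fc by (rule closed_vimage)
      show "lipschitz_on (K * norm (y - x)) (f -` X) (companion c \<circ> f)"
      proof (rule lipschitz_onI)
        fix s t assume "s \<in> f -` X" "t \<in> f -` X"
        then have "dist (companion c (f s)) (companion c (f t)) \<le> K * dist (f s) (f t)"
          using lipschitz_onD[OF piece[OF X]] by simp
        also have "dist (f s) (f t) = norm ((s - t) *\<^sub>R (y - x))" by (simp add: f_def dist_norm scaleR_diff_left)
        finally show "dist ((companion c \<circ> f) s) ((companion c \<circ> f) t) \<le> K * norm (y - x) * dist s t"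
          by (simp add: dist_real_def mult_ac)
      qed (use K0 in simp)
    next
      have "UNIV = \<Union>P" unfolding P_def using union_tri closure_subset by auto
      then show "{0..1} \<subseteq> (\<Union>X\<in>P. f -` X)" by blast
    qed
    from lipschitz_onD[OF this, of 0 1] show "dist (companion c x) (companion c y) \<le> K * dist x y"
      by (simp add: f_def dist_norm norm_minus_commute)
  qed
  then show ?thesis using that by blast
qed

lemma companion_H10: "companion c \<in> H10 \<Omega>"
proof -
  let ?g = "\<lambda>T. interpolant (sides (Mesh \<T>)) c T"
  obtain K where K: "lipschitz_on K UNIV (companion c)" by (rule companion_lipschitz)
  define G where "G = glue (\<lambda>T x. fst (?g T))"
  have Gm: "G \<in> borel_measurable lebesgue" unfolding G_def by (rule glue_measurable) simp
  \<comment> \<open>The zero lines of nonconstant pieces belong to the exceptional set, because there truncation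
    destroys the gradient at every level.\<close>
  define N where "N = (\<Union>T\<in>\<T>. (tri T - interior (tri T)) \<union> {x. fst (?g T) \<noteq> 0 \<and> aff (?g T) x = 0})"
  have h: "negligible {x. fst p \<noteq> 0 \<and> aff p x = 0}" for p
  proof (cases "fst p = 0")
    case False
    then have "negligible {x. fst p \<bullet> x = - snd p}" by (intro negligible_hyperplane) simp
    then show ?thesis by (rule negligible_subset) (auto simp: aff_def)
  qed simp
  have N: "negligible N" unfolding N_def 
  proof (rule negligible_Union)
    fix X assume "X \<in> (\<lambda>T. (tri T - interior (tri T)) \<union> {x. fst (?g T) \<noteq> 0 \<and> aff (?g T) x = 0}) ` \<T>"
    then show "negligible X" by (elim imageE) (simp only: negligible_Un[OF negligible_tri_boundary h])
  qed (use finite_mesh in simp)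
  have inside: "\<exists>T\<in>\<T>. x \<in> interior (tri T) \<and> (fst (?g T) = 0 \<or> aff (?g T) x \<noteq> 0)" if x: "x \<in> \<Omega>" "x \<notin> N" for x
  proof -
    obtain T where "T \<in> \<T>" "x \<in> tri T" using x(1) union_tri closure_subset by blast
    then show ?thesis using x(2) unfolding N_def by blast
  qed
  show ?thesis
  proof (rule H10I[OF open_domain _ K _ N Gm])
    show "bounded \<Omega>" using polygonal by (simp add: polygonal_domain_def)
    show "companion c x = 0" if "x \<notin> \<Omega>" for x using that by (simp add: companion_def)
    show "norm (G x) \<le> (\<Sum>T\<in>\<T>. norm (fst (?g T)))" for x
      unfolding G_def glue_def by (intro order_trans[OF norm_sum] sum_mono) (auto simp: indicator_def)
    fix x assume x: "x \<in> \<Omega>" "x \<notin> N"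
    obtain T where T: "T \<in> \<T>" "x \<in> interior (tri T)" "fst (?g T) = 0 \<or> aff (?g T) x \<noteq> 0" using inside[OF x] by blast
    have Gx: "G x = fst (?g T)" unfolding G_def by (rule glue_interior[OF T(1,2)])
    have xT: "x \<in> tri T" using T(2) interior_subset by blast
    show "companion c x \<noteq> 0 \<or> G x = 0" using T(3) companion_eq[OF T(1) xT] Gx by auto
    obtain r where r: "r > 0" "ball x r \<subseteq> tri T" using T(2) by (auto simp: mem_interior)
    have "companion c y = companion c x + G x \<bullet> (y - x)" if "y \<in> ball x r" for y
    proof -
      have "y \<in> tri T" using r that by blast
      then show ?thesis using companion_eq[OF T(1)] xT Gx aff_diff[of "?g T" y x] by simp
    qed
    then show "\<exists>r>0. \<forall>y\<in>ball x r. companion c y = companion c x + G x \<bullet> (y - x)" using r(1) by blast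
  qed
qed

end

section \<open>Crouzeix-Raviart functions on a refinement\<close>

text \<open>The affine function that is 1 at the midpoint of the side opposite to \<open>z\<close> and 0 at the two other
  midpoints.\<close>

definition cr_basis :: "marked_triangle \<Rightarrow> point \<Rightarrow> point \<times> real" where
  "cr_basis T z = (0, 1) - 2 *\<^sub>R bary T z"

lemma aff_cr_basis: "aff (cr_basis T z) x = 1 - 2 * bc T z x"
  unfolding cr_basis_def aff_minus_coefs by (simp add: aff_def algebra_simps)

lemma aff_side_mid:
  assumes nd: "nondegenerate T" and z: "z \<in> vertices T"
  shows "aff p (side_mid (opp_side T z)) = ((\<Sum>w\<in>vertices T. aff p w) - aff p z) / 2"
proof -
  obtain q r where V: "vertices T = {z, q, r}" "z \<noteq> q" "z \<noteq> r" "q \<noteq> r" using nondegenerateE[OF nd z] by metis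
  have "vertices T - {z} = {q, r}" using V by auto
  then have "opp_side T z = closed_segment q r" by (simp add: opp_side_def segment_convex_hull)
  moreover have "opp_side T z \<in> tri_sides T" using tri_sides_opp_side[OF nd] z by blast
  ultimately have "side_mid (opp_side T z) = midpoint q r" by (metis side_mid_eq)
  then show ?thesis using V by (simp add: aff_midpoint)
qed

lemma cr_value:
  assumes nd: "nondegenerate T" and z: "z \<in> vertices T"
  shows "aff (\<Sum>w\<in>vertices T. m w *\<^sub>R cr_basis T w) (side_mid (opp_side T z)) = m z"
proof -
  have "aff (cr_basis T w) (side_mid (opp_side T z)) = (if w = z then 1 else 0)" if w: "w \<in> vertices T" for w
  proof -
    have "(\<Sum>v\<in>vertices T. bc T w v) = (\<Sum>v\<in>vertices T. if v = w then 1 else 0)"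
      by (rule sum.cong) (auto simp: bary_vertex[OF nd w])
    then have "(\<Sum>v\<in>vertices T. bc T w v) = 1" using w nd by simp
    then show ?thesis using aff_side_mid[OF nd z, of "bary T w"] bary_vertex[OF nd w z] by (auto simp: aff_cr_basis)
  qed
  then have "aff (\<Sum>w\<in>vertices T. m w *\<^sub>R cr_basis T w) (side_mid (opp_side T z)) = (\<Sum>w\<in>vertices T. if w = z then m z else 0)"
    unfolding aff_sum_coefs by (intro sum.cong) auto
  then show ?thesis using z nd by simp
qed

text \<open>The value at a midpoint is the mean of two vertex values.  Since the midpoint values have the same sum
  as the vertex values, each vertex value can be recovered from them.\<close>

lemma cr_interpolation:
  assumes nd: "nondegenerate T"
  shows "p = (\<Sum>z\<in>vertices T. aff p (side_mid (opp_side T z)) *\<^sub>R cr_basis T z)"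
proof (rule affine_eq_on_triangle[OF nd])
  fix w assume w: "w \<in> vertices T"
  let ?Q = "\<Sum>v\<in>vertices T. aff p v"
  have "aff (\<Sum>z\<in>vertices T. aff p (side_mid (opp_side T z)) *\<^sub>R cr_basis T z) w
     = (\<Sum>z\<in>vertices T. (?Q - aff p z) / 2 - (if z = w then ?Q - aff p w else 0))"
    unfolding aff_sum_coefs using bary_vertex[OF nd _ w]
    by (intro sum.cong) (auto simp: aff_cr_basis aff_side_mid[OF nd] field_simps)
  also have "\<dots> = (\<Sum>z\<in>vertices T. (?Q - aff p z) / 2) - (?Q - aff p w)"
    using w nd by (simp add: sum_subtractf)
  also have "(\<Sum>z\<in>vertices T. (?Q - aff p z) / 2) = ?Q"
    using card_vertices[OF nd] by (simp add: sum_divide_distrib[symmetric] sum_subtractf)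
  finally show "aff p w = aff (\<Sum>z\<in>vertices T. aff p (side_mid (opp_side T z)) *\<^sub>R cr_basis T z) w" by simp
qed

lemma side_of_segment:
  assumes nd: "nondegenerate T" and ab: "a \<in> tri T" "b \<in> tri T" and m: "midpoint a b \<in> opp_side T z" and z: "z \<in> vertices T"
  shows "closed_segment a b \<subseteq> opp_side T z"
proof -
  have "bc T z (midpoint a b) = 0" using m opp_side_iff[OF nd z] by blast
  then have "bc T z a + bc T z b = 0" by (simp add: aff_midpoint)
  moreover have "0 \<le> bc T z a" "0 \<le> bc T z b" using ab tri_iff[OF nd] z by auto
  ultimately have "a \<in> opp_side T z" "b \<in> opp_side T z" using ab opp_side_iff[OF nd z] by auto
  then show ?thesis using closed_segment_subset[of a "opp_side T z" b] by (simp add: opp_side_def)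
qed

text \<open>Vertices are extreme points.\<close>

lemma vertex_not_midpoint:
  assumes nd: "nondegenerate T" and ab: "a \<in> tri T" "b \<in> tri T" "a \<noteq> b" shows "midpoint a b \<notin> vertices T"
proof
  let ?m = "midpoint a b"
  assume m: "?m \<in> vertices T"
  have eq: "x = ?m" if x: "x \<in> tri T" "bc T ?m x = 1" for x
  proof -
    have "(\<Sum>w\<in>vertices T - {?m}. bc T w x) = 0"
      using bary_sum[OF nd, of x] m nd x by (simp add: sum.remove[of "vertices T" ?m])
    then have "\<forall>w\<in>vertices T - {?m}. bc T w x = 0"
      using x tri_iff[OF nd] nd by (subst (asm) sum_nonneg_eq_0_iff) auto
    then have "(\<Sum>w\<in>vertices T - {?m}. bc T w x *\<^sub>R w) = 0" by (intro sum.neutral) simp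
    then show ?thesis using bary_point[OF nd, of x] m nd x by (simp add: sum.remove[of "vertices T" ?m])
  qed
  have "bc T ?m ?m = 1" using bary_vertex[OF nd m m] by simp
  then have "bc T ?m a + bc T ?m b = 2" by (simp add: aff_midpoint[of _ a b])
  moreover have "bc T ?m a \<le> 1" "bc T ?m b \<le> 1" using bary_le_1[OF nd _ m] ab by auto
  ultimately have "bc T ?m a = 1" "bc T ?m b = 1" by linarith+
  then show False using eq ab by metis
qed

locale refinement = coarse: mesh \<Omega> \<T> + fine: mesh \<Omega> \<N>
  for \<Omega> :: "point set" and \<T> \<N> :: "marked_triangle set" +
  assumes refines: "T' \<in> \<N> \<Longrightarrow> \<exists>T\<in>\<T>. tri T' \<subseteq> tri T"
begin

lemma parent_unique:
  assumes "T' \<in> \<N>" "T1 \<in> \<T>" "T2 \<in> \<T>" "tri T' \<subseteq> tri T1" "tri T' \<subseteq> tri T2" shows "T1 = T2"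
proof -
  have "interior (tri T') \<noteq> {}" using closure_interior_tri[OF fine.nondeg[OF assms(1)]] vertex_in_tri[of "newest T'" T'] 
    by (auto simp: vertices_def)
  then obtain x where x: "x \<in> interior (tri T')" by blast
  then have "x \<in> interior (tri T1)" using interior_mono[OF assms(4)] by blast
  moreover have "x \<in> tri T2" using x interior_subset assms(5) by blast
  ultimately show ?thesis using coarse.interior_point_unique assms(2,3) by blast
qed

definition parent :: "marked_triangle \<Rightarrow> marked_triangle" where
  "parent T' = (SOME T. T \<in> \<T> \<and> tri T' \<subseteq> tri T)"

lemma parent: assumes "T' \<in> \<N>" shows "parent T' \<in> \<T>" "tri T' \<subseteq> tri (parent T')"
proof -
  have "\<exists>T. T \<in> \<T> \<and> tri T' \<subseteq> tri T" using refines[OF assms] by blast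
  then have "parent T' \<in> \<T> \<and> tri T' \<subseteq> tri (parent T')" unfolding parent_def by (rule someI_ex)
  then show "parent T' \<in> \<T>" "tri T' \<subseteq> tri (parent T')" by auto
qed

text \<open>Both terms on the left-hand side are integrals of functions that are almost everywhere bounded
  by a function constant on every coarse triangle.\<close>

lemma error_estimate:
  assumes f: "f \<in> borel_measurable (lebesgue_on \<Omega>)" "fine.represents d f"
    and e: "\<And>T. T \<in> \<T> \<Longrightarrow> 0 \<le> e T" and k: "0 \<le> k" "0 \<le> k'"
    and val: "\<And>T' x. T' \<in> \<N> \<Longrightarrow> x \<in> tri T' \<Longrightarrow> (aff (d T') x)\<^sup>2 \<le> k * e (parent T')"
    and gr: "\<And>T'. T' \<in> \<N> \<Longrightarrow> (norm (fst (d T')))\<^sup>2 \<le> k' * e (parent T') / area (parent T')"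
  shows "(L2_norm \<Omega> (\<lambda>x. inverse (mesh_size \<T> x) * f x))\<^sup>2 + (L2_norm \<Omega> (nc_grad \<N> f))\<^sup>2
     \<le> (k + k') * (\<Sum>T\<in>\<T>. e T)"
proof -
  define \<Phi> where "\<Phi> c x = (\<Sum>T\<in>\<T>. indicator (tri T) x * (c * e T / area T))" for c x
  have ap: "0 < area T" if "T \<in> \<T>" for T using area_pos coarse.nondeg that by blast
  have \<Phi>0: "0 \<le> \<Phi> c x" if "0 \<le> c" for c x
    unfolding \<Phi>_def using that e ap by (intro sum_nonneg mult_nonneg_nonneg divide_nonneg_nonneg) (auto intro: less_imp_le)
  have \<Phi>1: "c * e T / area T \<le> \<Phi> c x" if c: "0 \<le> c" and T: "T \<in> \<T>" "x \<in> tri T" for c x T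
  proof -
    have "indicator (tri T) x * (c * e T / area T) \<le> \<Phi> c x"
      unfolding \<Phi>_def using T c e ap coarse.finite_mesh
      by (intro member_le_sum mult_nonneg_nonneg divide_nonneg_nonneg) (auto intro: less_imp_le)
    then show ?thesis using T by simp
  qed
  have ind: "integrable (lebesgue_on \<Omega>) (indicator (tri T) :: point \<Rightarrow> real)" 
    "integral\<^sup>L (lebesgue_on \<Omega>) (indicator (tri T)) \<le> area T" if T: "T \<in> \<T>" for T
  proof -
    have m: "tri T \<inter> \<Omega> \<in> lmeasurable" using tri_lmeasurable[OF coarse.nondeg[OF T]] coarse.domain_lmeasurable by (rule fmeasurable.Int)
    have e: "(\<lambda>x. if x \<in> \<Omega> then indicator (tri T) x else 0) = (indicator (tri T \<inter> \<Omega>) :: point \<Rightarrow> real)"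
      by (auto simp: indicator_def fun_eq_iff)
    show "integrable (lebesgue_on \<Omega>) (indicator (tri T) :: point \<Rightarrow> real)"
      using m Lebesgue_Measure.integrable_restrict_UNIV[OF coarse.domain_sets, of "indicator (tri T) :: point \<Rightarrow> real"]
      unfolding e lmeasurable_iff_integrable by blast
    have "integral\<^sup>L (lebesgue_on \<Omega>) (indicator (tri T)) = measure lebesgue (tri T \<inter> \<Omega>)"
      using Lebesgue_Measure.integral_restrict_UNIV[OF coarse.domain_sets, of "indicator (tri T) :: point \<Rightarrow> real"] unfolding e by simp
    also have "\<dots> \<le> area T" using tri_lmeasurable[OF coarse.nondeg[OF T]] m 
      by (intro measure_mono_fmeasurable) (auto intro: fmeasurableD)
    finally show "integral\<^sup>L (lebesgue_on \<Omega>) (indicator (tri T)) \<le> area T" .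
  qed
  have \<Phi>i: "integrable (lebesgue_on \<Omega>) (\<Phi> c)" for c
    unfolding \<Phi>_def[abs_def] using ind(1) by (intro Bochner_Integration.integrable_sum integrable_mult_left) auto
  have \<Phi>int: "integral\<^sup>L (lebesgue_on \<Omega>) (\<Phi> c) \<le> c * (\<Sum>T\<in>\<T>. e T)" if c: "0 \<le> c" for c
  proof -
    have "integral\<^sup>L (lebesgue_on \<Omega>) (\<Phi> c) = (\<Sum>T\<in>\<T>. integral\<^sup>L (lebesgue_on \<Omega>) (indicator (tri T)) * (c * e T / area T))"
      unfolding \<Phi>_def[abs_def] using ind(1) by (subst Bochner_Integration.integral_sum) auto
    also have "\<dots> \<le> (\<Sum>T\<in>\<T>. area T * (c * e T / area T))"
      using ind(2) c e ap by (intro sum_mono mult_right_mono divide_nonneg_nonneg) (auto intro: less_imp_le)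
    also have "\<dots> = (\<Sum>T\<in>\<T>. c * e T)" 
    proof (rule sum.cong[OF refl])
      fix T assume "T \<in> \<T>"
      then show "area T * (c * e T / area T) = c * e T" using ap[of T] by simp
    qed
    finally show ?thesis by (simp add: sum_distrib_left)
  qed
  have bound: "(L2_norm \<Omega> g)\<^sup>2 \<le> c * (\<Sum>T\<in>\<T>. e T)"
    if c: "0 \<le> c" and ae: "AE x in lebesgue_on \<Omega>. (norm (g x))\<^sup>2 \<le> \<Phi> c x" for g :: "point \<Rightarrow> 'z::euclidean_space" and c
  proof -
    have "(L2_norm \<Omega> g)\<^sup>2 = integral\<^sup>L (lebesgue_on \<Omega>) (\<lambda>x. (norm (g x))\<^sup>2)"
      unfolding L2_norm_def by (simp add: integral_nonneg_AE)
    also have "\<dots> \<le> integral\<^sup>L (lebesgue_on \<Omega>) (\<Phi> c)"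
      using \<Phi>i ae \<Phi>0[OF c] by (intro integral_mono_AE') auto
    finally show ?thesis using \<Phi>int[OF c] by linarith
  qed
  have "AE x in lebesgue_on \<Omega>. (norm (inverse (mesh_size \<T> x) * f x))\<^sup>2 \<le> \<Phi> k x"
    unfolding fine.AE_domain_iff
  proof
    fix T' assume T': "T' \<in> \<N>"
    let ?T = "parent T'"
    have nonempty: "AE x in lebesgue_on (tri T'). x \<in> interior (tri T')"
      unfolding AE_lebesgue_on_iff[OF tri_sets[OF fine.nondeg[OF T']]]
      using negligible_tri_boundary[of T'] by (simp add: set_diff_eq)
    have inT: "AE x in lebesgue_on (tri T'). x \<in> tri T'" by (rule AE_I2) simp
    from f(2) T' have "AE x in lebesgue_on (tri T'). f x = aff (d T') x" by (simp add: fine.represents_def)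
    with nonempty inT show "AE x in lebesgue_on (tri T'). (norm (inverse (mesh_size \<T> x) * f x))\<^sup>2 \<le> \<Phi> k x"
    proof eventually_elim
      case (elim x)
      have xi: "x \<in> interior (tri ?T)" using elim(1) interior_mono[OF parent(2)[OF T']] by blast
      then have xT: "x \<in> tri ?T" using interior_subset by blast
      have "(SOME T. T \<in> \<T> \<and> x \<in> tri T) = ?T"
      proof (rule some_equality)
        show "?T \<in> \<T> \<and> x \<in> tri ?T" using parent(1)[OF T'] xT by simp
        fix T assume "T \<in> \<T> \<and> x \<in> tri T"
        then show "T = ?T" using coarse.interior_point_unique[OF parent(1)[OF T'] _ xi] by blast
      qed
      then have "mesh_size \<T> x = sqrt (area ?T)" by (simp add: mesh_size_def)
      then have "(norm (inverse (mesh_size \<T> x) * f x))\<^sup>2 = (aff (d T') x)\<^sup>2 / area ?T"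
        using elim(3) ap[OF parent(1)[OF T']] by (simp add: power_mult_distrib field_simps power_inverse)
      also have "\<dots> \<le> k * e ?T / area ?T"
        using val[OF T' elim(2)] ap[OF parent(1)[OF T']] by (intro divide_right_mono) auto
      also have "\<dots> \<le> \<Phi> k x" by (rule \<Phi>1[OF k(1) parent(1)[OF T'] xT])
      finally show ?case .
    qed
  qed
  then have 1: "(L2_norm \<Omega> (\<lambda>x. inverse (mesh_size \<T> x) * f x))\<^sup>2 \<le> k * (\<Sum>T\<in>\<T>. e T)" by (rule bound[OF k(1)])
  have "AE x in lebesgue_on \<Omega>. (norm (nc_grad \<N> f x))\<^sup>2 \<le> \<Phi> k' x"
    unfolding fine.AE_domain_iff
  proof
    fix T' assume T': "T' \<in> \<N>"
    have inT: "AE x in lebesgue_on (tri T'). x \<in> tri T'" by (rule AE_I2) simp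
    from fine.nc_grad_AE[OF f T'] inT show "AE x in lebesgue_on (tri T'). (norm (nc_grad \<N> f x))\<^sup>2 \<le> \<Phi> k' x"
    proof eventually_elim
      case (elim x)
      have "(norm (fst (d T')))\<^sup>2 \<le> \<Phi> k' x" 
        using gr[OF T'] \<Phi>1[OF k(2) parent(1)[OF T'], of x] parent(2)[OF T'] elim(2) by (meson order_trans subsetD)
      then show ?case using elim(1) by simp
    qed
  qed
  then have "(L2_norm \<Omega> (nc_grad \<N> f))\<^sup>2 \<le> k' * (\<Sum>T\<in>\<T>. e T)" by (rule bound[OF k(2)])
  with 1 show ?thesis by (simp add: distrib_right)
qed

abbreviation refined_sides :: "point set set" where
  "refined_sides \<equiv> sides (Mesh \<T>) - sides (Mesh \<N>)"

text \<open>On unrefined sides the operator keeps the mean values of the given function, on all other sides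
  it takes those of the nodal interpolant.\<close>

definition mid_value :: "(marked_triangle \<Rightarrow> point \<times> real) \<Rightarrow> marked_triangle \<Rightarrow> point set \<Rightarrow> real" where
  "mid_value c T' S = aff (if S \<in> sides (Mesh \<T>) then c (parent T')
      else coarse.interpolant refined_sides c (parent T')) (side_mid S)"

definition cr_coefs :: "(marked_triangle \<Rightarrow> point \<times> real) \<Rightarrow> marked_triangle \<Rightarrow> point \<times> real" where
  "cr_coefs c T' = (\<Sum>z\<in>vertices T'. mid_value c T' (opp_side T' z) *\<^sub>R cr_basis T' z)"

definition cr_operator :: "(marked_triangle \<Rightarrow> point \<times> real) \<Rightarrow> point \<Rightarrow> real" where
  "cr_operator c = fine.glue (\<lambda>T'. aff (cr_coefs c T'))"

lemma cr_coefs_mid: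
  assumes "T' \<in> \<N>" "S \<in> tri_sides T'" shows "aff (cr_coefs c T') (side_mid S) = mid_value c T' S"
proof -
  obtain z where "z \<in> vertices T'" "S = opp_side T' z" using tri_sides_opp_side[OF fine.nondeg[OF assms(1)]] assms(2) by blast
  then show ?thesis unfolding cr_coefs_def using cr_value[OF fine.nondeg[OF assms(1)]] by simp
qed

lemma fine_side_in_parent:
  assumes "T' \<in> \<N>" "S \<in> tri_sides T'" shows "S \<subseteq> tri (parent T')"
  using side_subset_tri[OF assms(2)] parent(2)[OF assms(1)] by blast

lemma coarse_side_of_parent:
  assumes "T' \<in> \<N>" "S \<in> tri_sides T'" "S \<in> sides (Mesh \<T>)" shows "S \<in> tri_sides (parent T')"
proof -
  obtain T where "T \<in> \<T>" "S \<in> tri_sides T" using assms(3) by auto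
  then show ?thesis using coarse.side_of_neighbour parent(1)[OF assms(1)] fine_side_in_parent[OF assms(1,2)] by blast
qed

text \<open>A coarse side with a new fine side in it cannot itself be a fine side, since fine sides are not nested.\<close>

lemma refined_sideI:
  assumes "T' \<in> \<N>" "S \<in> tri_sides T'" "S \<notin> sides (Mesh \<T>)" "T \<in> \<T>" "S0 \<in> tri_sides T" "S \<subseteq> S0"
  shows "S0 \<in> refined_sides"
proof -
  have S0: "S0 \<in> sides (Mesh \<T>)" using assms by auto
  moreover have "S0 \<notin> sides (Mesh \<N>)"
  proof
    assume "S0 \<in> sides (Mesh \<N>)"
    moreover have "S \<in> sides (Mesh \<N>)" using assms by auto
    ultimately have "S = S0" using fine.nested_sides assms(6) by blast
    then show False using S0 assms(3) by simp
  qed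
  ultimately show ?thesis by simp
qed

text \<open>A fine side runs through the interior of a coarse triangle, or lies on an unrefined side or on a refined side.  The
  prescribed midpoint value is single valued in each case: on unrefined sides by the conditions on \<open>v\<close>,
  on refined sides by the agreement of the interpolants.\<close>

lemma cr_operator_CR10:
  assumes v: "v \<in> CR10 \<Omega> (Mesh \<T>)" "coarse.represents c v"
  shows "cr_operator c \<in> CR10 \<Omega> (Mesh \<N>)"
proof (rule fine.CR10_I)
  show "cr_operator c \<in> L2 \<Omega>" unfolding cr_operator_def by (rule fine.glue_affine_L2)
  show "fine.represents (cr_coefs c) (cr_operator c)" unfolding cr_operator_def by (rule fine.represents_glue)
next
  fix T' S assume T': "T' \<in> \<N>" "S \<in> tri_sides T'" and fr: "S \<subseteq> frontier \<Omega>"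
  let ?T = "parent T'"
  note T = parent(1)[OF T'(1)] and nd = coarse.nondeg[OF parent(1)[OF T'(1)]]
  show "aff (cr_coefs c T') (side_mid S) = 0"
  proof (cases "S \<in> sides (Mesh \<T>)")
    case True
    then show ?thesis unfolding cr_coefs_mid[OF T'] mid_value_def
      using coarse.CR10_mid_boundary[OF v T coarse_side_of_parent[OF T' True] fr] by simp
  next
    case False
    obtain a b where ab: "a \<noteq> b" "S = closed_segment a b" using T'(2) by (auto simp: tri_sides_def)
    have m: "side_mid S = midpoint a b" using side_mid_eq T'(2) ab(2) by blast
    have abT: "a \<in> tri ?T" "b \<in> tri ?T" using fine_side_in_parent[OF T'] ab(2) by auto
    have mS: "side_mid S \<in> S" using side_mid_in T'(2) by blast
    then have "side_mid S \<notin> \<Omega>" using fr coarse.frontier_eq by blast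
    then have "side_mid S \<notin> interior (tri ?T)" using coarse.interior_tri_subset[OF T] by blast
    moreover have "side_mid S \<in> tri ?T" using mS fine_side_in_parent[OF T'] by blast
    ultimately obtain z where z: "z \<in> vertices ?T" "side_mid S \<in> opp_side ?T z" using boundary_point_on_side[OF nd] by metis
    have sub: "S \<subseteq> opp_side ?T z" using side_of_segment[OF nd abT _ z(1)] z(2) m ab(2) by simp
    have S0: "opp_side ?T z \<in> tri_sides ?T" using tri_sides_opp_side[OF nd] z(1) by blast
    have "opp_side ?T z \<subseteq> frontier \<Omega>"
    proof (rule ccontr)
      assume "\<not> opp_side ?T z \<subseteq> frontier \<Omega>"
      then obtain T2 where T2: "T2 \<in> \<T>" "opp_side ?T z \<in> tri_sides T2" "T2 \<noteq> ?T" using coarse.interior_sideE[OF T S0] by metis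
      have "side_mid S \<notin> vertices ?T" using vertex_not_midpoint[OF nd abT ab(1)] m by simp
      then have "side_mid S \<in> \<Omega>" 
        using coarse.interior_side_not_in_frontier[OF T T2(1) T2(3)[symmetric] S0 T2(2) z(2)] by simp
      then show False using \<open>side_mid S \<notin> \<Omega>\<close> by simp
    qed
    moreover have "opp_side ?T z \<in> refined_sides" by (rule refined_sideI[OF T' False T S0 sub])
    ultimately show ?thesis unfolding cr_coefs_mid[OF T'] mid_value_def
      using coarse.interpolant_boundary[OF _ T S0 _ z(2)] False by simp
  qed
next
  fix T1 T2 S assume N: "T1 \<in> \<N>" "T2 \<in> \<N>" and ne: "T1 \<noteq> T2" and S: "S \<in> tri_sides T1" "S \<in> tri_sides T2"
  let ?P1 = "parent T1" and ?P2 = "parent T2"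
  note P = parent(1)[OF N(1)] parent(1)[OF N(2)]
  have "mid_value c T1 S = mid_value c T2 S"
  proof (cases "S \<in> sides (Mesh \<T>)")
    case True
    then show ?thesis unfolding mid_value_def
      using coarse.CR10_mid_interior[OF v P coarse_side_of_parent[OF N(1) S(1) True] coarse_side_of_parent[OF N(2) S(2) True]] by simp
  next
    case False
    show ?thesis
    proof (cases "?P1 = ?P2")
      case True then show ?thesis by (simp add: mid_value_def)
    next
      case ne: False
      obtain a b where ab: "a \<noteq> b" "S = closed_segment a b" using S(1) by (auto simp: tri_sides_def)
      have sub: "S \<subseteq> tri ?P1 \<inter> tri ?P2" using fine_side_in_parent N S by blast
      then have abP: "a \<in> tri ?P1" "a \<in> tri ?P2" "b \<in> tri ?P1 \<inter> tri ?P2" using ab by auto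
      have S0: "tri ?P1 \<inter> tri ?P2 \<in> tri_sides ?P1" "tri ?P1 \<inter> tri ?P2 \<in> tri_sides ?P2"
        using coarse.intersection_cases[OF P ne abP(1,2)] abP(3) ab(1) by (metis singletonD)+
      have "tri ?P1 \<inter> tri ?P2 \<in> refined_sides" by (rule refined_sideI[OF N(1) S(1) False P(1) S0(1) sub])
      moreover have "side_mid S \<in> tri ?P1 \<inter> tri ?P2" using sub side_mid_in[OF S(1)] by blast
      ultimately show ?thesis unfolding mid_value_def using coarse.interpolant_agree[OF _ P S0] False by simp
    qed
  qed
  then show "aff (cr_coefs c T1) (side_mid S) = aff (cr_coefs c T2) (side_mid S)"
    using cr_coefs_mid N S by simp
qed

lemma cr_difference:
  assumes "T' \<in> \<N>"
  shows "c (parent T') - cr_coefs c T' = (\<Sum>z\<in>vertices T'. 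
    (if opp_side T' z \<in> sides (Mesh \<T>) then 0 
     else aff (c (parent T') - coarse.interpolant refined_sides c (parent T')) (side_mid (opp_side T' z))) *\<^sub>R cr_basis T' z)"
proof -
  have "c (parent T') - cr_coefs c T' 
    = (\<Sum>z\<in>vertices T'. (aff (c (parent T')) (side_mid (opp_side T' z)) - mid_value c T' (opp_side T' z)) *\<^sub>R cr_basis T' z)"
    unfolding cr_coefs_def 
    by (subst cr_interpolation[OF fine.nondeg[OF assms], of "c (parent T')"]) (simp add: sum_subtractf scaleR_diff_left)
  also have "\<dots> = (\<Sum>z\<in>vertices T'. 
    (if opp_side T' z \<in> sides (Mesh \<T>) then 0 
     else aff (c (parent T') - coarse.interpolant refined_sides c (parent T')) (side_mid (opp_side T' z))) *\<^sub>R cr_basis T' z)"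
    unfolding mid_value_def aff_minus_coefs by (intro sum.cong refl) (simp only: split: if_split, simp)
  finally show ?thesis .
qed

text \<open>A fine triangle that has a coarse side is comparable in size to its parent.  On all other fine
  triangles the difference coincides with the difference to the nodal interpolant.\<close>

lemma cr_error:
  assumes C: "0 \<le> C" and sr: "shape_regular C T'" "shape_regular C (parent T')" and T': "T' \<in> \<N>"
    and b: "\<And>z. z \<in> vertices (parent T') \<Longrightarrow> \<bar>aff (c (parent T') - coarse.interpolant refined_sides c (parent T')) z\<bar> \<le> e"
  shows "x \<in> tri T' \<Longrightarrow> (aff (c (parent T') - cr_coefs c T') x)\<^sup>2 \<le> 9 * e\<^sup>2"
    and "(norm (fst (c (parent T') - cr_coefs c T')))\<^sup>2 \<le> (9 * C + 9 * C ^ 3) * e\<^sup>2 / area (parent T')"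
proof -
  let ?T = "parent T'"
  note T = parent[OF T'] and nd' = fine.nondeg[OF T'] and nd = coarse.nondeg[OF parent(1)[OF T']]
  define d where "d = c ?T - coarse.interpolant refined_sides c ?T"
  define m where "m z = (if opp_side T' z \<in> sides (Mesh \<T>) then 0 else aff d (side_mid (opp_side T' z)))" for z
  have diff: "c ?T - cr_coefs c T' = (\<Sum>z\<in>vertices T'. m z *\<^sub>R cr_basis T' z)"
    unfolding m_def d_def by (rule cr_difference[OF T'])
  have "newest ?T \<in> vertices ?T" by (simp add: vertices_def)
  then have e: "0 \<le> e" using b order_trans[OF abs_ge_zero] by blast
  have m: "\<bar>m z\<bar> \<le> e" if z: "z \<in> vertices T'" for z
  proof -
    have "opp_side T' z \<in> tri_sides T'" using tri_sides_opp_side[OF nd'] z by blast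
    then have "side_mid (opp_side T' z) \<in> tri ?T" using fine_side_in_parent[OF T'] side_mid_in by blast
    then have "\<bar>aff d (side_mid (opp_side T' z))\<bar> \<le> e" using aff_bound_on_tri[OF nd] b unfolding d_def by blast
    then show ?thesis using e by (simp add: m_def)
  qed
  show "(aff (c ?T - cr_coefs c T') x)\<^sup>2 \<le> 9 * e\<^sup>2" if x: "x \<in> tri T'"
  proof -
    have "\<bar>aff (c ?T - cr_coefs c T') x\<bar> \<le> (\<Sum>z\<in>vertices T'. \<bar>m z * aff (cr_basis T' z) x\<bar>)"
      unfolding diff aff_sum_coefs by (rule sum_abs)
    also have "\<dots> \<le> (\<Sum>z\<in>vertices T'. e * 1)"
    proof (rule sum_mono)
      fix z assume z: "z \<in> vertices T'"
      have "0 \<le> bc T' z x" "bc T' z x \<le> 1" using tri_iff[OF nd'] bary_le_1[OF nd' x z] x z by auto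
      then have "\<bar>aff (cr_basis T' z) x\<bar> \<le> 1" unfolding aff_cr_basis by linarith
      then show "\<bar>m z * aff (cr_basis T' z) x\<bar> \<le> e * 1" unfolding abs_mult using m[OF z] e by (intro mult_mono) auto
    qed
    also have "\<dots> = 3 * e" using card_vertices[OF nd'] by simp
    finally have "\<bar>aff (c ?T - cr_coefs c T') x\<bar>\<^sup>2 \<le> (3 * e)\<^sup>2" by (intro power_mono) auto
    then show ?thesis by (simp add: power_mult_distrib)
  qed
  have ap: "0 < area ?T" "0 < area T'" using area_pos nd nd' by auto
  show "(norm (fst (c ?T - cr_coefs c T')))\<^sup>2 \<le> (9 * C + 9 * C ^ 3) * e\<^sup>2 / area ?T"
  proof (cases "\<exists>z\<in>vertices T'. opp_side T' z \<in> sides (Mesh \<T>)")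
    case False
    have "(\<Sum>z\<in>vertices T'. m z *\<^sub>R cr_basis T' z)
      = (\<Sum>z\<in>vertices T'. aff d (side_mid (opp_side T' z)) *\<^sub>R cr_basis T' z)"
      using False unfolding m_def by (intro sum.cong refl) (simp del: sides.simps)
    also have "\<dots> = d" by (rule cr_interpolation[OF nd', symmetric])
    finally have "c ?T - cr_coefs c T' = d" using diff by simp
    also have "d = (\<Sum>z\<in>vertices ?T. aff d z *\<^sub>R bary ?T z)" by (rule affine_interpolation_coefs[OF nd])
    finally have "(norm (fst (c ?T - cr_coefs c T')))\<^sup>2 = (norm (fst (\<Sum>z\<in>vertices ?T. aff d z *\<^sub>R bary ?T z)))\<^sup>2" by simp
    also have "\<dots> \<le> 9 * e\<^sup>2 * (C / (4 * area ?T))"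
      using b unfolding d_def by (rule gradient_bound[OF nd sr(2)])
    also have "\<dots> = (9 * C / 4) * e\<^sup>2 / area ?T" by simp
    also have "\<dots> \<le> (9 * C + 9 * C ^ 3) * e\<^sup>2 / area ?T"
      using C ap by (intro divide_right_mono mult_right_mono) auto
    finally show ?thesis .
  next
    case True
    then obtain z where z: "z \<in> vertices T'" "opp_side T' z \<in> sides (Mesh \<T>)" by blast
    have S: "opp_side T' z \<in> tri_sides T'" using tri_sides_opp_side[OF nd'] z by blast
    obtain a b where ab: "a \<in> vertices T'" "b \<in> vertices T'" "a \<noteq> b" "opp_side T' z = closed_segment a b" using S by (auto simp: tri_sides_def)
    obtain a' b' where ab': "a' \<in> vertices ?T" "b' \<in> vertices ?T" "a' \<noteq> b'" "opp_side T' z = closed_segment a' b'"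
      using coarse_side_of_parent[OF T' S z(2)] by (auto simp: tri_sides_def)
    have "{a, b} = {a', b'}" using ab(4) ab'(4) closed_segment_eq by metis
    then have v: "a \<in> vertices ?T" "b \<in> vertices ?T" using ab' by (auto simp: doubleton_eq_iff)
    have "4 * area ?T \<le> C * (dist a b)\<^sup>2" by (rule area_le_side[OF nd sr(2) v ab(3)])
    also have "\<dots> \<le> C * (C * area T')" using sr(1) ab C unfolding shape_regular_def by (intro mult_left_mono) auto
    finally have size: "4 * area ?T \<le> C\<^sup>2 * area T'" by (simp add: power2_eq_square mult.assoc)
    have "fst (c ?T - cr_coefs c T') = fst (\<Sum>z\<in>vertices T'. (- 2 * m z) *\<^sub>R bary T' z)"
      unfolding diff by (simp add: fst_sum cr_basis_def mult.commute)
    then have "(norm (fst (c ?T - cr_coefs c T')))\<^sup>2 = (norm (fst (\<Sum>z\<in>vertices T'. (- 2 * m z) *\<^sub>R bary T' z)))\<^sup>2" by simp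
    also have "\<dots> \<le> 9 * (2 * e)\<^sup>2 * (C / (4 * area T'))"
      using m by (intro gradient_bound[OF nd' sr(1)]) (auto simp: abs_mult)
    also have "\<dots> = 9 * e\<^sup>2 * C * (1 / area T')" by (simp add: power_mult_distrib)
    also have "\<dots> \<le> 9 * e\<^sup>2 * C * (C\<^sup>2 / area ?T)"
    proof (rule mult_left_mono)
      have "area ?T \<le> C\<^sup>2 * area T'" using size ap by linarith
      then show "1 / area T' \<le> C\<^sup>2 / area ?T" using ap by (simp add: field_simps)
    qed (use C in simp)
    also have "\<dots> = (9 * C ^ 3) * e\<^sup>2 / area ?T" by (simp add: power3_eq_cube power2_eq_square)
    also have "\<dots> \<le> (9 * C + 9 * C ^ 3) * e\<^sup>2 / area ?T"
      using C ap by (intro divide_right_mono mult_right_mono) auto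
    finally show ?thesis .
  qed
qed

end

section \<open>The transfer operator\<close>

lemma AE_lebesgue_on_subset:
  assumes "AE x in lebesgue_on A. P x" "B \<subseteq> A" "A \<in> sets lebesgue" "B \<in> sets lebesgue"
  shows "AE x in lebesgue_on B. P (x :: point)"
proof -
  have "negligible {x. x \<in> A \<and> \<not> P x}" using assms AE_lebesgue_on_iff by blast
  then have "negligible {x. x \<in> B \<and> \<not> P x}" by (rule negligible_subset) (use assms(2) in blast)
  then show ?thesis using AE_lebesgue_on_iff[OF assms(4)] by blast
qed

abbreviation transfer_constant :: "real \<Rightarrow> real" where
  "transfer_constant C \<equiv> (9 + (9 * C + 9 * C ^ 3)) * (((pi * C)\<^sup>2 + 1)\<^sup>2 * (3 * (pi * C)))"

lemma (in refinement) cr_operator_estimate: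
  assumes v: "v \<in> CR10 \<Omega> (Mesh \<T>)" "coarse.represents c v" and C: "0 \<le> C"
    and sr: "\<forall>T\<in>\<T>. shape_regular C T" "\<forall>T\<in>\<N>. shape_regular C T"
  shows "(L2_norm \<Omega> (\<lambda>x. inverse (mesh_size \<T> x) * (v x - cr_operator c x)))\<^sup>2
      + (L2_norm \<Omega> (nc_grad \<N> (\<lambda>x. v x - cr_operator c x)))\<^sup>2
      \<le> transfer_constant C * (\<Sum>S\<in>refined_sides. coarse.side_indicator v S)"
proof -
  let ?R = refined_sides and ?e = "coarse.local_error C refined_sides v"
  have R: "?R \<subseteq> sides (Mesh \<T>)" by blast
  have e0: "0 \<le> ?e T" for T by (rule coarse.local_error_nonneg)
  have b: "\<bar>aff (c T - coarse.interpolant ?R c T) z\<bar> \<le> sqrt (?e T)" if "T \<in> \<T>" "z \<in> vertices T" for T z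
    by (rule coarse.interpolant_error[OF v R sr(1) that])
  have "(L2_norm \<Omega> (\<lambda>x. inverse (mesh_size \<T> x) * (v x - cr_operator c x)))\<^sup>2
      + (L2_norm \<Omega> (nc_grad \<N> (\<lambda>x. v x - cr_operator c x)))\<^sup>2 \<le> (9 + (9 * C + 9 * C ^ 3)) * (\<Sum>T\<in>\<T>. ?e T)"
  proof (rule error_estimate[where d = "\<lambda>T'. c (parent T') - cr_coefs c T'"])
    show "(\<lambda>x. v x - cr_operator c x) \<in> borel_measurable (lebesgue_on \<Omega>)"
    proof (rule borel_measurable_diff)
      show "v \<in> borel_measurable (lebesgue_on \<Omega>)" using v(1) by (simp add: L2_def)
      show "cr_operator c \<in> borel_measurable (lebesgue_on \<Omega>)"
        using fine.glue_affine_L2[of "cr_coefs c"] unfolding cr_operator_def by (simp add: L2_def)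
    qed
    show "fine.represents (\<lambda>T'. c (parent T') - cr_coefs c T') (\<lambda>x. v x - cr_operator c x)"
      unfolding fine.represents_def
    proof
      fix T' assume T': "T' \<in> \<N>"
      have "AE x in lebesgue_on (tri T'). v x = aff (c (parent T')) x"
        using v(2) parent[OF T'] coarse.nondeg fine.nondeg[OF T'] unfolding coarse.represents_def
        by (intro AE_lebesgue_on_subset[where A = "tri (parent T')" and B = "tri T'"] tri_sets) auto
      moreover have "AE x in lebesgue_on (tri T'). cr_operator c x = aff (cr_coefs c T') x"
        using fine.represents_glue[of "cr_coefs c"] T' unfolding cr_operator_def fine.represents_def by blast
      ultimately show "AE x in lebesgue_on (tri T'). v x - cr_operator c x = aff (c (parent T') - cr_coefs c T') x"
        by eventually_elim (simp add: aff_minus_coefs)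
    qed
    show "0 \<le> ?e T" for T by (rule e0)
    show "0 \<le> 9 * C + 9 * C ^ 3" using C by simp
    fix T' assume T': "T' \<in> \<N>"
    have s: "shape_regular C T'" "shape_regular C (parent T')" using sr T' parent(1)[OF T'] by auto
    note ce = cr_error[OF C s T' b[OF parent(1)[OF T']]]
    show "(aff (c (parent T') - cr_coefs c T') x)\<^sup>2 \<le> 9 * ?e (parent T')" if "x \<in> tri T'" for x
      using ce(1)[OF _ that] e0 by simp
    show "(norm (fst (c (parent T') - cr_coefs c T')))\<^sup>2 \<le> (9 * C + 9 * C ^ 3) * ?e (parent T') / area (parent T')"
      using ce(2) e0 by simp
  qed simp
  also have "\<dots> \<le> (9 + (9 * C + 9 * C ^ 3)) * (((pi * C)\<^sup>2 + 1)\<^sup>2 * (3 * (pi * C)) * (\<Sum>S\<in>?R. coarse.side_indicator v S))"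
    using C by (intro mult_left_mono coarse.sum_local_error[OF R sr(1)]) auto
  finally show ?thesis by (simp only: mult.assoc)
qed

lemma (in mesh) companion_estimate:
  assumes v: "v \<in> CR10 \<Omega> (Mesh \<T>)" "represents c v" and C: "0 \<le> C" and sr: "\<forall>T\<in>\<T>. shape_regular C T"
  shows "(L2_norm \<Omega> (\<lambda>x. inverse (mesh_size \<T> x) * (v x - companion c x)))\<^sup>2
      + (L2_norm \<Omega> (nc_grad \<T> (\<lambda>x. v x - companion c x)))\<^sup>2
      \<le> transfer_constant C * (\<Sum>S\<in>sides (Mesh \<T>). side_indicator v S)"
proof -
  interpret self: refinement \<Omega> \<T> \<T> by unfold_locales blast
  have p: "self.parent T = T" if "T \<in> \<T>" for T
    using self.parent_unique[OF that self.parent(1)[OF that] that self.parent(2)[OF that]] by simp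
  let ?R = "sides (Mesh \<T>)"
  let ?e = "local_error C ?R v" and ?d = "\<lambda>T. c T - interpolant ?R c T"
  have e0: "0 \<le> ?e T" for T by (rule local_error_nonneg)
  have b: "\<bar>aff (?d T) z\<bar> \<le> sqrt (?e T)" if "T \<in> \<T>" "z \<in> vertices T" for T z
    by (rule interpolant_error[OF v order_refl sr that])
  have "(L2_norm \<Omega> (\<lambda>x. inverse (mesh_size \<T> x) * (v x - companion c x)))\<^sup>2
      + (L2_norm \<Omega> (nc_grad \<T> (\<lambda>x. v x - companion c x)))\<^sup>2 \<le> (9 + (9 * C + 9 * C ^ 3)) * (\<Sum>T\<in>\<T>. ?e T)"
  proof (rule self.error_estimate[where d = ?d])
    obtain K where "lipschitz_on K UNIV (companion c)" by (rule companion_lipschitz)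
    then have cm: "companion c \<in> borel_measurable (lebesgue_on \<Omega>)"
      by (intro continuous_imp_measurable_on_sets_lebesgue domain_sets continuous_on_subset[OF lipschitz_on_continuous_on]) auto
    have vm: "v \<in> borel_measurable (lebesgue_on \<Omega>)" using v(1) by (simp add: L2_def)
    from vm cm show "(\<lambda>x. v x - companion c x) \<in> borel_measurable (lebesgue_on \<Omega>)" by (rule borel_measurable_diff)
    show "represents ?d (\<lambda>x. v x - companion c x)" unfolding represents_def
    proof
      fix T assume T: "T \<in> \<T>"
      have "AE x in lebesgue_on (tri T). v x = aff (c T) x" using v(2) T unfolding represents_def by blast
      moreover have "AE x in lebesgue_on (tri T). companion c x = aff (interpolant ?R c T) x"
        by (rule AE_I2) (rule companion_eq[OF T], simp)
      ultimately show "AE x in lebesgue_on (tri T). v x - companion c x = aff (?d T) x"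
        by eventually_elim (simp add: aff_minus_coefs del: sides.simps)
    qed
    show "0 \<le> ?e T" for T by (rule e0)
    show "0 \<le> 9 * C + 9 * C ^ 3" using C by simp
    fix T assume T: "T \<in> \<T>"
    show "(aff (?d T) x)\<^sup>2 \<le> 9 * ?e (self.parent T)" if "x \<in> tri T" for x
    proof -
      have "\<bar>aff (?d T) x\<bar> \<le> sqrt (?e T)" using aff_bound_on_tri[OF nondeg[OF T] b[OF T] that] .
      then have "\<bar>aff (?d T) x\<bar>\<^sup>2 \<le> (sqrt (?e T))\<^sup>2" by (intro power_mono) auto
      then have "(aff (?d T) x)\<^sup>2 \<le> ?e T" using e0[of T] by simp
      then show ?thesis unfolding p[OF T] using e0[of T] by linarith
    qed
    have "(norm (fst (\<Sum>z\<in>vertices T. aff (?d T) z *\<^sub>R bary T z)))\<^sup>2 \<le> 9 * (sqrt (?e T))\<^sup>2 * (C / (4 * area T))"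
      using sr T by (intro gradient_bound nondeg b) auto
    then have "(norm (fst (?d T)))\<^sup>2 \<le> 9 * (sqrt (?e T))\<^sup>2 * (C / (4 * area T))"
      using affine_interpolation_coefs[OF nondeg[OF T], of "?d T"] by (simp only:)
    also have "\<dots> = (9 * C / 4) * ?e T / area T" using e0[of T] by simp
    also have "\<dots> \<le> (9 * C + 9 * C ^ 3) * ?e T / area T"
      using C e0[of T] area_pos[OF nondeg[OF T]] by (intro divide_right_mono mult_right_mono) auto
    finally show "(norm (fst (?d T)))\<^sup>2 \<le> (9 * C + 9 * C ^ 3) * ?e (self.parent T) / area (self.parent T)" 
      unfolding p[OF T] .
  qed simp
  also have "\<dots> \<le> (9 + (9 * C + 9 * C ^ 3)) * (((pi * C)\<^sup>2 + 1)\<^sup>2 * (3 * (pi * C)) * (\<Sum>S\<in>?R. side_indicator v S))"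
    using C by (intro mult_left_mono sum_local_error[OF order_refl sr]) auto
  finally show ?thesis by (simp only: mult.assoc)
qed

text \<open>Fixing the coefficients outside the triangulation makes the operator a function of the
  equivalence class.\<close>

definition mesh_coefs :: "marked_triangle set \<Rightarrow> (point \<Rightarrow> real) \<Rightarrow> marked_triangle \<Rightarrow> point \<times> real" where
  "mesh_coefs \<T> v T = (if T \<in> \<T> then coef v T else 0)"

context mesh begin

lemma mesh_coefs_represents: "v \<in> CR10 \<Omega> (Mesh \<T>) \<Longrightarrow> represents (mesh_coefs \<T> v) v"
  using represents_coef[of v] by (simp add: represents_def mesh_coefs_def)

lemma mesh_coefs_cong:
  assumes "AE x in lebesgue_on \<Omega>. v x = v' x" shows "mesh_coefs \<T> v = mesh_coefs \<T> v'"
proof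
  fix T
  show "mesh_coefs \<T> v T = mesh_coefs \<T> v' T"
    using assms coef_cong[where T = T and v = v and v' = v'] unfolding mesh_coefs_def AE_domain_iff by simp
qed

lemma respects_AE_mesh_coefs: "respects_AE \<Omega> V (\<lambda>v. J (mesh_coefs \<T> v))"
  unfolding respects_AE_def
proof (intro ballI impI)
  fix v v' :: "point \<Rightarrow> real" assume ae: "AE x in lebesgue_on \<Omega>. v x = v' x"
  show "AE x in lebesgue_on \<Omega>. J (mesh_coefs \<T> v) x = J (mesh_coefs \<T> v') x"
    unfolding mesh_coefs_cong[OF ae] by simp
qed

end

theorem theorem3p1:
  fixes \<Omega> :: "(real^2) set" and \<T>\<^sub>0 :: "marked_triangle set"
  assumes "polygonal_domain \<Omega>"
    and "conforming_triangulation \<Omega> \<T>\<^sub>0"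
    and "matching \<T>\<^sub>0"
  shows "\<exists>c>0. \<forall>\<T> \<in> admissible \<Omega> \<T>\<^sub>0. \<forall>\<T>\<^sub>s \<in> admissible_hat \<Omega> \<T>\<^sub>0.
    refined_by (Mesh \<T>) \<T>\<^sub>s \<longrightarrow>
    (\<exists>J. J \<in> CR10 \<Omega> (Mesh \<T>) \<rightarrow> CR10 \<Omega> \<T>\<^sub>s \<and> respects_AE \<Omega> (CR10 \<Omega> (Mesh \<T>)) J \<and>
      (\<forall>v \<in> CR10 \<Omega> (Mesh \<T>).
        (L2_norm \<Omega> (\<lambda>x. inverse (mesh_size \<T> x) * (v x - J v x)))\<^sup>2
        + (L2_norm \<Omega> (nc_grad (common_mesh \<T> \<T>\<^sub>s) (\<lambda>x. v x - J v x)))\<^sup>2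
        \<le> c * (\<Sum>S \<in> sides (Mesh \<T>) - sides \<T>\<^sub>s.
                side_length S * (L2_norm_side S (tangential_jump \<Omega> \<T> v S))\<^sup>2)))"
proof -
  have T0: "finite \<T>\<^sub>0" "\<forall>T\<in>\<T>\<^sub>0. nondegenerate T" using assms(2) by (auto simp: conforming_triangulation_def)
  obtain K where K: "K \<ge> 1" "\<forall>T\<in>\<T>\<^sub>0. shape_bound K T" using exists_shape_bound[OF T0] by blast
  define C where "C = 4 * K"
  have C: "0 < C" using K(1) by (simp add: C_def)
  have mesh: "mesh \<Omega> \<T>" if "\<T> \<in> admissible \<Omega> \<T>\<^sub>0" for \<T>
    using that assms(1) by (simp add: mesh_def admissible_def)
  have sr: "\<forall>T\<in>\<T>. shape_regular C T" if "\<T> \<in> admissible \<Omega> \<T>\<^sub>0" for \<T>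
  proof -
    have "bisection\<^sup>*\<^sup>* \<T>\<^sub>0 \<T>" using that by (simp add: admissible_def)
    then have "\<forall>T\<in>\<T>. shape_bound K T" using K(2) by (rule bisections_invariant) (rule shape_bound_child)
    then show ?thesis using shape_bound_regular mesh.nondeg[OF mesh[OF that]] unfolding C_def by blast
  qed
  show ?thesis
  proof (rule exI[of _ "transfer_constant C"], intro conjI ballI impI)
    have 1: "0 < 9 + (9 * C + 9 * C ^ 3)" using C by (intro add_pos_pos mult_pos_pos zero_less_power) auto
    have 2: "0 < ((pi * C)\<^sup>2 + 1)\<^sup>2" by (intro zero_less_power add_nonneg_pos) auto
    have 3: "0 < 3 * (pi * C)" using C by simp
    show "0 < transfer_constant C" by (rule mult_pos_pos[OF 1 mult_pos_pos[OF 2 3]])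
    fix \<T> \<T>\<^sub>s assume T: "\<T> \<in> admissible \<Omega> \<T>\<^sub>0" and Ts: "\<T>\<^sub>s \<in> admissible_hat \<Omega> \<T>\<^sub>0" and ref: "refined_by (Mesh \<T>) \<T>\<^sub>s"
    interpret coarse: mesh \<Omega> \<T> by (rule mesh[OF T])
    show "\<exists>J. J \<in> CR10 \<Omega> (Mesh \<T>) \<rightarrow> CR10 \<Omega> \<T>\<^sub>s \<and> respects_AE \<Omega> (CR10 \<Omega> (Mesh \<T>)) J \<and>
      (\<forall>v \<in> CR10 \<Omega> (Mesh \<T>).
        (L2_norm \<Omega> (\<lambda>x. inverse (mesh_size \<T> x) * (v x - J v x)))\<^sup>2
        + (L2_norm \<Omega> (nc_grad (common_mesh \<T> \<T>\<^sub>s) (\<lambda>x. v x - J v x)))\<^sup>2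
        \<le> transfer_constant C * (\<Sum>S \<in> sides (Mesh \<T>) - sides \<T>\<^sub>s.
                side_length S * (L2_norm_side S (tangential_jump \<Omega> \<T> v S))\<^sup>2))"
    proof (cases \<T>\<^sub>s)
      case Top
      let ?J = "\<lambda>v. coarse.companion (mesh_coefs \<T> v)"
      show ?thesis
      proof (intro exI[of _ ?J] conjI ballI)
        show "?J \<in> CR10 \<Omega> (Mesh \<T>) \<rightarrow> CR10 \<Omega> \<T>\<^sub>s"
          unfolding Top CR10.simps(2) using coarse.companion_H10 by blast
        show "respects_AE \<Omega> (CR10 \<Omega> (Mesh \<T>)) ?J" by (rule coarse.respects_AE_mesh_coefs)
        fix v assume v: "v \<in> CR10 \<Omega> (Mesh \<T>)"
        from coarse.companion_estimate[OF v coarse.mesh_coefs_represents[OF v] less_imp_le[OF C] sr[OF T],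
            unfolded coarse.side_indicator_def]
        show "(L2_norm \<Omega> (\<lambda>x. inverse (mesh_size \<T> x) * (v x - ?J v x)))\<^sup>2
            + (L2_norm \<Omega> (nc_grad (common_mesh \<T> \<T>\<^sub>s) (\<lambda>x. v x - ?J v x)))\<^sup>2
            \<le> transfer_constant C * (\<Sum>S \<in> sides (Mesh \<T>) - sides \<T>\<^sub>s.
                side_length S * (L2_norm_side S (tangential_jump \<Omega> \<T> v S))\<^sup>2)"
          unfolding Top common_mesh.simps(2) sides.simps(2) Diff_empty .
      qed
    next
      case (Mesh \<N>)
      then have N: "\<N> \<in> admissible \<Omega> \<T>\<^sub>0" using Ts by (auto simp: admissible_hat_def)
      have bis: "bisection\<^sup>*\<^sup>* \<T> \<N>" using ref Mesh by simp
      interpret fine: mesh \<Omega> \<N> by (rule mesh[OF N])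
      interpret refinement \<Omega> \<T> \<N> by unfold_locales (use bisections_subset[OF bis] in blast)
      let ?J = "\<lambda>v. cr_operator (mesh_coefs \<T> v)"
      show ?thesis
      proof (intro exI[of _ ?J] conjI ballI)
        show "?J \<in> CR10 \<Omega> (Mesh \<T>) \<rightarrow> CR10 \<Omega> \<T>\<^sub>s"
          unfolding Mesh using cr_operator_CR10 coarse.mesh_coefs_represents by blast
        show "respects_AE \<Omega> (CR10 \<Omega> (Mesh \<T>)) ?J" by (rule coarse.respects_AE_mesh_coefs)
        fix v assume v: "v \<in> CR10 \<Omega> (Mesh \<T>)"
        from cr_operator_estimate[OF v coarse.mesh_coefs_represents[OF v] less_imp_le[OF C] sr[OF T] sr[OF N],
            unfolded coarse.side_indicator_def]
        show "(L2_norm \<Omega> (\<lambda>x. inverse (mesh_size \<T> x) * (v x - ?J v x)))\<^sup>2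
            + (L2_norm \<Omega> (nc_grad (common_mesh \<T> \<T>\<^sub>s) (\<lambda>x. v x - ?J v x)))\<^sup>2
            \<le> transfer_constant C * (\<Sum>S \<in> sides (Mesh \<T>) - sides \<T>\<^sub>s.
                side_length S * (L2_norm_side S (tangential_jump \<Omega> \<T> v S))\<^sup>2)"
          unfolding Mesh common_mesh.simps(1) .
      qed
    qed
  qed
qed

end
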